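(* Let $(F,\Phi)$ be an $A$-module structure on a $q$-variety $F$ and let $r(F)=\dim_{K(T)}K(T)\otimes_{K[T]}K\{F\}$ be its rank. Then there exists $c\in A\setminus\{0\}$ such that for all $a\in A$ coprime to $c$, the $A$-module $\mathrm{Tor}(a,F):=\{x\in F:\Phi_a(x)=0\}$ is isomorphic to $(A/aA)^{r(F)}$.
   Context: $p$ prime, $K$ algebraically closed of characteristic $p$, $q$ a power of $p$, $\mathbb{F}_q\subset K$. $K\{\tau\}$ is the ring (under composition) of $\mathbb{F}_q$-linear polynomials $\sum a_iX^{q^i}$, $\tau=X^q$. $\Lambda_n$ is the left $K\{\tau\}$-module of polynomials $\sum_{i=1}^nP_i(X_i)$, $P_i\in K\{\tau\}$. A $q$-variety is a set $\{x\in K^n: f(x)=0\ \forall f\in S\}$ for some $S\subset\Lambda_n$. For $F\subset K^n$, $M(F)=\{f\in\Lambda_n: f|_F=0\}$ and $K\{F\}:=\Lambda_n/M(F)$. A morphism of $q$-varieties $F\subset K^n\to H\subset K^m$ is a map $x\mapsto(f_1(x),\dots,f_m(x))$, $f_j\in\Lambda_n$; $\mathrm{End}(F)$ is the ring of morphisms $F\to F$. For $f=\sum_iP_i(X_i)$, $d(f)$ is its linear part $\sum_i a_{0,i}X_i$ where $a_{0,i}$ is the coefficient of $X_i$ in $P_i$; $T(F)=\{x: d(f)(x)=0\ \forall f\in M(F)\}$ and $d(\psi)(x)=(d(f_1)(x),\dots,d(f_m)(x))$. $A=\mathbb{F}_q[T]$, $\delta:A\to K$ a fixed $\mathbb{F}_q$-algebra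 morphism. An $A$-module structure is an $\mathbb{F}_q$-algebra morphism $\Phi:A\to\mathrm{End}(F)$ with $d(\Phi_a)=\delta(a)\mathrm{Id}_{T(F)}$ for all $a$. $K\{F\}$ is a $K[T]$-module via $T\cdot f=f\circ\Phi_T$ and the $K$-vector space structure. $\mathrm{Tor}(a,F)$ is an $A$-module via $\Phi$. *)

theory Defs
  imports
    "HOL-Computational_Algebra.Computational_Algebra"
    "HOL-Algebra.QuotRing"
    "HOL-Algebra.Free_Abelian_Groups"
    "Jordan_Normal_Form.VS_Connect"
begin

section \<open>General module constructions\<close>

definition module_isomorphic ::
  "('r, 'c) ring_scheme \<Rightarrow> ('r, 'm, 'd) module_scheme \<Rightarrow> ('r, 'n, 'e) module_scheme \<Rightarrow> bool"
  where "module_isomorphic R M N \<longleftrightarrow>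
    (\<exists>h \<in> LinearCombinations.module_hom R M N. bij_betw h (carrier M) (carrier N))"

text \<open>The module \<open>R/I\<close> over \<open>R\<close>. As in \<^const>\<open>module_vec\<close>, the components \<open>mult\<close> and \<open>one\<close>
  of the record, which have no meaning for a module, are left unspecified here and below.\<close>

definition quotient_module :: "('r, 'c) ring_scheme \<Rightarrow> 'r set \<Rightarrow> ('r, 'r set) module"
  where "quotient_module R I =
    \<lparr>carrier = carrier (R Quot I), mult = undefined, one = undefined,
     ring.zero = \<zero>\<^bsub>R Quot I\<^esub>, add = ring.add (R Quot I),
     smult = (\<lambda>b C. (I +>\<^bsub>R\<^esub> b) \<otimes>\<^bsub>R Quot I\<^esub> C)\<rparr>"

definition module_power :: "('r, 'm, 'd) module_scheme \<Rightarrow> nat \<Rightarrow> ('r, nat \<Rightarrow> 'm) module"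
  where "module_power M r =
    \<lparr>carrier = {..<r} \<rightarrow>\<^sub>E carrier M, mult = undefined, one = undefined,
     ring.zero = (\<lambda>i\<in>{..<r}. \<zero>\<^bsub>M\<^esub>), add = (\<lambda>u v. \<lambda>i\<in>{..<r}. u i \<oplus>\<^bsub>M\<^esub> v i),
     smult = (\<lambda>b v. \<lambda>i\<in>{..<r}. b \<odot>\<^bsub>M\<^esub> v i)\<rparr>"

text \<open>The tensor product \<open>S \<otimes>\<^sub>R M\<close> along a ring morphism \<open>\<phi>\<close> from \<open>R\<close> to \<open>S\<close>, as the quotient of
  the free abelian group on the pairs \<open>(s, m)\<close> by the bilinearity relations and
  \<open>(s \<phi>(r), m) = (s, r m)\<close>; \<open>S\<close> acts on the left factor. The free abelian group of the library is
  written multiplicatively, but its group operation is the addition of finitely supported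
  functions.\<close>

definition tensor_relations ::
  "('r, 'c) ring_scheme \<Rightarrow> ('s, 'd) ring_scheme \<Rightarrow> ('r \<Rightarrow> 's) \<Rightarrow> ('r, 'm, 'e) module_scheme
    \<Rightarrow> ('s \<times> 'm \<Rightarrow>\<^sub>0 int) set"
  where "tensor_relations R S \<phi> M =
     {frag_of (s \<oplus>\<^bsub>S\<^esub> s', m) - frag_of (s, m) - frag_of (s', m) | s s' m.
        s \<in> carrier S \<and> s' \<in> carrier S \<and> m \<in> carrier M}
   \<union> {frag_of (s, m \<oplus>\<^bsub>M\<^esub> m') - frag_of (s, m) - frag_of (s, m') | s m m'.
        s \<in> carrier S \<and> m \<in> carrier M \<and> m' \<in> carrier M}
   \<union> {frag_of (s \<otimes>\<^bsub>S\<^esub> \<phi> r, m) - frag_of (s, r \<odot>\<^bsub>M\<^esub> m) | s r m.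
        s \<in> carrier S \<and> r \<in> carrier R \<and> m \<in> carrier M}"

definition extension_of_scalars ::
  "('r, 'c) ring_scheme \<Rightarrow> ('s, 'd) ring_scheme \<Rightarrow> ('r \<Rightarrow> 's) \<Rightarrow> ('r, 'm, 'e) module_scheme
    \<Rightarrow> ('s, ('s \<times> 'm \<Rightarrow>\<^sub>0 int) set) module"
  where "extension_of_scalars R S \<phi> M =
    (let G = free_Abelian_group (carrier S \<times> carrier M);
         N = generate G (tensor_relations R S \<phi> M)
     in \<lparr>carrier = carrier (G Mod N), mult = undefined, one = undefined,
         ring.zero = \<one>\<^bsub>G Mod N\<^esub>, add = monoid.mult (G Mod N),
         smult = (\<lambda>t C. \<Union>x\<in>C. N #>\<^bsub>G\<^esub> frag_extend (\<lambda>(s, m). frag_of (t \<otimes>\<^bsub>S\<^esub> s, m)) x)\<rparr>)"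


section \<open>\<open>q\<close>-varieties\<close>

text \<open>\<open>K{\<tau>}\<close>: the polynomials \<open>\<Sum> a\<^sub>i X^(q^i)\<close>.\<close>

definition Ktau :: "nat \<Rightarrow> 'k::field poly set"
  where "Ktau q = {P. \<forall>j. coeff P j \<noteq> 0 \<longrightarrow> (\<exists>i. j = q ^ i)}"

text \<open>A polynomial \<open>P\<^sub>1(X\<^sub>1) + \<dots> + P\<^sub>n(X\<^sub>n)\<close> of \<open>\<Lambda>\<^sub>n\<close> determines the \<open>P\<^sub>i\<close>, since these have no
  constant term; it is encoded as the vector of the \<open>P\<^sub>i\<close>.\<close>

definition Lam :: "nat \<Rightarrow> nat \<Rightarrow> 'k::field poly vec set"
  where "Lam q n = {f \<in> carrier_vec n. \<forall>i<n. f $ i \<in> Ktau q}"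

definition lam_eval :: "'k::field poly vec \<Rightarrow> 'k vec \<Rightarrow> 'k"
  where "lam_eval f x = (\<Sum>i<dim_vec f. poly (f $ i) (x $ i))"

definition lam_linear :: "'k::field poly vec \<Rightarrow> 'k vec \<Rightarrow> 'k"
  where "lam_linear f x = (\<Sum>i<dim_vec f. coeff (f $ i) 1 * x $ i)"

definition q_variety :: "nat \<Rightarrow> nat \<Rightarrow> 'k::field vec set \<Rightarrow> bool"
  where "q_variety q n F \<longleftrightarrow>
    (\<exists>S \<subseteq> Lam q n. F = {x \<in> carrier_vec n. \<forall>f\<in>S. lam_eval f x = 0})"

definition vanishing :: "nat \<Rightarrow> nat \<Rightarrow> 'k::field vec set \<Rightarrow> 'k poly vec set"
  where "vanishing q n F = {f \<in> Lam q n. \<forall>x\<in>F. lam_eval f x = 0}"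

definition tangent_space :: "nat \<Rightarrow> nat \<Rightarrow> 'k::field vec set \<Rightarrow> 'k vec set"
  where "tangent_space q n F = {x \<in> carrier_vec n. \<forall>f\<in>vanishing q n F. lam_linear f x = 0}"

text \<open>Morphisms are extensional functions, so that equality of morphisms is equality of functions.\<close>

definition represents ::
  "nat \<Rightarrow> nat \<Rightarrow> nat \<Rightarrow> 'k::field vec set \<Rightarrow> (nat \<Rightarrow> 'k poly vec) \<Rightarrow> ('k vec \<Rightarrow> 'k vec) \<Rightarrow> bool"
  where "represents q n m F fs \<psi> \<longleftrightarrow>
    (\<forall>j<m. fs j \<in> Lam q n) \<and> (\<forall>x\<in>F. \<psi> x = vec m (\<lambda>j. lam_eval (fs j) x))"

definition q_morphisms ::
  "nat \<Rightarrow> nat \<Rightarrow> nat \<Rightarrow> 'k::field vec set \<Rightarrow> 'k vec set \<Rightarrow> ('k vec \<Rightarrow> 'k vec) set"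
  where "q_morphisms q n m F H = {\<psi> \<in> F \<rightarrow>\<^sub>E H. \<exists>fs. represents q n m F fs \<psi>}"

definition End_ring :: "nat \<Rightarrow> nat \<Rightarrow> 'k::field vec set \<Rightarrow> ('k vec \<Rightarrow> 'k vec) ring"
  where "End_ring q n F =
    \<lparr>carrier = q_morphisms q n n F F, mult = compose F, one = (\<lambda>x\<in>F. x),
     ring.zero = (\<lambda>x\<in>F. 0\<^sub>v n), add = (\<lambda>\<psi> \<chi>. \<lambda>x\<in>F. \<psi> x + \<chi> x)\<rparr>"

definition morphism_differential ::
  "nat \<Rightarrow> (nat \<Rightarrow> 'k::field poly vec) \<Rightarrow> 'k vec \<Rightarrow> 'k vec"
  where "morphism_differential m fs x = vec m (\<lambda>j. lam_linear (fs j) x)"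

text \<open>On \<open>T(F)\<close> the differential depends only on the morphism, not on the representing polynomials.\<close>

lemma morphism_differential_unique:
  assumes fs: "represents q n m F fs \<psi>" and gs: "represents q n m F gs \<psi>"
    and x: "x \<in> tangent_space q n F"
  shows "morphism_differential m fs x = morphism_differential m gs x"
proof -
  have "lam_linear (fs j) x = lam_linear (gs j) x" if j: "j < m" for j
  proof -
    let ?h = "fs j - gs j"
    have f: "fs j \<in> Lam q n" and g: "gs j \<in> Lam q n"
      using fs gs j by (auto simp: represents_def)
    then have dims: "dim_vec (fs j) = n" "dim_vec (gs j) = n" "?h \<in> carrier_vec n"
      by (auto simp: Lam_def)
    have "?h $ i \<in> Ktau q" if "i < n" for i
    proof -
      have "fs j $ i \<in> Ktau q" "gs j $ i \<in> Ktau q" using f g that by (auto simp: Lam_def)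
      then have "fs j $ i - gs j $ i \<in> Ktau q"
        unfolding Ktau_def mem_Collect_eq coeff_diff by (metis diff_0_right)
      then show ?thesis using dims that by simp
    qed
    then have L: "?h \<in> Lam q n" using dims by (simp add: Lam_def)
    have "lam_eval ?h y = 0" if y: "y \<in> F" for y
    proof -
      have "vec m (\<lambda>j. lam_eval (fs j) y) = vec m (\<lambda>j. lam_eval (gs j) y)"
        using fs gs y by (simp add: represents_def)
      then have "lam_eval (fs j) y = lam_eval (gs j) y" using j by (metis index_vec)
      then show ?thesis using dims by (simp add: lam_eval_def sum_subtractf)
    qed
    with L have "lam_linear ?h x = 0"
      using x by (auto simp: tangent_space_def vanishing_def)
    then show ?thesis
      using dims by (simp add: lam_linear_def sum_subtractf left_diff_distrib)
  qed
  then show ?thesis by (auto simp: morphism_differential_def)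
qed


section \<open>\<open>A\<close>-modules\<close>

text \<open>\<open>A = \<F>\<^sub>q[T]\<close> is the type \<open>'f poly\<close> for a field \<open>'f\<close> with \<open>q\<close> elements, embedded in \<open>'k\<close> by
  \<open>\<iota>\<close>. A morphism of \<open>\<F>\<^sub>q\<close>-algebras is a unital ring morphism that sends a constant \<open>[:c:]\<close> to the
  scalar \<open>c\<close>.\<close>

definition A_algebra_hom_to_K :: "('f::field \<Rightarrow> 'k::field) \<Rightarrow> ('f poly \<Rightarrow> 'k) \<Rightarrow> bool"
  where "A_algebra_hom_to_K \<iota> \<delta> \<longleftrightarrow>
    comm_ring_hom \<delta> \<and> (\<forall>c. \<delta> [:c:] = \<iota> c)"

definition A_algebra_hom_to_End ::
  "nat \<Rightarrow> ('f::field \<Rightarrow> 'k::field) \<Rightarrow> nat \<Rightarrow> 'k vec set \<Rightarrow> ('f poly \<Rightarrow> 'k vec \<Rightarrow> 'k vec) \<Rightarrow> bool"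
  where "A_algebra_hom_to_End q \<iota> n F \<Phi> \<longleftrightarrow>
    \<Phi> \<in> Ring.ring_hom class_ring (End_ring q n F) \<and> (\<forall>c. \<Phi> [:c:] = (\<lambda>x\<in>F. \<iota> c \<cdot>\<^sub>v x))"

definition A_module_structure ::
  "nat \<Rightarrow> ('f::field \<Rightarrow> 'k::field) \<Rightarrow> ('f poly \<Rightarrow> 'k) \<Rightarrow> nat \<Rightarrow> 'k vec set
    \<Rightarrow> ('f poly \<Rightarrow> 'k vec \<Rightarrow> 'k vec) \<Rightarrow> bool"
  where "A_module_structure q \<iota> \<delta> n F \<Phi> \<longleftrightarrow>
    A_algebra_hom_to_End q \<iota> n F \<Phi> \<and>
    (\<forall>a fs. represents q n n F fs (\<Phi> a) \<longrightarrow>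
      (\<forall>x \<in> tangent_space q n F. morphism_differential n fs x = \<delta> a \<cdot>\<^sub>v x))"

text \<open>\<open>K{F} = \<Lambda>\<^sub>n/M(F)\<close> as a module over \<open>K[T]\<close>: with \<open>p = \<Sum> c\<^sub>i T\<^sup>i\<close>, the product \<open>p \<cdot> [f]\<close> is the
  class of \<open>\<Sum> c\<^sub>i (f \<circ> \<Phi>\<^sub>T \<circ> \<dots> \<circ> \<Phi>\<^sub>T)\<close>, i.e. the set of those elements of \<open>\<Lambda>\<^sub>n\<close> that
  agree with this function on \<open>F\<close>.\<close>

definition Lam_group :: "nat \<Rightarrow> nat \<Rightarrow> 'k::field poly vec ring"
  where "Lam_group q n =
    \<lparr>carrier = Lam q n, mult = undefined, one = undefined, ring.zero = 0\<^sub>v n, add = (+)\<rparr>"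

definition K_of ::
  "nat \<Rightarrow> nat \<Rightarrow> 'k::field vec set \<Rightarrow> ('f::field poly \<Rightarrow> 'k vec \<Rightarrow> 'k vec)
    \<Rightarrow> ('k poly, 'k poly vec set) module"
  where "K_of q n F \<Phi> =
    \<lparr>carrier = a_rcosets\<^bsub>Lam_group q n\<^esub> (vanishing q n F), mult = undefined, one = undefined,
     ring.zero = vanishing q n F, add = set_add (Lam_group q n),
     smult = (\<lambda>p C. {g \<in> Lam q n. \<exists>f\<in>C. \<forall>x\<in>F.
       lam_eval g x = (\<Sum>i\<le>degree p. coeff p i * lam_eval f ((\<Phi> [:0, 1:] ^^ i) x))})\<rparr>"

definition A_rank ::
  "nat \<Rightarrow> nat \<Rightarrow> 'k::field vec set \<Rightarrow> ('f::field poly \<Rightarrow> 'k vec \<Rightarrow> 'k vec) \<Rightarrow> nat"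
  where "A_rank q n F \<Phi> =
    vectorspace.dim (class_ring :: 'k poly fract ring)
      (extension_of_scalars class_ring class_ring to_fract (K_of q n F \<Phi>))"

definition Tor ::
  "nat \<Rightarrow> 'k::field vec set \<Rightarrow> ('f::field poly \<Rightarrow> 'k vec \<Rightarrow> 'k vec) \<Rightarrow> 'f poly
    \<Rightarrow> ('f poly, 'k vec) module"
  where "Tor n F \<Phi> a =
    \<lparr>carrier = {x \<in> F. \<Phi> a x = 0\<^sub>v n}, mult = undefined, one = undefined,
     ring.zero = 0\<^sub>v n, add = (+), smult = \<Phi>\<rparr>"

end

theory Submission
  imports Defs "HOL-Library.Function_Algebras"
begin

text \<open>Let \<open>M = K{F}\<close>, realised as the space of functions on \<open>F\<close>, with \<open>\<tau>\<close> acting by \<open>\<phi> \<mapsto> \<phi>\<^sup>q\<close>. A degree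
  count shows that \<open>M\<close> contains a maximal finite family \<open>e\<^sub>1, \<dots>, e\<^sub>r\<close> that is independent over \<open>K[T]\<close>,
  and \<open>r\<close> is the rank. Every generator \<open>X\<^sub>i\<close> of \<open>M\<close> over \<open>K{\<tau>}\<close> and every \<open>\<tau> e\<^sub>j\<close> is multiplied into
  the span of the \<open>e\<^sub>j\<close> by a nonzero polynomial; choose \<open>c\<close> divisible by the minimal polynomials over
  \<open>\<F>\<^sub>q\<close> of the algebraic roots of these polynomials and of \<open>\<delta>(T)\<close>. If \<open>a\<close> is coprime to \<open>c\<close>, then the
  elements of \<open>M\<close> that are multiplied into this span by a polynomial prime to \<open>a\<close> form a
  \<open>\<tau>\<close>-stable submodule that contains the \<open>X\<^sub>i\<close>, hence \<open>M\<close>; so \<open>M/aM\<close> is free over \<open>K[T]/a\<close> of rank \<open>r\<close>.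
  Since \<open>\<delta>(a) \<noteq> 0\<close>, \<open>\<tau>\<close> is surjective on \<open>M/aM\<close> up to \<open>K\<close>-span, and by Lang's theorem \<open>M/aM\<close> has a
  \<open>K\<close>-basis of \<open>\<tau>\<close>-fixed vectors. The points of \<open>Tor(a, F)\<close> are the \<open>K{\<tau>}\<close>-linear maps \<open>M/aM \<rightarrow> K\<close>,
  so there are \<open>q\<close> to the power \<open>r deg a\<close> of them. This count for all divisors of \<open>a\<close> determines the
  \<open>A\<close>-module \<open>Tor(a, F)\<close>.\<close>

text \<open>The obstacle is that \<open>K{F}\<close> is finitely generated over
  \<open>K{\<tau>}\<close> but in general not over \<open>K[T]\<close>. For \<open>F = K\<close>
  with \<open>T\<close> acting as multiplication by a transcendental \<open>\<theta>\<close>, the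
  rank is 0 and \<open>X^(q^k)\<close> is killed by \<open>T - \<theta>^(q^k)\<close>: there is
  torsion at infinitely many places, and no single denominator serves all of \<open>K{F}\<close>.
  Only finitely many conditions on \<open>a\<close> arise because \<open>\<tau>\<close> replaces a
  denominator \<open>P\<close> by the polynomial whose coefficients are the \<open>q\<close>-th
  powers, while a polynomial over \<open>\<F>\<^sub>q\<close> stays the same; so comaximality with
  \<open>a\<close> survives \<open>\<tau>\<close>. The condition on differentials enters at one
  place: modulo \<open>q\<close>-th powers \<open>a X_i\<close> equals
  \<open>\<delta>(a) X_i\<close>, so that every \<open>X_i\<close> lies in \<open>aM\<close> plus
  the span of \<open>\<tau> M\<close>. If \<open>\<delta>(a) = 0\<close>, then \<open>\<tau>\<close>
  may be nilpotent on \<open>M/aM\<close> and fixed vectors may be missing.\<close>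

no_notation fps_nth (infixl "$" 75)

lemma sum_fun_apply: "sum f A x = (\<Sum>i\<in>A. f i x :: 'a::comm_monoid_add)"
  by (induction A rule: infinite_finite_induct) auto

lemma degree_diff_eq_left: "degree b < degree a \<Longrightarrow> degree (a - b) = degree (a :: 'a::ab_group_add poly)"
  using degree_add_eq_left[of "- b" a] by simp

text \<open>Polynomials over a type of class \<^class>\<open>field\<close> have no \<open>gcd\<close> (this needs \<^class>\<open>field_gcd\<close>), hence
  coprimality is used in the form of a Bezout relation.\<close>

definition comaximal :: "'a::comm_ring_1 \<Rightarrow> 'a \<Rightarrow> bool"
  where "comaximal a b \<longleftrightarrow> (\<exists>u v. u * a + v * b = 1)"

lemma comaximal_mult_left:
  assumes "comaximal a c" "comaximal b c" shows "comaximal (a * b) c"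
proof -
  obtain u v u' v' where uv: "u * a + v * c = 1" "u' * b + v' * c = 1"
    using assms by (auto simp: comaximal_def)
  have "(u * a + v * c) * (u' * b + v' * c) = 1" using uv by simp
  then have "(u * u') * (a * b) + (u * a * v' + v * u' * b + v * c * v') * c = 1"
    by (simp add: algebra_simps)
  then show ?thesis unfolding comaximal_def by blast
qed

lemma comaximal_dvd_mult:
  assumes "comaximal a c" "c dvd a * b" shows "c dvd b"
proof -
  obtain u v where uv: "u * a + v * c = 1" using assms by (auto simp: comaximal_def)
  have "b = (u * a + v * c) * b" using uv by simp
  also have "\<dots> = u * (a * b) + c * (v * b)" by (simp add: algebra_simps)
  finally have "b = u * (a * b) + c * (v * b)" .
  then show ?thesis using assms(2) by (metis dvd_add dvd_mult dvd_triv_left)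
qed

lemma comaximal_dvd_right:
  assumes "comaximal a c" "d dvd c" shows "comaximal a d"
proof -
  obtain k where "c = d * k" using assms(2) by (rule dvdE)
  moreover obtain u v where "u * a + v * c = 1" using assms(1) by (auto simp: comaximal_def)
  ultimately have "u * a + (v * k) * d = 1" by (simp add: ac_simps)
  then show ?thesis unfolding comaximal_def by blast
qed

section \<open>Semilinear maps over an algebraically closed field\<close>

locale frobenius_space = vector_space scale
  for scale :: "'k::alg_closed_field \<Rightarrow> 'b::ab_group_add \<Rightarrow> 'b" (infixr "*s" 75) +
  fixes p e q :: nat
  assumes prime_p: "prime p" and char_p: "CHAR('k) = p" and e_pos: "e \<ge> 1" and q_def: "q = p ^ e"
begin

lemma q_ge_2: "q \<ge> 2"
  using prime_ge_2_nat[OF prime_p] e_pos unfolding q_def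
  by (metis One_nat_def Suc_leD le_trans numeral_2_eq_2 power_increasing power_one_right)

lemma of_nat_q: "of_nat q = (0 :: 'k)"
  using char_p e_pos by (simp add: q_def of_nat_eq_0_iff_char_dvd)

lemma frob_add: "((x :: 'k) + y) ^ q = x ^ q + y ^ q"
  by (rule freshmans_dream'[of _ e]) (use prime_p char_p q_def in auto)

lemma frob_sum: "(sum (f :: 'c \<Rightarrow> 'k) A) ^ q = (\<Sum>x\<in>A. f x ^ q)"
  using q_ge_2 by (induction A rule: infinite_finite_induct) (auto simp: frob_add)

lemma frob_root: "\<exists>y::'k. y ^ q = x"
proof -
  let ?P = "monom 1 q - [:x:]"
  have "degree ?P = q" using q_ge_2
    by (subst degree_diff_eq_left) (auto simp: degree_monom_eq)
  then have "degree ?P > 0" using q_ge_2 by simp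
  then obtain y where "poly ?P y = 0" using alg_closed_imp_poly_has_root by blast
  then show ?thesis by (auto simp: poly_monom intro: exI[of _ y])
qed

lemma artin_schreier_root: "\<exists>y::'k. y ^ q - y + d = 0"
proof -
  let ?P = "monom 1 q - [:-d, 1:]"
  have "degree ?P = q" using q_ge_2
    by (subst degree_diff_eq_left) (auto simp: degree_monom_eq)
  then have "degree ?P > 0" using q_ge_2 by simp
  then obtain y where "poly ?P y = 0" using alg_closed_imp_poly_has_root by blast
  then show ?thesis by (auto simp: poly_monom algebra_simps intro!: exI[of _ y])
qed

text \<open>The recursion expresses that \<open>\<Sum> y i \<sigma>\<^sup>i v\<close> is fixed by a \<open>q\<close>-semilinear map \<open>\<sigma>\<close> with
  \<open>\<sigma>\<^sup>k v = \<Sum> c i \<sigma>\<^sup>i v\<close>.\<close>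

lemma fixed_vector_recursion:
  fixes c :: "nat \<Rightarrow> 'k"
  assumes j: "j < k" "c j \<noteq> 0"
  shows "\<exists>y. y 0 = y (k - 1) ^ q * c 0 \<and>
    (\<forall>i. Suc i < k \<longrightarrow> y (Suc i) = y i ^ q + y (k - 1) ^ q * c (Suc i)) \<and> y (k - 1) \<noteq> 0"
proof -
  \<comment> \<open>With \<open>z = y (k - 1)\<close> as the unknown, the recursion makes every
    \<open>y i\<close> a polynomial \<open>Y i\<close> in \<open>z\<close>; what remains is to solve
    \<open>Y (k - 1) = z\<close> with \<open>z \<noteq> 0\<close>.\<close>
  define Y where "Y = rec_nat (monom (c 0) q) (\<lambda>i P. P ^ q + monom (c (Suc i)) q)"
  have Y0: "Y 0 = monom (c 0) q" and YS: "Y (Suc i) = Y i ^ q + monom (c (Suc i)) q" for i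
    by (simp_all add: Y_def)
  have Yz: "poly (Y i) 0 = 0" for i
    using q_ge_2 by (induction i) (auto simp: Y0 YS poly_monom power_0_left)
  have pm: "pderiv (monom a q) = 0" for a :: 'k
    by (simp add: pderiv_monom of_nat_q)
  have Yd: "pderiv (Y i) = 0" for i
    by (induction i) (auto simp: Y0 YS pm pderiv_add pderiv_power)
  have Yz0: "(\<forall>j\<le>i. c j = 0) \<Longrightarrow> Y i = 0" for i
    using q_ge_2 by (induction i) (auto simp: Y0 YS power_0_left)
  \<comment> \<open>Once some \<open>c j\<close> is nonzero the degree is at least \<open>q\<close>;
    the next \<open>q\<close>-th power has degree at least \<open>q * q\<close>, so the new term of
    degree \<open>q\<close> cannot cancel it.\<close>
  have Ydeg: "(\<exists>j\<le>i. c j \<noteq> 0) \<Longrightarrow> degree (Y i) \<ge> q" for i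
  proof (induction i)
    case 0 then show ?case by (simp add: Y0 degree_monom_eq)
  next
    case (Suc i)
    show ?case
    proof (cases "\<exists>j\<le>i. c j \<noteq> 0")
      case True
      then have *: "degree (Y i) \<ge> q" using Suc by blast
      then have "Y i \<noteq> 0" using q_ge_2 by auto
      then have d: "degree (Y i ^ q) = q * degree (Y i)" by (simp add: degree_power_eq)
      have "q * degree (Y i) \<ge> q * q" using * by simp
      moreover have "q * q > q" using q_ge_2 by simp
      ultimately have gt: "degree (Y i ^ q) > q" using d by linarith
      moreover have "degree (monom (c (Suc i)) q) \<le> q" by (simp add: degree_monom_le)
      ultimately have "degree (Y (Suc i)) = degree (Y i ^ q)"
        unfolding YS by (intro degree_add_eq_left) linarith
      then show ?thesis using gt by simp
    next
      case False
      then have z: "Y i = 0" using Yz0 by blast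
      have "c (Suc i) \<noteq> 0" using False Suc.prems by (auto simp: le_Suc_eq)
      then show ?thesis using z q_ge_2 by (simp add: YS degree_monom_eq power_0_left)
    qed
  qed
  \<comment> \<open>All \<open>Y i\<close> are polynomials in \<open>z ^ q\<close>, so
    \<open>H\<close> has derivative \<open>-1\<close> and 0 is a simple root. As the degree is at
    least \<open>q \<ge> 2\<close>, there is a root other than 0.\<close>
  define H where "H = Y (k - 1) - [:0, 1:]"
  have dY: "degree (Y (k - 1)) \<ge> q" using Ydeg[of "k - 1"] j by fastforce
  then have dH: "degree H \<ge> q"
    unfolding H_def using q_ge_2 by (subst degree_diff_eq_left) auto
  have "poly H 0 = 0" by (simp add: H_def Yz)
  then have "[:-0, 1:] dvd H" by (simp only: poly_eq_0_iff_dvd)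
  then obtain G where G: "H = [:0, 1:] * G" by (auto elim: dvdE)
  have "H \<noteq> 0" using dH q_ge_2 by auto
  then have "G \<noteq> 0" using G by auto
  then have "degree H = Suc (degree G)" unfolding G by (simp add: degree_mult_eq)
  then have "degree G > 0" using dH q_ge_2 by linarith
  then obtain z where z: "poly G z = 0" using alg_closed_imp_poly_has_root by blast
  have "poly (pderiv H) 0 = poly G 0" unfolding G by (simp add: pderiv_mult pderiv_pCons)
  moreover have "poly (pderiv H) 0 = -1" unfolding H_def by (simp add: pderiv_diff Yd pderiv_pCons)
  ultimately have z0: "z \<noteq> 0" using z by auto
  have "poly H z = 0" using z G by simp
  then have Yk: "poly (Y (k - 1)) z = z" by (simp add: H_def)
  show ?thesis
    by (rule exI[of _ "\<lambda>i. poly (Y i) z"]) (use Yk z0 in \<open>auto simp: Y0 YS poly_monom mult.commute\<close>)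
qed

section \<open>Lang's theorem for semilinear maps\<close>

lemma in_span_family:
  assumes "finite I" "x \<in> span (f ` I)"
  obtains c where "x = (\<Sum>i\<in>I. c i *s f i)"
  using assms
proof (induction I arbitrary: x thesis)
  case empty then show ?case by simp
next
  case (insert j I)
  from insert.prems obtain k where k: "x - k *s f j \<in> span (f ` I)"
    by (auto simp: span_insert)
  obtain c where c: "x - k *s f j = (\<Sum>i\<in>I. c i *s f i)" using insert.IH[OF _ k] by blast
  have "x = (\<Sum>i\<in>insert j I. (c(j := k)) i *s f i)"
    using insert.hyps c by (auto simp: algebra_simps intro!: sum.cong)
  then show ?case using insert.prems by blast
qed

text \<open>Take a maximal independent set \<open>B\<close> of fixed vectors. If it did not span
  \<open>W\<close>, the orbit of a vector outside \<open>span B\<close> would yield a vector that is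
  fixed modulo \<open>span B\<close>, and Artin-Schreier equations would correct it to a fixed
  vector outside \<open>span B\<close>.\<close>

theorem lang:
  assumes W: "subspace W" "finite S" "W \<subseteq> span S"
    and \<sigma>: "\<And>x. x \<in> W \<Longrightarrow> \<sigma> x \<in> W" "\<And>x y. x \<in> W \<Longrightarrow> y \<in> W \<Longrightarrow> \<sigma> (x + y) = \<sigma> x + \<sigma> y"
      "\<And>c x. x \<in> W \<Longrightarrow> \<sigma> (c *s x) = c ^ q *s \<sigma> x"
    and surj: "W \<subseteq> span (\<sigma> ` W)"
  obtains B where "B \<subseteq> W" "independent B" "finite B" "W \<subseteq> span B" "\<And>b. b \<in> B \<Longrightarrow> \<sigma> b = b"
proof -
  have bound: "finite B \<and> card B \<le> card S" if "independent B" "B \<subseteq> W" for B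
    using independent_span_bound[OF W(2) that(1)] that W by blast
  have \<sigma>0: "\<sigma> 0 = 0" using \<sigma>(3)[of 0 0] W(1) q_ge_2 by (simp add: subspace_0 power_0_left)
  have \<sigma>sum: "\<sigma> (\<Sum>i\<in>I. c i *s f i) = (\<Sum>i\<in>I. c i ^ q *s \<sigma> (f i))"
    if "\<And>i. i \<in> I \<Longrightarrow> f i \<in> W" for I c and f :: "'c \<Rightarrow> 'b"
    using that
  proof (induction I rule: infinite_finite_induct)
    case (insert x F)
    have "(\<Sum>i\<in>F. c i *s f i) \<in> W" "c x *s f x \<in> W"
      using insert.prems W(1) by (auto intro!: subspace_sum subspace_scale)
    then show ?case using insert by (simp add: \<sigma>)
  qed (auto simp: \<sigma>0)
  \<comment> \<open>A kernel vector could be completed to a basis \<open>B\<close> of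
    \<open>W\<close>, and then the image of \<sigma> would be spanned by the images of the other
    \<open>card B - 1\<close> vectors.\<close>
  have inj: "v = 0" if v: "v \<in> W" "\<sigma> v = 0" for v
  proof (rule ccontr)
    assume "v \<noteq> 0"
    then have iv: "independent {v}" by simp
    obtain B where B: "{v} \<subseteq> B" "B \<subseteq> W" "independent B" "W \<subseteq> span B"
      using maximal_independent_subset_extend[of "{v}" W, OF _ iv] v by blast
    have fB: "finite B" using bound B by blast
    have "\<sigma> x \<in> span (\<sigma> ` (B - {v}))" if "x \<in> W" for x
    proof -
      have "x \<in> span (id ` B)" using that B by auto
      then obtain c where c: "x = (\<Sum>b\<in>B. c b *s id b)" using in_span_family[OF fB] by blast
      have "\<sigma> x = (\<Sum>b\<in>B. c b ^ q *s \<sigma> (id b))"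
        unfolding c using B by (intro \<sigma>sum) auto
      also have "\<dots> \<in> span (\<sigma> ` (B - {v}))"
        using v by (intro span_sum) (metis DiffI empty_iff id_apply image_eqI insert_iff scale_zero_right span_base span_scale span_zero)
      finally show ?thesis .
    qed
    then have "B \<subseteq> span (\<sigma> ` (B - {v}))"
      using B surj by (metis image_subset_iff span_minimal subset_trans subspace_span)
    then have "card B \<le> card (\<sigma> ` (B - {v}))"
      using independent_span_bound[of "\<sigma> ` (B - {v})" B] B(3) fB by simp
    also have "\<dots> \<le> card (B - {v})" using fB by (intro card_image_le) auto
    also have "\<dots> < card B" using fB B by (intro card_Diff1_less) auto
    finally show False by simp
  qed
  define \<C> where "\<C> = {B. B \<subseteq> W \<and> independent B \<and> (\<forall>b\<in>B. \<sigma> b = b)}"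
  have "{} \<in> \<C>" by (auto simp: \<C>_def independent_empty)
  moreover have "\<forall>B. B \<in> \<C> \<longrightarrow> card B < Suc (card S)" using bound by (auto simp: \<C>_def less_Suc_eq_le)
  ultimately obtain B where B: "B \<in> \<C>" and Bmax: "\<And>B'. B' \<in> \<C> \<Longrightarrow> card B' \<le> card B"
    using ex_has_greatest_nat[of "\<lambda>B. B \<in> \<C>" "{}" card "Suc (card S)"] by blast
  have BW: "B \<subseteq> W" and iB: "independent B" and Bfix: "\<And>b. b \<in> B \<Longrightarrow> \<sigma> b = b"
    using B by (auto simp: \<C>_def)
  have fB: "finite B" using bound BW iB by blast
  have BWs: "span B \<subseteq> W" using BW W(1) by (simp add: span_minimal)
  have "W \<subseteq> span B"
  proof (rule ccontr)
    assume "\<not> W \<subseteq> span B"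
    then obtain v where v: "v \<in> W" "v \<notin> span B" by blast
    \<comment> \<open>At the least \<open>k\<close> for which \<open>s k\<close> depends on
      \<open>B\<close> and the earlier vectors, \<open>s k = u + (\<Sum>i<k. c i *s s i)\<close>
      with \<open>u\<close> in \<open>span B\<close>. This is the relation needed for the recursion,
      up to the error \<open>u\<close>.\<close>
    define s where "s i = (\<sigma> ^^ i) v" for i
    have s0: "s 0 = v" and sS: "s (Suc i) = \<sigma> (s i)" for i by (auto simp: s_def)
    have sW: "s i \<in> W" for i by (induction i) (auto simp: s0 sS v \<sigma>)
    define P where "P k \<longleftrightarrow> s k \<in> span (B \<union> s ` {..<k})" for k
    have "\<exists>k. P k"
    proof (rule ccontr)
      assume nP: "\<nexists>k. P k"
      have *: "independent (B \<union> s ` {..<k}) \<and> card (s ` {..<k}) = k" for k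
      proof (induction k)
        case 0 then show ?case using iB by simp
      next
        case (Suc k)
        have n: "s k \<notin> span (B \<union> s ` {..<k})" using nP by (simp add: P_def)
        have eq: "B \<union> s ` {..<Suc k} = insert (s k) (B \<union> s ` {..<k})"
          by (simp add: lessThan_Suc)
        have "s k \<notin> s ` {..<k}" using n span_base[of "s k" "B \<union> s ` {..<k}"] by (meson UnI2)
        then have "card (s ` {..<Suc k}) = Suc k" using Suc by (simp add: lessThan_Suc)
        moreover have "independent (B \<union> s ` {..<Suc k})"
          unfolding eq by (rule independent_insertI[OF n]) (use Suc in blast)
        ultimately show ?case by blast
      qed
      have "card (s ` {..<Suc (card S)}) \<le> card (B \<union> s ` {..<Suc (card S)})"
        using fB by (intro card_mono) auto
      moreover have "card (B \<union> s ` {..<Suc (card S)}) \<le> card S"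
        using bound[of "B \<union> s ` {..<Suc (card S)}"] *[of "Suc (card S)"] BW sW by auto
      ultimately show False using *[of "Suc (card S)"] by linarith
    qed
    define k where "k = (LEAST k. P k)"
    have Pk: "P k" unfolding k_def using \<open>\<exists>k. P k\<close> by (metis LeastI)
    have nPk: "\<not> P i" if "i < k" for i using that not_less_Least unfolding k_def by blast
    have kpos: "k > 0" using Pk v s0 P_def by (cases k) auto
    then have k1: "k - 1 < k" by simp
    have not_in: "s (k - 1) \<notin> span (B \<union> s ` {..<k - 1})" using nPk[OF k1] by (simp add: P_def)
    obtain u w where u: "u \<in> span B" and w: "w \<in> span (s ` {..<k})" and skuw: "s k = u + w"
      using Pk by (auto simp: P_def span_Un)
    obtain c where c: "w = (\<Sum>i<k. c i *s s i)" using in_span_family[OF _ w] by blast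
    obtain d where d: "u = (\<Sum>b\<in>B. d b *s id b)" using in_span_family[of B u id] u fB by auto
    \<comment> \<open>Otherwise \<sigma> maps \<open>s (k - 1)\<close> to \<open>u\<close>. Taking
      \<open>q\<close>-th roots of the coordinates of \<open>u\<close> gives a vector of
      \<open>span B\<close> with the same image, and injectivity puts \<open>s (k - 1)\<close> into
      \<open>span B\<close>, against the minimality of \<open>k\<close>.\<close>
    have "\<exists>j<k. c j \<noteq> 0"
    proof (rule ccontr)
      assume "\<not> (\<exists>j<k. c j \<noteq> 0)"
      then have "w = 0" unfolding c by (intro sum.neutral) auto
      then have sk: "s k = u" using skuw by simp
      have "\<forall>b. \<exists>y. y ^ q = d b" using frob_root by blast
      then obtain r where r: "\<And>b. r b ^ q = d b" using choice[of "\<lambda>b y. y ^ q = d b"] by blast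
      let ?x = "\<Sum>b\<in>B. r b *s id b"
      have xB: "?x \<in> span B" by (intro span_sum span_scale span_base) auto
      have "\<sigma> ?x = (\<Sum>b\<in>B. r b ^ q *s \<sigma> (id b))" using BW by (intro \<sigma>sum) auto
      then have "\<sigma> ?x = u" unfolding d r by (simp add: Bfix)
      moreover have "\<sigma> (s (k - 1)) = u" using sk sS[of "k - 1"] kpos by simp
      moreover have "\<sigma> (- ?x) = - \<sigma> ?x"
      proof -
        have "- ?x \<in> W" "?x \<in> W" using xB BWs W(1) subspace_neg by blast+
        from \<sigma>(2)[OF this] have "\<sigma> (- ?x) + \<sigma> ?x = 0" by (simp add: \<sigma>0)
        then show ?thesis by (simp add: eq_neg_iff_add_eq_0)
      qed
      moreover have "- ?x \<in> W" using xB BWs W(1) subspace_neg by blast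
      ultimately have "\<sigma> (s (k - 1) + - ?x) = 0" using \<sigma>(2)[OF sW]
        by (simp del: add_uminus_conv_diff)
      then have "s (k - 1) + - ?x = 0"
        using inj[of "s (k - 1) + - ?x"] \<open>- ?x \<in> W\<close> sW W(1) subspace_add by blast
      then have "s (k - 1) = ?x" by simp
      then have "s (k - 1) \<in> span B" using xB by simp
      then show False using not_in span_mono[of B "B \<union> s ` {..<k - 1}"] by blast
    qed
    then obtain j where j: "j < k" "c j \<noteq> 0" by blast
    obtain y where y0: "y 0 = y (k - 1) ^ q * c 0"
      and yS: "\<And>i. Suc i < k \<Longrightarrow> y (Suc i) = y i ^ q + y (k - 1) ^ q * c (Suc i)"
      and yk: "y (k - 1) \<noteq> 0" using fixed_vector_recursion[where c = c, OF j] by blast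
    define z where "z = y (k - 1)"
    define x where "x = (\<Sum>i<k. y i *s s i)"
    have xW: "x \<in> W" unfolding x_def using W(1) sW by (intro subspace_sum subspace_scale) auto
    obtain k' where k': "k = Suc k'" using kpos by (cases k) auto
    have yk'[simp]: "y k' = z" by (simp add: z_def k')
    have "\<sigma> x = (\<Sum>i<k. y i ^ q *s s (Suc i))" unfolding x_def sS using sW by (intro \<sigma>sum) auto
    also have "\<dots> = (\<Sum>i<k'. y i ^ q *s s (Suc i)) + z ^ q *s s k" unfolding k' by simp
    also have "z ^ q *s s k = z ^ q *s u + (\<Sum>i<k. (z ^ q * c i) *s s i)"
      unfolding skuw c by (simp add: scale_right_distrib scale_sum_right)
    also have "(\<Sum>i<k. (z ^ q * c i) *s s i) =
        (z ^ q * c 0) *s s 0 + (\<Sum>i<k'. (z ^ q * c (Suc i)) *s s (Suc i))"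
      unfolding k' by (simp add: sum.lessThan_Suc_shift del: sum.lessThan_Suc)
    also have "(\<Sum>i<k'. y i ^ q *s s (Suc i)) + (z ^ q *s u + ((z ^ q * c 0) *s s 0 + (\<Sum>i<k'. (z ^ q * c (Suc i)) *s s (Suc i))))
        = z ^ q *s u + (y 0 *s s 0 + (\<Sum>i<k'. y (Suc i) *s s (Suc i)))"
    proof -
      have "(\<Sum>i<k'. y (Suc i) *s s (Suc i)) =
          (\<Sum>i<k'. y i ^ q *s s (Suc i)) + (\<Sum>i<k'. (z ^ q * c (Suc i)) *s s (Suc i))"
        unfolding sum.distrib[symmetric] using yS k'
        by (intro sum.cong) (auto simp: z_def[symmetric] scale_left_distrib)
      then show ?thesis using y0[folded z_def] by (simp add: algebra_simps)
    qed
    also have "y 0 *s s 0 + (\<Sum>i<k'. y (Suc i) *s s (Suc i)) = x"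
      unfolding x_def k' by (simp add: sum.lessThan_Suc_shift del: sum.lessThan_Suc)
    finally have \<sigma>x: "\<sigma> x = z ^ q *s u + x" .
    \<comment> \<open>Here the recursion must have a nonzero last coefficient \<open>z\<close>: it
      is the coefficient of \<open>s (k - 1)\<close>, which is independent of \<open>B\<close> and
      the earlier vectors.\<close>
    have xn: "x \<notin> span B"
    proof
      assume "x \<in> span B"
      then have xb: "x \<in> span (B \<union> s ` {..<k'})" using span_mono[of B "B \<union> s ` {..<k'}"] by blast
      have "x = (\<Sum>i<k'. y i *s s i) + z *s s k'" unfolding x_def k' by simp
      moreover have "(\<Sum>i<k'. y i *s s i) \<in> span (B \<union> s ` {..<k'})"
        by (intro span_sum span_scale span_base) auto
      ultimately have "z *s s k' \<in> span (B \<union> s ` {..<k'})"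
        using xb by (simp add: span_add_eq)
      then have "inverse z *s z *s s k' \<in> span (B \<union> s ` {..<k'})" by (rule span_scale)
      moreover have "z \<noteq> 0" using yk z_def by simp
      ultimately show False using not_in k' by simp
    qed
    \<comment> \<open>Adding \<open>\<Sum>b\<in>B. t b *s b\<close> to \<open>x\<close> changes
      \<open>\<sigma> x - x\<close> by \<open>\<Sum>b\<in>B. (t b ^ q - t b) *s b\<close>, which has
      to cancel the error \<open>z ^ q *s u\<close>.\<close>
    have "\<forall>b. \<exists>y. y ^ q - y + z ^ q * d b = 0" using artin_schreier_root by blast
    then obtain t where t: "\<And>b. t b ^ q - t b + z ^ q * d b = 0"
      using choice[of "\<lambda>b y. y ^ q - y + z ^ q * d b = 0"] by blast
    let ?t = "\<Sum>b\<in>B. t b *s id b"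
    have tB: "?t \<in> span B" by (intro span_sum span_scale span_base) auto
    have "\<sigma> (x + ?t) = \<sigma> x + \<sigma> ?t" using \<sigma>(2) xW tB BWs by blast
    also have "\<sigma> ?t = (\<Sum>b\<in>B. t b ^ q *s \<sigma> (id b))" using BW by (intro \<sigma>sum) auto
    also have "\<dots> = (\<Sum>b\<in>B. t b *s b) - (\<Sum>b\<in>B. (z ^ q * d b) *s b)"
      unfolding sum_subtractf[symmetric]
    proof (intro sum.cong refl)
      fix b assume "b \<in> B"
      have "t b ^ q = t b - z ^ q * d b" using t[of b] by (simp add: algebra_simps)
      then show "t b ^ q *s \<sigma> (id b) = t b *s b - (z ^ q * d b) *s b"
        using Bfix[OF \<open>b \<in> B\<close>] by (simp add: scale_left_diff_distrib)
    qed
    also have "(\<Sum>b\<in>B. (z ^ q * d b) *s b) = z ^ q *s u"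
      unfolding d by (simp add: scale_sum_right)
    finally have fixx: "\<sigma> (x + ?t) = x + ?t" unfolding \<sigma>x by simp
    have xtn: "x + ?t \<notin> span B" using xn tB span_add_eq2 by blast
    have "insert (x + ?t) B \<in> \<C>"
      using BW fixx Bfix iB xtn xW tB BWs W(1) subspace_add[OF W(1)]
      by (auto simp: \<C>_def independent_insert)
    moreover have "x + ?t \<notin> B" using xtn span_base by blast
    ultimately show False using Bmax[of "insert (x + ?t) B"] fB by simp
  qed
  then show thesis using that BW iB fB Bfix by blast
qed

end

section \<open>Modules over \<open>K[T]\<close> with a Frobenius map\<close>

context vector_space
begin

lemma semilinear_span:
  assumes add: "\<And>x y. f (x + y) = f x + f y" and scl: "\<And>c x. f (scale c x) = scale (g c) (f x)"
    and S: "\<And>x. x \<in> S \<Longrightarrow> f x \<in> span S" and "x \<in> span S"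
  shows "f x \<in> span S"
  using assms(4)
proof (induction rule: span_induct_alt)
  case base
  have "f 0 = 0" using add[of 0 0] by simp
  then show ?case by (simp add: span_zero)
next
  case (step c x y)
  then show ?case using S by (simp add: add scl span_add span_scale)
qed

lemma independent_family_card_le:
  assumes "finite I" "finite S" "f ` I \<subseteq> span S"
    and indep: "\<And>c i. (\<Sum>i\<in>I. scale (c i) (f i)) = 0 \<Longrightarrow> i \<in> I \<Longrightarrow> c i = 0"
  shows "inj_on f I" "independent (f ` I)" "card I \<le> card S"
proof -
  show inj: "inj_on f I"
  proof (rule inj_onI, rule ccontr)
    fix i j assume ij: "i \<in> I" "j \<in> I" "f i = f j" "i \<noteq> j"
    define c where "c k = (if k = i then 1 else if k = j then -1 else (0::'a))" for k
    have "(\<Sum>k\<in>I. scale (c k) (f k)) = (\<Sum>k\<in>{i, j}. scale (c k) (f k))"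
      using ij assms(1) by (intro sum.mono_neutral_right) (auto simp: c_def)
    also have "\<dots> = 0" using ij by (simp add: c_def)
    finally have "c i = 0" using indep ij by blast
    then show False by (simp add: c_def)
  qed
  show ind: "independent (f ` I)"
  proof
    assume "dependent (f ` I)"
    then obtain u where u: "\<exists>v\<in>f ` I. u v \<noteq> 0" "(\<Sum>v\<in>f ` I. scale (u v) v) = 0"
      using dependent_finite[of "f ` I"] assms(1) by auto
    have "(\<Sum>i\<in>I. scale (u (f i)) (f i)) = 0"
      using u(2) inj by (simp add: sum.reindex)
    then show False using indep[of "\<lambda>i. u (f i)"] u(1) by blast
  qed
  have "card (f ` I) \<le> card S"
    using independent_span_bound[OF assms(2) ind assms(3)] by simp
  then show "card I \<le> card S" using card_image[OF inj] by simp
qed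

end

section \<open>The \<open>K[T]\<close>-module of a linear operator\<close>

locale linear_operator = vector_space scale
  for scale :: "'k::field \<Rightarrow> 'b::ab_group_add \<Rightarrow> 'b" (infixr "*s" 75) +
  fixes T :: "'b \<Rightarrow> 'b"
  assumes T_add: "T (x + y) = T x + T y" and T_scale: "T (c *s x) = c *s T x"
begin

definition act :: "'k poly \<Rightarrow> 'b \<Rightarrow> 'b"
  where "act P x = (\<Sum>i\<le>degree P. coeff P i *s (T ^^ i) x)"

lemma T_0 [simp]: "T 0 = 0" using T_scale[of 0 0] by simp

lemma T_sum: "T (sum f A) = (\<Sum>x\<in>A. T (f x))"
  by (induction A rule: infinite_finite_induct) (auto simp: T_add)

lemma Tpow_add: "(T ^^ i) (x + y) = (T ^^ i) x + (T ^^ i) y"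
  by (induction i) (auto simp: T_add)

lemma Tpow_scale: "(T ^^ i) (c *s x) = c *s (T ^^ i) x"
  by (induction i) (auto simp: T_scale)

lemma act_bound: "degree P \<le> N \<Longrightarrow> act P x = (\<Sum>i\<le>N. coeff P i *s (T ^^ i) x)"
  unfolding act_def by (rule sum.mono_neutral_left) (auto simp: coeff_eq_0)

lemma act_0 [simp]: "act 0 x = 0" by (simp add: act_def)

lemma act_add_left: "act (P + Q) x = act P x + act Q x"
proof -
  let ?N = "max (degree P) (degree Q)"
  have "degree (P + Q) \<le> ?N" by (simp add: degree_add_le)
  then show ?thesis
    by (simp add: act_bound[of _ ?N] coeff_add scale_left_distrib sum.distrib)
qed

lemma act_smult: "act (Polynomial.smult c P) x = c *s act P x"
proof -
  have "degree (Polynomial.smult c P) \<le> degree P" by (rule degree_smult_le)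
  then show ?thesis by (simp add: act_bound[of _ "degree P"] scale_sum_right)
qed

lemma act_minus_left: "act (- P) x = - act P x"
  using act_smult[of "-1" P x] by simp

lemma act_diff_left: "act (P - Q) x = act P x - act Q x"
  using act_add_left[of P "- Q" x] by (simp add: act_minus_left)

lemma act_add: "act P (x + y) = act P x + act P y"
  by (simp add: act_def Tpow_add scale_right_distrib sum.distrib)

lemma act_scale: "act P (c *s x) = c *s act P x"
  by (simp add: act_def Tpow_scale scale_sum_right mult.commute)

lemma act_zero [simp]: "act P 0 = 0" using act_scale[of P 0 0] by simp

lemma act_minus: "act P (- x) = - act P x"
  using act_scale[of P "-1" x] by simp

lemma act_diff: "act P (x - y) = act P x - act P y"
  using act_add[of P x "- y"] by (simp add: act_minus)

lemma act_sum: "act P (sum f A) = (\<Sum>x\<in>A. act P (f x))"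
  by (induction A rule: infinite_finite_induct) (auto simp: act_add)

lemma act_sum_left: "act (sum f A) x = (\<Sum>i\<in>A. act (f i) x)"
  by (induction A rule: infinite_finite_induct) (auto simp: act_add_left)

lemma act_pCons: "act (pCons a P) x = a *s x + T (act P x)"
proof -
  have "act (pCons a P) x = (\<Sum>i\<le>Suc (degree P). coeff (pCons a P) i *s (T ^^ i) x)"
    by (rule act_bound) (simp add: degree_pCons_le)
  also have "\<dots> = a *s x + (\<Sum>i\<le>degree P. coeff P i *s (T ^^ Suc i) x)"
    by (subst sum.atMost_Suc_shift) simp
  also have "(\<Sum>i\<le>degree P. coeff P i *s (T ^^ Suc i) x) = T (act P x)"
    by (simp add: act_def T_sum T_scale)
  finally show ?thesis .
qed

lemma act_mult: "act (P * Q) x = act P (act Q x)"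
  by (induction P) (auto simp: act_pCons act_add_left act_smult)

lemma act_1 [simp]: "act 1 x = x" by (simp add: act_def)

lemma act_monom: "act (monom c k) x = c *s (T ^^ k) x"
  by (induction k) (auto simp: monom_Suc act_pCons monom_0 T_scale)

lemma act_closed:
  assumes "subspace R" "\<And>y. y \<in> R \<Longrightarrow> T y \<in> R" "x \<in> R"
  shows "act P x \<in> R"
  by (induction P) (use assms in \<open>auto simp: act_pCons intro: subspace_0 subspace_add subspace_scale\<close>)

lemma act_eq_sum_lessThan:
  assumes "P = 0 \<or> degree P < d"
  shows "act P x = (\<Sum>k<d. coeff P k *s (T ^^ k) x)"
proof (cases d)
  case 0 then show ?thesis using assms by simp
next
  case (Suc d')
  then have "degree P \<le> d'" using assms by auto
  then show ?thesis by (simp add: act_bound[of _ d'] Suc lessThan_Suc_atMost)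
qed

end

text \<open>Abstract form of \<open>K{F}\<close>: \<open>R\<close> sits in a larger space on which
  \<open>T\<close> and \<tau> are total, so that their identities carry no membership conditions.
  The last assumption says that \<open>R\<close> is generated by \<open>n\<close> elements over
  \<open>K{\<tau>}\<close>.\<close>

locale frobenius_module = frobenius_space scale p e q + linear_operator scale T
  for scale :: "'k::alg_closed_field \<Rightarrow> 'b::ab_group_add \<Rightarrow> 'b" (infixr "*s" 75) and p e q T +
  fixes \<tau> :: "'b \<Rightarrow> 'b" and R :: "'b set" and X :: "nat \<Rightarrow> 'b" and n :: nat
  assumes \<tau>_add: "\<tau> (x + y) = \<tau> x + \<tau> y" and \<tau>_scale: "\<tau> (c *s x) = c ^ q *s \<tau> x"
    and T_\<tau>: "T (\<tau> x) = \<tau> (T x)"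
    and R_subspace: "subspace R" and R_T: "x \<in> R \<Longrightarrow> T x \<in> R" and R_\<tau>: "x \<in> R \<Longrightarrow> \<tau> x \<in> R"
    and X_R: "i < n \<Longrightarrow> X i \<in> R"
    and R_gen: "R \<subseteq> span {(\<tau> ^^ k) (X i) | k i. i < n}"
begin

lemma \<tau>_0 [simp]: "\<tau> 0 = 0" using \<tau>_scale[of 0 0] q_ge_2 by (simp add: power_0_left)

lemma \<tau>_sum: "\<tau> (sum f A) = (\<Sum>x\<in>A. \<tau> (f x))"
  by (induction A rule: infinite_finite_induct) (auto simp: \<tau>_add)

lemma \<tau>_minus: "\<tau> (- x) = - \<tau> x"
  using \<tau>_add[of x "- x"] by (simp add: eq_neg_iff_add_eq_0 add.commute)

lemma \<tau>_diff: "\<tau> (x - y) = \<tau> x - \<tau> y"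
  using \<tau>_add[of x "- y"] by (simp add: \<tau>_minus)

abbreviation twist :: "'k poly \<Rightarrow> 'k poly" where "twist \<equiv> map_poly (\<lambda>c. c ^ q)"

lemma twist_pCons: "twist (pCons a P) = pCons (a ^ q) (twist P)"
  using q_ge_2 by (simp add: map_poly_pCons)

lemma twist_add: "twist (P + Q) = twist P + twist Q"
  using q_ge_2 by (intro poly_eqI) (simp add: coeff_map_poly frob_add)

lemma twist_mult: "twist (P * Q) = twist P * twist Q"
  using q_ge_2
  by (intro poly_eqI) (simp add: coeff_map_poly coeff_mult frob_sum power_mult_distrib)

lemma twist_1: "twist 1 = 1"
  by (simp add: map_poly_1)

lemma \<tau>_act: "\<tau> (act P x) = act (twist P) (\<tau> x)"
  by (induction P) (auto simp: act_pCons twist_pCons \<tau>_add \<tau>_scale T_\<tau>[symmetric])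

lemma twist_comaximal:
  assumes "twist a = a" "comaximal P a" shows "comaximal (twist P) a"
proof -
  obtain u v where "u * P + v * a = 1" using assms(2) by (auto simp: comaximal_def)
  then have "twist (u * P + v * a) = twist 1" by simp
  then have "twist u * twist P + twist v * a = 1"
    by (simp only: twist_add twist_mult twist_1 assms(1))
  then show ?thesis by (auto simp: comaximal_def)
qed

lemma R_act: "x \<in> R \<Longrightarrow> act P x \<in> R"
  by (rule act_closed[OF R_subspace R_T])

text \<open>The filtration by degree in \<tau>; its steps have dimension at most
  \<open>(d + 1) * n\<close>.\<close>

definition R_le :: "nat \<Rightarrow> 'b set" where "R_le d = span {(\<tau> ^^ k) (X i) | k i. k \<le> d \<and> i < n}"

lemma R_le_mono: "d \<le> d' \<Longrightarrow> R_le d \<subseteq> R_le d'"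
  unfolding R_le_def by (rule span_mono) fastforce

lemma R_le_exhaust:
  assumes "x \<in> R" shows "\<exists>d. x \<in> R_le d"
proof -
  have "x \<in> span {(\<tau> ^^ k) (X i) | k i. i < n}" using assms R_gen by blast
  then show ?thesis
  proof (induction rule: span_induct_alt)
    case base then show ?case by (auto simp: R_le_def span_zero)
  next
    case (step c x y)
    then obtain k i d where x: "x = (\<tau> ^^ k) (X i)" "i < n" and y: "y \<in> R_le d" by blast
    have "x \<in> R_le k" unfolding R_le_def using x by (intro span_base) auto
    then have "x \<in> R_le (max k d)" "y \<in> R_le (max k d)"
      using y R_le_mono[of k "max k d"] R_le_mono[of d "max k d"] by auto
    then have "c *s x + y \<in> R_le (max k d)" unfolding R_le_def by (intro span_add span_scale)
    then show ?case by blast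
  qed
qed

lemma \<tau>_R_le: "x \<in> R_le d \<Longrightarrow> \<tau> x \<in> R_le (Suc d)"
  unfolding R_le_def
proof (induction rule: span_induct_alt)
  case base then show ?case by (simp add: span_zero)
next
  case (step c x y)
  then obtain k i where x: "x = (\<tau> ^^ k) (X i)" "i < n" "k \<le> d" by blast
  have "\<tau> x \<in> span {(\<tau> ^^ k) (X i) |k i. k \<le> Suc d \<and> i < n}"
    using x by (intro span_base CollectI exI[of _ "Suc k"] exI[of _ i]) auto
  then show ?case using step by (simp add: \<tau>_add \<tau>_scale span_add span_scale)
qed

text \<open>Since \<open>T\<close> commutes with \<tau>, the amount by which it raises the degree is
  controlled by its values on the finitely many generators.\<close>

lemma T_R_le: "\<exists>D. \<forall>d. \<forall>x\<in>R_le d. T x \<in> R_le (d + D)"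
proof -
  have "\<forall>i. \<exists>d. i < n \<longrightarrow> T (X i) \<in> R_le d" using R_le_exhaust R_T X_R by blast
  then obtain D where D: "\<And>i. i < n \<Longrightarrow> T (X i) \<in> R_le (D i)" by metis
  define D' where "D' = (\<Sum>i<n. D i)"
  have D': "T (X i) \<in> R_le D'" if "i < n" for i
    using D[OF that] R_le_mono[of "D i" D'] that member_le_sum[of i "{..<n}" D] by (auto simp: D'_def)
  have *: "T ((\<tau> ^^ k) (X i)) \<in> R_le (k + D')" if "i < n" for i k
    by (induction k) (use D' that in \<open>auto simp: T_\<tau> intro: \<tau>_R_le\<close>)
  have "T x \<in> R_le (d + D')" if "x \<in> R_le d" for d x
    using that unfolding R_le_def[of d]
  proof (induction rule: span_induct_alt)
    case base then show ?case by (simp add: R_le_def span_zero)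
  next
    case (step c x y)
    then obtain k i where x: "x = (\<tau> ^^ k) (X i)" "i < n" "k \<le> d" by blast
    then have "T x \<in> R_le (d + D')" using *[of i k] R_le_mono[of "k + D'" "d + D'"] by auto
    then show ?case using step by (auto simp: T_add T_scale R_le_def intro: span_add span_scale)
  qed
  then show ?thesis by blast
qed

section \<open>Rank and bases up to torsion\<close>

definition poly_indep :: "(nat \<Rightarrow> 'b) \<Rightarrow> nat \<Rightarrow> bool"
  where "poly_indep b r \<longleftrightarrow> (\<forall>Q. (\<Sum>j<r. act (Q j) (b j)) = 0 \<longrightarrow> (\<forall>j<r. Q j = 0))"

text \<open>A growth argument: the \<open>r * N\<close> vectors \<open>(T ^^ k) (b j)\<close> with
  \<open>k < N\<close> are independent over \<open>K\<close>, but lie in a filtration step whose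
  dimension is at most \<open>(d + N * D + 1) * n\<close>. Comparing slopes in \<open>N\<close>
  gives \<open>r \<le> n * D\<close>.\<close>

lemma poly_indep_bounded:
  "\<exists>m. \<forall>b r. (\<forall>j<r. b j \<in> R) \<longrightarrow> poly_indep b r \<longrightarrow> r \<le> m"
proof -
  obtain D where D: "\<And>d x. x \<in> R_le d \<Longrightarrow> T x \<in> R_le (d + D)" using T_R_le by blast
  have "r \<le> n * D" if b: "\<forall>j<r. b j \<in> R" and ind: "poly_indep b r" for b r
  proof (rule ccontr)
    assume "\<not> r \<le> n * D"
    then have r: "n * D + 1 \<le> r" by simp
    have "\<forall>j. \<exists>d. j < r \<longrightarrow> b j \<in> R_le d" using R_le_exhaust b by blast
    then obtain d0 where d0: "\<And>j. j < r \<Longrightarrow> b j \<in> R_le (d0 j)" by metis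
    define d where "d = (\<Sum>j<r. d0 j)"
    have bd: "b j \<in> R_le d" if "j < r" for j
      using d0[OF that] R_le_mono[of "d0 j" d] that member_le_sum[of j "{..<r}" d0] by (auto simp: d_def)
    \<comment> \<open>The least \<open>N\<close> with
      \<open>(n * D + 1) * N > (d + N * D + 1) * n\<close>.\<close>
    define N where "N = n * d + n + 1"
    define I where "I = {..<r} \<times> {..<N}"
    define f where "f = (\<lambda>(j, k). (T ^^ k) (b j))"
    define S where "S = (\<lambda>(k, i). (\<tau> ^^ k) (X i)) ` ({..d + N * D} \<times> {..<n})"
    have Tk: "(T ^^ k) (b j) \<in> R_le (d + k * D)" if "j < r" for j k
      by (induction k) (use bd[OF that] in \<open>auto dest: D simp: algebra_simps\<close>)
    have RS: "R_le (d + N * D) = span S"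
      unfolding R_le_def S_def by (rule arg_cong[of _ _ span]) auto
    have "f ` I \<subseteq> span S"
    proof -
      have "(T ^^ k) (b j) \<in> span S" if "j < r" "k < N" for j k
      proof -
        have "d + k * D \<le> d + N * D" using that by simp
        then show ?thesis using Tk[OF that(1), of k] R_le_mono RS by blast
      qed
      then show ?thesis by (auto simp: I_def f_def)
    qed
    moreover have "c i = 0" if c: "(\<Sum>i\<in>I. c i *s f i) = 0" and i: "i \<in> I" for c i
    proof -
      define Q where "Q j = (\<Sum>k<N. monom (c (j, k)) k)" for j
      have "(\<Sum>j<r. act (Q j) (b j)) = 0"
        using c by (simp add: I_def f_def sum.cartesian_product Q_def act_sum_left act_monom case_prod_beta)
      then have "\<forall>j<r. Q j = 0" using ind by (auto simp: poly_indep_def)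
      moreover obtain j k where jk: "i = (j, k)" "j < r" "k < N" using i by (auto simp: I_def)
      ultimately have "coeff (Q j) k = 0" by simp
      then show ?thesis using jk by (simp add: Q_def coeff_sum if_distrib cong: if_cong)
    qed
    ultimately have "card I \<le> card S"
      by (intro independent_family_card_le(3)[of I S f]) (auto simp: I_def S_def)
    also have "\<dots> \<le> (d + N * D + 1) * n"
      unfolding S_def by (rule order_trans[OF card_image_le]) auto
    finally have "r * N \<le> (d + N * D + 1) * n" by (simp add: I_def)
    moreover have "(n * D + 1) * N \<le> r * N" using r by (rule mult_le_mono1)
    ultimately have "(n * D + 1) * N \<le> (d + N * D + 1) * n" by linarith
    then show False by (simp add: N_def algebra_simps)
  qed
  then show ?thesis by blast
qed

text \<open>Not a basis of \<open>R\<close>, which may have torsion and be infinitely generated; it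
  becomes one over \<open>K(T)\<close>.\<close>

definition poly_basis :: "(nat \<Rightarrow> 'b) \<Rightarrow> nat \<Rightarrow> bool"
  where "poly_basis b r \<longleftrightarrow> (\<forall>j<r. b j \<in> R) \<and> poly_indep b r \<and>
    (\<forall>x\<in>R. \<exists>P Q. P \<noteq> 0 \<and> act P x = (\<Sum>j<r. act (Q j) (b j)))"

lemma poly_basis_exists: "\<exists>b r. poly_basis b r"
proof -
  define \<C> where "\<C> r \<longleftrightarrow> (\<exists>b. (\<forall>j<r. b j \<in> R) \<and> poly_indep b r)" for r
  obtain m where "\<And>r. \<C> r \<Longrightarrow> r \<le> m" using poly_indep_bounded unfolding \<C>_def by blast
  moreover have "\<C> 0" by (auto simp: \<C>_def poly_indep_def)
  ultimately obtain r where r: "\<C> r" and max: "\<And>r'. \<C> r' \<Longrightarrow> r' \<le> r"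
    using GreatestI_nat[of \<C> 0 m] Greatest_le_nat[of \<C> _ m] by metis
  obtain b where b: "\<forall>j<r. b j \<in> R" "poly_indep b r" using r by (auto simp: \<C>_def)
  have "\<exists>P Q. P \<noteq> 0 \<and> act P x = (\<Sum>j<r. act (Q j) (b j))" if x: "x \<in> R" for x
  proof -
    have "\<not> \<C> (Suc r)" using max by fastforce
    moreover have "\<forall>j<Suc r. (b(r := x)) j \<in> R" using b x by (auto simp: less_Suc_eq)
    ultimately have "\<not> poly_indep (b(r := x)) (Suc r)" unfolding \<C>_def by blast
    then obtain Q where Q: "(\<Sum>j<Suc r. act (Q j) ((b(r := x)) j)) = 0" "\<exists>j<Suc r. Q j \<noteq> 0"
      by (auto simp: poly_indep_def)
    have "(\<Sum>j<r. act (Q j) ((b(r := x)) j)) = (\<Sum>j<r. act (Q j) (b j))"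
      by (intro sum.cong) auto
    then have s: "(\<Sum>j<r. act (Q j) (b j)) + act (Q r) x = 0"
      using Q(1) by simp
    have "Q r \<noteq> 0"
    proof
      assume "Q r = 0"
      then have "(\<Sum>j<r. act (Q j) (b j)) = 0" using s by simp
      then have "\<forall>j<r. Q j = 0" using b(2) unfolding poly_indep_def by blast
      then show False using Q(2) \<open>Q r = 0\<close> by (auto simp: less_Suc_eq)
    qed
    moreover have "act (Q r) x = (\<Sum>j<r. act (- Q j) (b j))"
      using s by (simp add: act_minus_left sum_negf eq_neg_iff_add_eq_0 add.commute)
    ultimately show ?thesis by (intro exI[of _ "Q r"] exI[of _ "\<lambda>j. - Q j"] conjI)
  qed
  then have "poly_basis b r" using b unfolding poly_basis_def by blast
  then show ?thesis by blast
qed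

end

section \<open>Fixed vectors modulo a stable subspace\<close>

context frobenius_space
begin

text \<open>Lang's theorem for \<open>R/J\<close> without forming the quotient: the complement
  \<open>span U\<close> stands for \<open>R/J\<close>, and \<tau> followed by the projection along
  \<open>J\<close> stands for the induced map. Fixed vectors of the latter are fixed by \<tau>
  modulo \<open>J\<close>.\<close>

lemma lang_quotient:
  assumes sub: "subspace J" "subspace R" "J \<subseteq> R"
    and \<tau>_add: "\<And>x y. \<tau> (x + y) = \<tau> x + \<tau> y" and \<tau>_scale: "\<And>c x. \<tau> (c *s x) = c ^ q *s \<tau> x"
    and \<tau>J: "\<And>x. x \<in> J \<Longrightarrow> \<tau> x \<in> J" and \<tau>R: "\<And>x. x \<in> R \<Longrightarrow> \<tau> x \<in> R"
    and U: "finite U" "U \<subseteq> R" "independent U"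
    and complement: "\<And>x. x \<in> R \<Longrightarrow> \<exists>w\<in>span U. x - w \<in> J" "\<And>w. w \<in> span U \<Longrightarrow> w \<in> J \<Longrightarrow> w = 0"
    and surj: "R \<subseteq> span (\<tau> ` R \<union> J)"
  obtains B where "finite B" "card B = card U" "B \<subseteq> R" "independent B" "span B = span U"
    "\<And>b. b \<in> B \<Longrightarrow> \<tau> b - b \<in> J"
proof -
  define W where "W = span U"
  have W: "subspace W" "W \<subseteq> R" using U sub by (auto simp: W_def intro: span_minimal[THEN subsetD])
  have "\<forall>x. \<exists>w. x \<in> R \<longrightarrow> w \<in> W \<and> x - w \<in> J" using complement(1) unfolding W_def by blast
  then obtain \<pi> where \<pi>: "\<And>x. x \<in> R \<Longrightarrow> \<pi> x \<in> W" "\<And>x. x \<in> R \<Longrightarrow> x - \<pi> x \<in> J" by metis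
  have \<pi>_eq: "\<pi> x = w" if "x \<in> R" "w \<in> W" "x - w \<in> J" for x w
  proof -
    have "(x - w) - (x - \<pi> x) \<in> J" using that \<pi> sub subspace_diff by blast
    then have "\<pi> x - w \<in> J" by simp
    moreover have "\<pi> x - w \<in> W" using \<pi>(1) that W by (intro subspace_diff) auto
    ultimately show ?thesis using complement(2)[of "\<pi> x - w"] by (simp add: W_def)
  qed
  have \<pi>_lin: "\<pi> (c *s x + y) = c *s \<pi> x + \<pi> y" if "x \<in> R" "y \<in> R" for c x y
  proof (rule \<pi>_eq)
    show "c *s x + y \<in> R" using that sub by (intro subspace_add subspace_scale) auto
    show "c *s \<pi> x + \<pi> y \<in> W" using that \<pi> W by (intro subspace_add subspace_scale) auto
    have "c *s (x - \<pi> x) + (y - \<pi> y) \<in> J" using that \<pi> sub by (intro subspace_add subspace_scale) auto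
    then show "c *s x + y - (c *s \<pi> x + \<pi> y) \<in> J" by (simp add: algebra_simps)
  qed
  have zR: "0 \<in> R" "0 \<in> J" "0 \<in> W" using sub W subspace_0 by auto
  have \<pi>J: "\<pi> x = 0" if "x \<in> J" for x using that sub zR by (intro \<pi>_eq) auto
  define \<sigma> where "\<sigma> x = \<pi> (\<tau> x)" for x
  have \<sigma>: "\<sigma> x \<in> W" if "x \<in> W" for x using that W \<tau>R \<pi> by (auto simp: \<sigma>_def)
  have \<sigma>_add: "\<sigma> (x + y) = \<sigma> x + \<sigma> y" if "x \<in> W" "y \<in> W" for x y
    using \<pi>_lin[of "\<tau> x" "\<tau> y" 1] that W \<tau>R by (auto simp: \<sigma>_def \<tau>_add)
  have \<sigma>_scale: "\<sigma> (c *s x) = c ^ q *s \<sigma> x" if "x \<in> W" for x c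
    using \<pi>_lin[of "\<tau> x" 0 "c ^ q"] that W \<tau>R zR \<pi>J[of 0] by (auto simp: \<sigma>_def \<tau>_scale)
  \<comment> \<open>The spanning hypothesis passes to \<open>W\<close>, because modulo
    \<open>J\<close> the vector \<open>\<tau> z\<close> depends only on
    \<open>\<pi> z\<close>.\<close>
  have "x \<in> R \<and> \<pi> x \<in> span (\<sigma> ` W)" if "x \<in> span (\<tau> ` R \<union> J)" for x
    using that
  proof (induction rule: span_induct_alt)
    case base then show ?case using zR \<pi>J by (simp add: span_zero)
  next
    case (step c x y)
    have x: "x \<in> R \<and> \<pi> x \<in> span (\<sigma> ` W)"
    proof (cases "x \<in> J")
      case True then show ?thesis using \<pi>J sub by (auto simp: span_zero)
    next
      case False
      then obtain z where z: "x = \<tau> z" "z \<in> R" using step by blast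
      have "\<tau> (z - \<pi> z) \<in> J" using \<pi> z \<tau>J by blast
      moreover have "\<tau> (\<pi> z) \<in> R" using \<pi> z \<tau>R W by blast
      ultimately have "\<pi> (1 *s \<tau> (z - \<pi> z) + \<tau> (\<pi> z)) = 1 *s \<pi> (\<tau> (z - \<pi> z)) + \<pi> (\<tau> (\<pi> z))"
        using sub by (intro \<pi>_lin) auto
      moreover have "\<tau> z = \<tau> (z - \<pi> z) + \<tau> (\<pi> z)" using \<tau>_add[of "z - \<pi> z" "\<pi> z"] by simp
      ultimately have "\<pi> x = \<sigma> (\<pi> z)" using \<pi>J[OF \<open>\<tau> (z - \<pi> z) \<in> J\<close>] z by (simp add: \<sigma>_def)
      moreover have "\<pi> z \<in> W" using \<pi> z by blast
      ultimately show ?thesis using z \<tau>R by (auto intro: span_base)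
    qed
    then show ?case using step \<pi>_lin[of x y c] sub
      by (auto intro!: subspace_add subspace_scale span_add span_scale)
  qed
  then have "W \<subseteq> span (\<sigma> ` W)" using surj W \<pi>_eq zR by (metis (no_types, lifting) diff_self subset_iff)
  then obtain B where B: "B \<subseteq> W" "independent B" "finite B" "W \<subseteq> span B" "\<And>b. b \<in> B \<Longrightarrow> \<sigma> b = b"
    using lang[OF W(1) U(1) _ \<sigma> \<sigma>_add \<sigma>_scale] W_def by blast
  have "span B = W" using B W by (intro subset_antisym) (auto intro: span_minimal[THEN subsetD])
  moreover have "card B = card U"
    using independent_span_bound[OF U(1) B(2)] independent_span_bound[OF B(3) U(3)] B(1,4)
      span_superset[of U] unfolding W_def by (meson le_antisym subset_trans)
  moreover have "\<tau> b - b \<in> J" if "b \<in> B" for b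
    using \<pi>(2)[of "\<tau> b"] B(1) B(5)[OF that] that W \<tau>R by (auto simp: \<sigma>_def)
  ultimately show thesis using that B W unfolding W_def by blast
qed

end

context frobenius_module
begin

text \<open>The set \<open>\<P>\<close> consists of one denominator for each \<open>X i\<close> and
  each \<open>\<tau> (b j)\<close>. It is fixed before \<open>a\<close>, although the denominators
  of the elements of \<open>R\<close> may form an infinite set.\<close>

lemma denominators:
  assumes basis: "poly_basis b r"
  obtains \<P> where "finite \<P>" "0 \<notin> \<P>"
    "\<And>a x. twist a = a \<Longrightarrow> \<forall>P\<in>\<P>. comaximal P a \<Longrightarrow> x \<in> R \<Longrightarrow>
      \<exists>P Q. comaximal P a \<and> act P x = (\<Sum>j<r. act (Q j) (b j))"
proof -
  have b: "\<And>j. j < r \<Longrightarrow> b j \<in> R" using basis by (auto simp: poly_basis_def)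
  have den: "\<exists>P. P \<noteq> 0 \<and> (\<exists>Q. act P x = (\<Sum>j<r. act (Q j) (b j)))" if "x \<in> R" for x
    using basis that unfolding poly_basis_def by blast
  have "\<forall>i. \<exists>P. i < n \<longrightarrow> P \<noteq> 0 \<and> (\<exists>Q. act P (X i) = (\<Sum>j<r. act (Q j) (b j)))"
    using den X_R by blast
  then obtain PX where PX: "\<And>i. i < n \<Longrightarrow> PX i \<noteq> 0 \<and> (\<exists>Q. act (PX i) (X i) = (\<Sum>j<r. act (Q j) (b j)))"
    by metis
  have "\<forall>i. \<exists>P. i < r \<longrightarrow> P \<noteq> 0 \<and> (\<exists>Q. act P (\<tau> (b i)) = (\<Sum>j<r. act (Q j) (b j)))"
    using den b R_\<tau> by blast
  then obtain PB where PB: "\<And>i. i < r \<Longrightarrow> PB i \<noteq> 0 \<and> (\<exists>Q. act (PB i) (\<tau> (b i)) = (\<Sum>j<r. act (Q j) (b j)))"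
    by metis
  define \<P> where "\<P> = PX ` {..<n} \<union> PB ` {..<r}"
  have "\<exists>P Q. comaximal P a \<and> act P x = (\<Sum>j<r. act (Q j) (b j))"
    if a: "twist a = a" "\<forall>P\<in>\<P>. comaximal P a" and x: "x \<in> R" for a x
  proof -
    define comb where "comb Q = (\<Sum>j<r. act (Q j) (b j))" for Q
    define L where "L = range comb"
    define N where "N = {x. \<exists>P. comaximal P a \<and> act P x \<in> L}"
    have "comb Q + comb Q' = comb (\<lambda>j. Q j + Q' j)" for Q Q'
      by (simp add: comb_def act_add_left sum.distrib)
    then have L_add: "x + y \<in> L" if "x \<in> L" "y \<in> L" for x y using that by (auto simp: L_def)
    have "act P (comb Q) = comb (\<lambda>j. P * Q j)" for P Q
      by (simp add: comb_def act_sum act_mult)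
    then have L_act: "act P x \<in> L" if "x \<in> L" for P x using that by (auto simp: L_def)
    have "comb (\<lambda>_. 0) = 0" by (simp add: comb_def)
    then have L_0: "0 \<in> L" unfolding L_def by (metis rangeI)
    have one: "comaximal 1 a" unfolding comaximal_def by (intro exI[of _ 1] exI[of _ 0]) simp
    have N_div: "x \<in> N" if P: "comaximal P a" "act P x \<in> N" for P x
    proof -
      obtain P' where "comaximal P' a" "act P' (act P x) \<in> L" using P(2) by (auto simp: N_def)
      then have "comaximal (P' * P) a \<and> act (P' * P) x \<in> L"
        using P by (auto simp: act_mult intro: comaximal_mult_left)
      then show ?thesis by (auto simp: N_def)
    qed
    have N_act: "act P x \<in> N" if x: "x \<in> N" for P x
    proof -
      obtain P' where P': "comaximal P' a" "act P' x \<in> L" using x by (auto simp: N_def)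
      have "act P' (act P x) = act P (act P' x)" by (simp add: act_mult[symmetric] mult.commute)
      then show ?thesis using P' L_act by (auto simp: N_def)
    qed
    have N_add: "x + y \<in> N" if xy: "x \<in> N" "y \<in> N" for x y
    proof -
      obtain P P' where P: "comaximal P a" "act P x \<in> L" "comaximal P' a" "act P' y \<in> L"
        using xy by (auto simp: N_def)
      have "act (P * P') (x + y) = act P' (act P x) + act P (act P' y)"
        by (simp add: act_add act_mult[symmetric] mult.commute)
      then have "comaximal (P * P') a \<and> act (P * P') (x + y) \<in> L"
        using P by (auto intro: comaximal_mult_left L_add L_act)
      then show ?thesis by (auto simp: N_def)
    qed
    have N_0: "0 \<in> N" using one L_0 by (auto simp: N_def intro!: exI[of _ 1])
    have N_scale: "c *s x \<in> N" if "x \<in> N" for c x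
      using N_act[OF that, of "[:c:]"] by (simp add: act_pCons)
    have N_sum: "sum f A \<in> N" if "\<And>x. x \<in> A \<Longrightarrow> f x \<in> N" for f and A :: "nat set"
      using that by (induction A rule: infinite_finite_induct) (auto simp: N_0 N_add)
    have X_N: "X i \<in> N" if "i < n" for i
      using PX[OF that] a(2) that by (auto simp: N_def L_def comb_def \<P>_def)
    have B_N: "\<tau> (b j) \<in> N" if "j < r" for j
      using PB[OF that] a(2) that by (auto simp: N_def L_def comb_def \<P>_def)
    \<comment> \<open>Applying \<tau> to a relation twists its denominator, which stays comaximal
      with \<open>a\<close>, and leaves a combination of the \<open>\<tau> (b j)\<close>. Their own
      denominators belong to \<open>\<P>\<close>, so the combination lies in \<open>N\<close> and
      can be divided by the twisted denominator.\<close>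
    have \<tau>_N: "\<tau> x \<in> N" if x: "x \<in> N" for x
    proof -
      obtain P Q where P: "comaximal P a" "act P x = (\<Sum>j<r. act (Q j) (b j))"
        using x by (auto simp: N_def L_def comb_def)
      have "act (twist P) (\<tau> x) = (\<Sum>j<r. act (twist (Q j)) (\<tau> (b j)))"
        using arg_cong[OF P(2), of \<tau>] by (simp add: \<tau>_act \<tau>_sum)
      also have "\<dots> \<in> N" using B_N N_act by (intro N_sum) auto
      finally show ?thesis using N_div twist_comaximal[OF a(1) P(1)] by blast
    qed
    have \<tau>X_N: "(\<tau> ^^ k) (X i) \<in> N" if "i < n" for k i
      by (induction k) (use X_N[OF that] \<tau>_N in auto)
    have "subspace N" using N_0 N_add N_scale by (auto intro: subspaceI)
    then have "span {(\<tau> ^^ k) (X i) | k i. i < n} \<subseteq> N" using \<tau>X_N by (intro span_minimal) auto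
    then have "x \<in> N" using x R_gen by blast
    then show ?thesis by (auto simp: N_def L_def comb_def)
  qed
  moreover have "finite \<P>" "0 \<notin> \<P>" using PX PB by (auto simp: \<P>_def)
  ultimately show thesis using that by blast
qed

text \<open>A denominator comaximal with \<open>a\<close> is a unit modulo \<open>a\<close>, so the
  \<open>b j\<close> form a basis of \<open>R/aR\<close> over \<open>K[T]/(a)\<close>. Over
  \<open>K\<close> the vectors \<open>(T ^^ k) (b j)\<close> with \<open>k < degree a\<close> are
  then a basis, which Lang's theorem trades for a fixed one.\<close>

theorem fixed_basis_mod:
  assumes basis: "poly_basis b r" and a: "twist a = a" "a \<noteq> 0"
    and den: "\<And>x. x \<in> R \<Longrightarrow> \<exists>P Q. comaximal P a \<and> act P x = (\<Sum>j<r. act (Q j) (b j))"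
    and etale: "R \<subseteq> span (\<tau> ` R \<union> act a ` R)"
  obtains B where "finite B" "card B = r * degree a" "B \<subseteq> R" "independent B"
    "\<And>b. b \<in> B \<Longrightarrow> \<tau> b - b \<in> act a ` R"
    "\<And>x. x \<in> R \<Longrightarrow> \<exists>w\<in>span B. x - w \<in> act a ` R"
    "\<And>w. w \<in> span B \<Longrightarrow> w \<in> act a ` R \<Longrightarrow> w = 0"
proof -
  have b: "\<And>j. j < r \<Longrightarrow> b j \<in> R" and ind: "poly_indep b r" using basis by (auto simp: poly_basis_def)
  define J where "J = act a ` R"
  define d where "d = degree a"
  define I where "I = {..<r} \<times> {..<d}"
  define f where "f = (\<lambda>(j, k). (T ^^ k) (b j))"
  have fI: "finite (f ` I)" "finite I" by (auto simp: I_def)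
  have Tk: "(T ^^ k) x \<in> R" if "x \<in> R" for k x by (induction k) (use that R_T in auto)
  have fR: "f ` I \<subseteq> R" using b Tk by (auto simp: f_def I_def)
  have J: "subspace J" "J \<subseteq> R"
  proof -
    show "subspace J" unfolding J_def
    proof (intro subspaceI)
      show "0 \<in> act a ` R" using subspace_0[OF R_subspace] by (force intro: image_eqI[of _ _ 0])
      show "x + y \<in> act a ` R" if "x \<in> act a ` R" "y \<in> act a ` R" for x y
        using that subspace_add[OF R_subspace] by (auto simp: act_add[symmetric])
      show "c *s x \<in> act a ` R" if "x \<in> act a ` R" for c x
        using that subspace_scale[OF R_subspace] by (auto simp: act_scale[symmetric])
    qed
  qed (use R_act in \<open>auto simp: J_def\<close>)
  have J\<tau>: "\<tau> x \<in> J" if "x \<in> J" for x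
    using that R_\<tau> by (auto simp: J_def \<tau>_act a(1))
  have sumf: "(\<Sum>i\<in>I. c i *s f i) = (\<Sum>j<r. act (\<Sum>k<d. monom (c (j, k)) k) (b j))" for c
    by (simp add: I_def f_def sum.cartesian_product act_sum_left act_monom case_prod_beta)
  have coeffQ: "coeff (\<Sum>k<d. monom (c k) k) l = (if l < d then c l else 0)" for c :: "nat \<Rightarrow> 'k" and l
    by (simp add: coeff_sum if_distrib cong: if_cong)
  \<comment> \<open>If the combination equals \<open>a y\<close>, multiplying by a denominator
    \<open>P\<close> of \<open>y\<close> and comparing coefficients gives
    \<open>P * Q j = a * S j\<close>. Hence \<open>a\<close> divides \<open>Q j\<close>, whose
    degree is too small unless it is 0.\<close>
  have indJ: "c i = 0" if c: "(\<Sum>i\<in>I. c i *s f i) \<in> J" and i: "i \<in> I" for c i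
  proof -
    define Q where "Q j = (\<Sum>k<d. monom (c (j, k)) k)" for j
    obtain y where y: "y \<in> R" "(\<Sum>j<r. act (Q j) (b j)) = act a y"
      using c by (auto simp: J_def sumf Q_def)
    obtain P S where P: "comaximal P a" "act P y = (\<Sum>j<r. act (S j) (b j))" using den[OF y(1)] by blast
    have "(\<Sum>j<r. act (P * Q j - a * S j) (b j)) =
        act P (\<Sum>j<r. act (Q j) (b j)) - act a (\<Sum>j<r. act (S j) (b j))"
      by (simp add: act_diff_left act_mult act_sum sum_subtractf)
    also have "\<dots> = 0" unfolding y(2) P(2)[symmetric] by (simp add: act_mult[symmetric] mult.commute)
    finally have "\<forall>j<r. P * Q j - a * S j = 0"
      using ind[unfolded poly_indep_def, rule_format, of "\<lambda>j. P * Q j - a * S j"] by blast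
    moreover obtain j k where jk: "i = (j, k)" "j < r" "k < d" using i by (auto simp: I_def)
    ultimately have "a dvd P * Q j" by (metis dvd_triv_left eq_iff_diff_eq_0)
    then have dv: "a dvd Q j" using comaximal_dvd_mult P(1) by blast
    have "Q j = 0"
    proof (rule ccontr)
      assume Q0: "Q j \<noteq> 0"
      then have "d \<le> degree (Q j)" using dv dvd_imp_degree_le unfolding d_def by blast
      then have "coeff (Q j) (degree (Q j)) = 0" by (simp add: Q_def coeffQ)
      then show False using Q0 by simp
    qed
    then show ?thesis using jk coeffQ[of "\<lambda>k. c (j, k)" k] by (simp add: Q_def)
  qed
  have indf: "c i = 0" if "(\<Sum>i\<in>I. c i *s f i) = 0" "i \<in> I" for c i
    using indJ that subspace_0[OF J(1)] by simp
  have fam: "inj_on f I" "independent (f ` I)"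
    using independent_family_card_le[of I "f ` I" f] fI span_superset[of "f ` I"] indf by auto
  have decomp: "\<exists>w\<in>span (f ` I). x - w \<in> J" if x: "x \<in> R" for x
  proof -
    obtain P Q where P: "comaximal P a" "act P x = (\<Sum>j<r. act (Q j) (b j))" using den[OF x] by blast
    \<comment> \<open>Modulo \<open>a\<close> the polynomial \<open>u\<close> inverts the
      denominator, so \<open>x\<close> is congruent to \<open>act u (act P x)\<close>, whose
      coefficients may be reduced modulo \<open>a\<close>.\<close>
    obtain u v where uv: "u * P + v * a = 1" using P(1) by (auto simp: comaximal_def)
    define w where "w = (\<Sum>j<r. act ((u * Q j) mod a) (b j))"
    have "x = act (u * P + v * a) x" unfolding uv by simp
    also have "\<dots> = act u (act P x) + act a (act v x)"
      by (simp add: act_add_left act_mult[symmetric] mult.commute)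
    also have "act u (act P x) = (\<Sum>j<r. act (a * ((u * Q j) div a) + (u * Q j) mod a) (b j))"
      by (simp add: P(2) act_sum act_mult[symmetric])
    also have "\<dots> = act a (\<Sum>j<r. act ((u * Q j) div a) (b j)) + w"
      by (simp only: act_add_left sum.distrib act_mult act_sum w_def)
    finally have "x - w = act a ((\<Sum>j<r. act ((u * Q j) div a) (b j)) + act v x)"
      by (simp add: act_add algebra_simps)
    moreover have "(\<Sum>j<r. act ((u * Q j) div a) (b j)) + act v x \<in> R"
      using b x R_act R_subspace by (auto intro!: subspace_add subspace_sum)
    ultimately have "x - w \<in> J" by (auto simp: J_def)
    moreover have "w \<in> span (f ` I)"
    proof -
      have "act ((u * Q j) mod a) (b j) \<in> span (f ` I)" if "j < r" for j
      proof -
        have "(u * Q j) mod a = 0 \<or> degree ((u * Q j) mod a) < d"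
          using degree_mod_less[OF a(2)] by (auto simp: d_def)
        then have "act ((u * Q j) mod a) (b j) = (\<Sum>k<d. coeff ((u * Q j) mod a) k *s (T ^^ k) (b j))"
          by (rule act_eq_sum_lessThan)
        also have "\<dots> \<in> span (f ` I)"
          using that by (intro span_sum span_scale span_base) (force simp: f_def I_def)
        finally show ?thesis .
      qed
      then show ?thesis unfolding w_def by (intro span_sum) auto
    qed
    ultimately show ?thesis by blast
  qed
  have inter: "w = 0" if w: "w \<in> span (f ` I)" "w \<in> J" for w
  proof -
    obtain c where c: "w = (\<Sum>i\<in>I. c i *s f i)" using in_span_family[OF fI(2) w(1)] by blast
    then have "\<forall>i\<in>I. c i = 0" using indJ w(2) by blast
    then show ?thesis unfolding c by simp
  qed
  obtain B where B: "finite B" "card B = card (f ` I)" "B \<subseteq> R" "independent B" "span B = span (f ` I)"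
    "\<And>b. b \<in> B \<Longrightarrow> \<tau> b - b \<in> J"
    using lang_quotient[OF J(1) R_subspace J(2) \<tau>_add \<tau>_scale J\<tau> R_\<tau> fI(1) fR fam(2) decomp inter]
      etale[folded J_def] by blast
  have "card B = r * degree a" using B(2) card_image[OF fam(1)] by (simp add: I_def d_def)
  then show thesis using that[of B] B decomp inter unfolding J_def by simp
qed

end

section \<open>Extension of scalars to \<open>K(T)\<close>\<close>

context frobenius_module
begin

text \<open>The map sending \<open>s \<otimes> m\<close> to \<open>s\<close> times the coordinates
  of \<open>h m\<close> over \<open>K(T)\<close> identifies the tensor product with
  \<open>K(T)^r\<close>. The work lies in showing that the subgroup generated by the bilinearity
  relations is the full kernel of this map on the free abelian group.\<close>

lemma extension_of_scalars_dim:
  fixes M :: "('k poly, 'm, 'e) module_scheme" and h :: "'m \<Rightarrow> 'b"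
  assumes bij: "bij_betw h (carrier M) R"
    and M_add: "\<And>x y. x \<in> carrier M \<Longrightarrow> y \<in> carrier M \<Longrightarrow> x \<oplus>\<^bsub>M\<^esub> y \<in> carrier M \<and> h (x \<oplus>\<^bsub>M\<^esub> y) = h x + h y"
    and M_smult: "\<And>P x. x \<in> carrier M \<Longrightarrow> P \<odot>\<^bsub>M\<^esub> x \<in> carrier M \<and> h (P \<odot>\<^bsub>M\<^esub> x) = act P (h x)"
    and basis: "poly_basis b r"
  shows "vectorspace.dim (class_ring :: 'k poly fract ring)
    (extension_of_scalars class_ring class_ring to_fract M) = r"
proof -
  have b: "b j \<in> R" if "j < r" for j using basis that by (auto simp: poly_basis_def)
  have ind: "\<And>Q j. (\<Sum>j<r. act (Q j) (b j)) = 0 \<Longrightarrow> j < r \<Longrightarrow> Q j = 0"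
    using basis unfolding poly_basis_def poly_indep_def by blast
  have hR: "h x \<in> R" if "x \<in> carrier M" for x using bij that by (auto simp: bij_betw_def)
  have h_inj: "x = y" if "x \<in> carrier M" "y \<in> carrier M" "h x = h y" for x y
    using bij that by (auto simp: bij_betw_def inj_on_def)
  define g where "g = the_inv_into (carrier M) h"
  have g: "g x \<in> carrier M \<and> h (g x) = x" if "x \<in> R" for x
    unfolding g_def using bij that
    by (metis bij_betw_def f_the_inv_into_f the_inv_into_into order_refl)
  \<comment> \<open>Coordinates over \<open>K(T)\<close> with respect to \<open>b\<close>, read off
    from some relation \<open>P x = \<Sum> Q j b j\<close>. By independence of \<open>b\<close> the
    fractions \<open>Q j / P\<close> are the same for all such relations.\<close>
  define c :: "'b \<Rightarrow> nat \<Rightarrow> 'k poly fract" where "c x = (SOME c. \<exists>P Q. P \<noteq> 0 \<and> act P x = (\<Sum>j<r. act (Q j) (b j)) \<and>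
    c = (\<lambda>j. if j < r then to_fract (Q j) / to_fract P else 0))" for x
  have c_eq: "c x = (\<lambda>j. if j < r then to_fract (Q j) / to_fract P else 0)"
    if PQ: "P \<noteq> 0" "act P x = (\<Sum>j<r. act (Q j) (b j))" for x P Q
  proof -
    have "\<exists>c. \<exists>P Q. P \<noteq> 0 \<and> act P x = (\<Sum>j<r. act (Q j) (b j)) \<and>
        c = (\<lambda>j. if j < r then to_fract (Q j) / to_fract P else 0)" using PQ by blast
    from someI_ex[OF this, folded c_def] obtain P' Q' where P'Q': "P' \<noteq> 0"
      "act P' x = (\<Sum>j<r. act (Q' j) (b j))" "c x = (\<lambda>j. if j < r then to_fract (Q' j) / to_fract P' else 0)"
      by blast
    have "(\<Sum>j<r. act (P * Q' j - P' * Q j) (b j)) =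
        act P (\<Sum>j<r. act (Q' j) (b j)) - act P' (\<Sum>j<r. act (Q j) (b j))"
      by (simp add: act_diff_left act_mult act_sum sum_subtractf)
    also have "\<dots> = 0" unfolding PQ(2)[symmetric] P'Q'(2)[symmetric] by (simp add: act_mult[symmetric] mult.commute)
    finally have "P * Q' j = P' * Q j" if "j < r" for j
      using ind[of "\<lambda>j. P * Q' j - P' * Q j"] that by simp
    then have "to_fract P * to_fract (Q' j) = to_fract P' * to_fract (Q j)" if "j < r" for j
      using that to_fract_mult by metis
    then show ?thesis unfolding P'Q'(3) using PQ(1) P'Q'(1) by (auto simp: fun_eq_iff frac_eq_eq mult.commute)
  qed
  have den: "\<exists>P Q. P \<noteq> 0 \<and> act P x = (\<Sum>j<r. act (Q j) (b j))" if "x \<in> R" for x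
    using basis that by (auto simp: poly_basis_def)
  have c_add: "c (x + y) = c x + c y" if xy: "x \<in> R" "y \<in> R" for x y
  proof -
    obtain P Q where PQ: "P \<noteq> 0" "act P x = (\<Sum>j<r. act (Q j) (b j))" using den[OF xy(1)] by blast
    obtain P' Q' where P'Q': "P' \<noteq> 0" "act P' y = (\<Sum>j<r. act (Q' j) (b j))" using den[OF xy(2)] by blast
    have "act (P * P') (x + y) = act P' (act P x) + act P (act P' y)"
      by (simp add: act_add act_mult[symmetric] mult.commute)
    also have "\<dots> = (\<Sum>j<r. act (P' * Q j + P * Q' j) (b j))"
      unfolding PQ(2) P'Q'(2) by (simp add: act_sum act_add_left act_mult sum.distrib)
    finally have "act (P * P') (x + y) = (\<Sum>j<r. act (P' * Q j + P * Q' j) (b j))" .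
    from c_eq[OF _ this] show ?thesis
      using c_eq[OF PQ] c_eq[OF P'Q'] PQ(1) P'Q'(1) by (auto simp: fun_eq_iff field_simps)
  qed
  have c_act: "c (act P x) = (\<lambda>j. to_fract P * c x j)" if x: "x \<in> R" for P x
  proof -
    obtain P' Q where PQ: "P' \<noteq> 0" "act P' x = (\<Sum>j<r. act (Q j) (b j))" using den[OF x] by blast
    have "act P' (act P x) = act P (act P' x)" by (simp add: act_mult[symmetric] mult.commute)
    also have "\<dots> = (\<Sum>j<r. act (P * Q j) (b j))" unfolding PQ(2) by (simp add: act_sum act_mult)
    finally have "act P' (act P x) = (\<Sum>j<r. act (P * Q j) (b j))" .
    from c_eq[OF PQ(1) this] show ?thesis using c_eq[OF PQ] by (auto simp: fun_eq_iff)
  qed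
  have c_b: "c (b i) = (\<lambda>j. if j = i then 1 else 0)" if i: "i < r" for i
  proof -
    have "(\<Sum>j<r. act (if j = i then 1 else 0) (b j)) = (\<Sum>j<r. if j = i then b i else 0)"
      by (intro sum.cong) auto
    then have "act 1 (b i) = (\<Sum>j<r. act (if j = i then 1 else 0) (b j))" using i by simp
    from c_eq[OF _ this] show ?thesis using i by (auto simp: fun_eq_iff)
  qed
  have c_supp: "c x j = 0" if "x \<in> R" "\<not> j < r" for x j using den[OF that(1)] c_eq that(2) by fastforce

  define S where "S = (UNIV :: 'k poly fract set) \<times> carrier M"
  define G where "G = free_Abelian_group S"
  define rel where "rel = tensor_relations class_ring (class_ring :: 'k poly fract ring) to_fract M"
  define N where "N = generate G rel"
  interpret G: comm_group G unfolding G_def by (rule abelian_free_Abelian_group)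
  have G_simps [simp]: "x \<in> carrier G \<longleftrightarrow> Poly_Mapping.keys x \<subseteq> S" "\<one>\<^bsub>G\<^esub> = 0" "x \<otimes>\<^bsub>G\<^esub> y = x + y" for x y
    by (auto simp: G_def)
  have G_frag: "frag_of (s, m) \<in> carrier G" if "m \<in> carrier M" for s m using that by (simp add: S_def)
  have G_add: "x + y \<in> carrier G" if "x \<in> carrier G" "y \<in> carrier G" for x y
    using G.m_closed[OF that] by (simp only: G_simps)
  have G_minus: "- x \<in> carrier G" if "x \<in> carrier G" for x using that by simp
  have G_diff: "x - y \<in> carrier G" if "x \<in> carrier G" "y \<in> carrier G" for x y
    using G_add[OF that(1) G_minus[OF that(2)]] by simp
  have G_sum: "sum f A \<in> carrier G" if "\<And>i. i \<in> A \<Longrightarrow> f i \<in> carrier G" for f and A :: "nat set"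
    using that unfolding G_def by (rule sum_closed_free_Abelian_group)
  have G_induct [consumes 1, case_names zero diff frag]: "P x"
    if "x \<in> carrier G" "P 0"
      "\<And>x y. x \<in> carrier G \<Longrightarrow> y \<in> carrier G \<Longrightarrow> P x \<Longrightarrow> P y \<Longrightarrow> P (x - y)"
      "\<And>s m. m \<in> carrier M \<Longrightarrow> P (frag_of (s, m))" for P x
  proof (rule free_Abelian_group_induct[of x S])
    show "P (frag_of a)" if "a \<in> S" for a using that \<open>\<And>s m. m \<in> carrier M \<Longrightarrow> P (frag_of (s, m))\<close> by (auto simp: S_def)
  qed (use that in auto)
  have rel_G: "rel \<subseteq> carrier G"
    unfolding rel_def tensor_relations_def using M_add M_smult
    by (intro Un_least) (auto simp del: G_simps simp: G_frag intro!: G_diff)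
  have r1: "frag_of (s + s', m) - frag_of (s, m) - frag_of (s', m) \<in> N" if "m \<in> carrier M" for s s' m
    unfolding N_def rel_def tensor_relations_def using that by (intro generate.incl) force
  have r2: "frag_of (s, m \<oplus>\<^bsub>M\<^esub> m') - frag_of (s, m) - frag_of (s, m') \<in> N"
    if "m \<in> carrier M" "m' \<in> carrier M" for s m m'
    unfolding N_def rel_def tensor_relations_def using that by (intro generate.incl) force
  have r3: "frag_of (s * to_fract P, m) - frag_of (s, P \<odot>\<^bsub>M\<^esub> m) \<in> N" if "m \<in> carrier M" for s P m
    unfolding N_def rel_def tensor_relations_def using that by (intro generate.incl) force
  have N_sub: "subgroup N G" unfolding N_def by (rule G.generate_is_subgroup[OF rel_G])
  have N_G: "x \<in> carrier G" if "x \<in> N" for x using that subgroup.subset[OF N_sub] by blast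
  have N_0: "0 \<in> N" using subgroup.one_closed[OF N_sub] by (simp only: G_simps)
  have N_add: "x + y \<in> N" if "x \<in> N" "y \<in> N" for x y
    using subgroup.m_closed[OF N_sub that] by (simp only: G_simps)
  have N_minus: "- x \<in> N" if "x \<in> N" for x
    using subgroup.m_inv_closed[OF N_sub that] N_G[OF that] by (simp add: G_def)
  have N_diff: "x - y \<in> N" if "x \<in> N" "y \<in> N" for x y
    using N_add[OF that(1) N_minus[OF that(2)]] by simp
  have N_sum: "sum f A \<in> N" if "\<And>i. i \<in> A \<Longrightarrow> f i \<in> N" for f and A :: "nat set"
    using that by (induction A rule: infinite_finite_induct) (auto simp: N_0 N_add)
  have N_0_left: "frag_of (0, m) \<in> N" if "m \<in> carrier M" for m
    using N_minus[OF r1[OF that, of 0 0]] by simp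
  have N_0_right: "frag_of (s, m) \<in> N" if "m \<in> carrier M" "h m = 0" for s m
  proof -
    have "m \<oplus>\<^bsub>M\<^esub> m = m" using M_add[OF that(1,1)] that by (intro h_inj) auto
    then show ?thesis using N_minus[OF r2[OF that(1,1), of s]] by simp
  qed

  have expand: "frag_of (s, m) - (\<Sum>j<k. frag_of (s * to_fract (Q j), g (b j))) \<in> N"
    if "m \<in> carrier M" "h m = (\<Sum>j<k. act (Q j) (b j))" "k \<le> r" for s m k Q
    using that
  proof (induction k arbitrary: m)
    case 0 then show ?case using N_0_right by simp
  next
    case (Suc k)
    define m1 where "m1 = g (\<Sum>j<k. act (Q j) (b j))"
    define m2 where "m2 = Q k \<odot>\<^bsub>M\<^esub> g (b k)"
    have gb: "g (b k) \<in> carrier M" "h (g (b k)) = b k" using g b Suc.prems(3) by auto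
    have "(\<Sum>j<k. act (Q j) (b j)) \<in> R"
      using b Suc.prems(3) R_act by (intro subspace_sum[OF R_subspace]) auto
    then have m1: "m1 \<in> carrier M" "h m1 = (\<Sum>j<k. act (Q j) (b j))" unfolding m1_def using g by auto
    have m2: "m2 \<in> carrier M" "h m2 = act (Q k) (b k)" unfolding m2_def using M_smult gb by auto
    have "m = m1 \<oplus>\<^bsub>M\<^esub> m2" using M_add[OF m1(1) m2(1)] m1 m2 Suc.prems by (intro h_inj) auto
    then have 1: "frag_of (s, m) - frag_of (s, m1) - frag_of (s, m2) \<in> N" using r2[OF m1(1) m2(1)] by simp
    have 2: "frag_of (s, m1) - (\<Sum>j<k. frag_of (s * to_fract (Q j), g (b j))) \<in> N"
      using Suc.IH[OF m1] Suc.prems(3) by simp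
    have 3: "frag_of (s * to_fract (Q k), g (b k)) - frag_of (s, m2) \<in> N" unfolding m2_def by (rule r3[OF gb(1)])
    show ?case using N_diff[OF N_add[OF 1 2] 3] by (simp add: algebra_simps)
  qed
  have frag_expand: "frag_of (s, m) - (\<Sum>j<r. frag_of (s * c (h m) j, g (b j))) \<in> N"
    if m: "m \<in> carrier M" for s m
  proof -
    obtain P Q where PQ: "P \<noteq> 0" "act P (h m) = (\<Sum>j<r. act (Q j) (b j))" using den[OF hR[OF m]] by blast
    \<comment> \<open>The denominator is moved across the tensor sign:
      \<open>s \<otimes> m = s/P \<otimes> P m\<close>, and \<open>P m\<close> expands in the
      \<open>b j\<close> with coefficients in \<open>K[T]\<close>.\<close>
    define t where "t = s / to_fract P"
    have t: "t * to_fract P = s" using PQ(1) by (simp add: t_def)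
    have 1: "frag_of (s, m) - frag_of (t, P \<odot>\<^bsub>M\<^esub> m) \<in> N" using r3[OF m, of t P] unfolding t .
    have 2: "frag_of (t, P \<odot>\<^bsub>M\<^esub> m) - (\<Sum>j<r. frag_of (t * to_fract (Q j), g (b j))) \<in> N"
      using M_smult[OF m, of P] PQ(2) by (intro expand) auto
    have 3: "(\<Sum>j<r. frag_of (t * to_fract (Q j), g (b j))) = (\<Sum>j<r. frag_of (s * c (h m) j, g (b j)))"
      by (intro sum.cong refl) (simp add: c_eq[OF PQ] t_def)
    show ?thesis using N_add[OF 1 2] unfolding 3 by simp
  qed

  \<comment> \<open>The additive group of functions, written multiplicatively so that the universal
    property of the free abelian group applies.\<close>
  define L :: "(nat \<Rightarrow> 'k poly fract) monoid" where "L = \<lparr>carrier = UNIV, monoid.mult = (+), one = 0\<rparr>"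
  have "comm_group L"
  proof (rule group.group_comm_groupI)
    show "group L" by (rule groupI) (auto simp: L_def add.assoc intro: exI[of _ "- _"] ab_left_minus)
  qed (simp add: L_def add.commute)
  then obtain \<Theta> where \<Theta>: "\<Theta> \<in> hom G L" "\<And>x. x \<in> S \<Longrightarrow> \<Theta> (frag_of x) = (\<lambda>j. fst x * c (h (snd x)) j)"
    using comm_group.free_Abelian_group_universal[of L "\<lambda>x. (\<lambda>j. fst x * c (h (snd x)) j)" S]
    unfolding G_def L_def by auto
  have \<Theta>_add: "\<Theta> (x + y) = \<Theta> x + \<Theta> y" if "x \<in> carrier G" "y \<in> carrier G" for x y
    using hom_mult[OF \<Theta>(1) that] by (simp add: L_def)
  have \<Theta>_0: "\<Theta> 0 = 0" using \<Theta>_add[of 0 0] by simp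
  have \<Theta>_diff: "\<Theta> (x - y) = \<Theta> x - \<Theta> y" if "x \<in> carrier G" "y \<in> carrier G" for x y
    using \<Theta>_add[OF G_diff[OF that] that(2)] by (simp add: eq_diff_eq)
  have \<Theta>_sum: "\<Theta> (sum f A) = (\<Sum>i\<in>A. \<Theta> (f i))" if "\<And>i. i \<in> A \<Longrightarrow> f i \<in> carrier G" for f and A :: "nat set"
    using that by (induction A rule: infinite_finite_induct)
      (auto simp del: G_simps simp: \<Theta>_0 \<Theta>_add G_sum)
  have \<Theta>_frag: "\<Theta> (frag_of (s, m)) = (\<lambda>j. s * c (h m) j)" if "m \<in> carrier M" for s m
    using \<Theta>(2)[of "(s, m)"] that by (simp add: S_def)
  have gb: "g (b j) \<in> carrier M" "h (g (b j)) = b j" if "j < r" for j using g b that by auto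
  define u where "u w = (\<Sum>j<r. frag_of (w j, g (b j)))" for w :: "nat \<Rightarrow> 'k poly fract"
  have uG: "u w \<in> carrier G" for w unfolding u_def using gb by (intro G_sum G_frag) auto
  have \<Theta>_u: "\<Theta> (u w) = (\<lambda>j. if j < r then w j else 0)" for w
  proof -
    have "\<Theta> (u w) = (\<Sum>j<r. \<Theta> (frag_of (w j, g (b j))))"
      unfolding u_def by (intro \<Theta>_sum G_frag gb) auto
    also have "\<dots> = (\<Sum>j<r. (\<lambda>i. w j * (if i = j then 1 else 0)))"
      by (intro sum.cong refl) (simp add: \<Theta>_frag gb c_b)
    finally show ?thesis by (auto simp: fun_eq_iff sum_fun_apply if_distrib cong: if_cong)
  qed
  have u_add: "u (\<lambda>j. w j + w' j) - u w - u w' \<in> N" for w w'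
    unfolding u_def sum_subtractf[symmetric] using gb by (intro N_sum r1) auto
  \<comment> \<open>Modulo the relations every element equals its standard representative
    \<open>u (\<Theta> x)\<close>. So the kernel of \<Theta> is contained in \<open>N\<close>; the
    opposite inclusion only requires checking the three kinds of relations.\<close>
  have G_expand: "x - u (\<Theta> x) \<in> N" if "x \<in> carrier G" for x
    using that
  proof (induction rule: G_induct)
    case zero
    \<comment> \<open>In the free group \<open>u 0\<close> is not 0 but a sum of generators
      \<open>(0, m)\<close>, each of which lies in \<open>N\<close>.\<close>
    have "u 0 \<in> N" unfolding u_def using gb N_0_left by (intro N_sum) auto
    then show ?case unfolding \<Theta>_0 diff_0 by (rule N_minus)
  next
    case (diff x y)
    note xy = diff(1,2)
    have "(\<lambda>j. \<Theta> (x - y) j + \<Theta> y j) = \<Theta> x" using \<Theta>_diff[OF xy] by (simp add: fun_eq_iff)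
    then have "u (\<Theta> x) - u (\<Theta> (x - y)) - u (\<Theta> y) \<in> N" using u_add[of "\<Theta> (x - y)" "\<Theta> y"] by simp
    from N_add[OF N_diff[OF diff(3,4)] this] show ?case by (simp add: algebra_simps)
  next
    case (frag s m)
    show ?case using frag_expand[OF frag, of s] unfolding u_def \<Theta>_frag[OF frag] .
  qed
  have \<Theta>_supp: "\<Theta> x j = 0" if "x \<in> carrier G" "\<not> j < r" for x j
    using that(1)
  proof (induction rule: G_induct)
    case (diff x y) then show ?case by (simp add: \<Theta>_diff)
  next
    case (frag s m) then show ?case using c_supp[OF hR that(2)] by (simp add: \<Theta>_frag)
  qed (simp add: \<Theta>_0)
  have "subgroup {x \<in> carrier G. \<Theta> x = 0} G"
  proof (rule G.subgroupI)
    show "{x \<in> carrier G. \<Theta> x = 0} \<noteq> {}" using \<Theta>_0 by auto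
    show "inv\<^bsub>G\<^esub> x \<in> {x \<in> carrier G. \<Theta> x = 0}" if "x \<in> {x \<in> carrier G. \<Theta> x = 0}" for x
      using that \<Theta>_diff[of 0 x] \<Theta>_0 by (simp add: G_def)
    show "x \<otimes>\<^bsub>G\<^esub> y \<in> {x \<in> carrier G. \<Theta> x = 0}"
      if "x \<in> {x \<in> carrier G. \<Theta> x = 0}" "y \<in> {x \<in> carrier G. \<Theta> x = 0}" for x y
      using that G_add[of x y] by (simp add: \<Theta>_add)
  qed blast
  moreover have "rel \<subseteq> {x \<in> carrier G. \<Theta> x = 0}"
  proof
    fix x assume x: "x \<in> rel"
    have "\<Theta> (frag_of (s + s', m) - frag_of (s, m) - frag_of (s', m)) = 0" if "m \<in> carrier M" for s s' m
      using that by (simp del: G_simps add: \<Theta>_diff G_diff G_frag \<Theta>_frag fun_eq_iff distrib_right)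
    moreover have "\<Theta> (frag_of (s, m \<oplus>\<^bsub>M\<^esub> m') - frag_of (s, m) - frag_of (s, m')) = 0"
      if "m \<in> carrier M" "m' \<in> carrier M" for s m m'
      using that M_add[OF that]
      by (simp del: G_simps add: \<Theta>_diff G_diff G_frag \<Theta>_frag c_add hR fun_eq_iff distrib_left)
    moreover have "\<Theta> (frag_of (s * to_fract P, m) - frag_of (s, P \<odot>\<^bsub>M\<^esub> m)) = 0"
      if "m \<in> carrier M" for s P m
      using that M_smult[OF that, of P]
      by (simp del: G_simps add: \<Theta>_diff G_frag \<Theta>_frag c_act hR fun_eq_iff mult.assoc)
    ultimately have "\<Theta> x = 0"
      using x unfolding rel_def tensor_relations_def by fastforce
    then show "x \<in> {x \<in> carrier G. \<Theta> x = 0}" using x rel_G by blast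
  qed
  ultimately have N_\<Theta>: "N \<subseteq> {x \<in> carrier G. \<Theta> x = 0}"
    unfolding N_def by (intro G.generate_subgroup_incl)
  have N_iff: "x \<in> N \<longleftrightarrow> x \<in> carrier G \<and> \<Theta> x = 0" for x
  proof
    assume x: "x \<in> carrier G \<and> \<Theta> x = 0"
    have "u 0 \<in> N" unfolding u_def using gb N_0_left by (intro N_sum) auto
    then show "x \<in> N" using G_expand[of x] x N_add[of "x - u 0" "u 0"] by auto
  qed (use N_\<Theta> in auto)

  \<comment> \<open>Since \<open>N\<close> is the kernel, its cosets are the fibres of \<Theta>; the
    tensor product is described through them from here on.\<close>
  define fib where "fib w = {x \<in> carrier G. \<Theta> x = w}" for w
  have coset: "N #>\<^bsub>G\<^esub> x = fib (\<Theta> x)" if x: "x \<in> carrier G" for x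
  proof (intro equalityI subsetI)
    fix y assume "y \<in> N #>\<^bsub>G\<^esub> x"
    then obtain z where z: "z \<in> N" "y = z + x" by (auto simp: r_coset_def)
    then show "y \<in> fib (\<Theta> x)" using x N_iff[of z] G_add[of z x] by (auto simp del: G_simps simp: fib_def \<Theta>_add)
  next
    fix y assume "y \<in> fib (\<Theta> x)"
    then have "y - x \<in> N" using x G_diff[of y x] by (auto simp del: G_simps simp: fib_def \<Theta>_diff N_iff)
    then show "y \<in> N #>\<^bsub>G\<^esub> x" unfolding r_coset_def by (auto intro!: bexI[of _ "y - x"])
  qed
  define W where "W = {w :: nat \<Rightarrow> 'k poly fract. \<forall>j. \<not> j < r \<longrightarrow> w j = 0}"
  have \<Theta>_W: "\<Theta> x \<in> W" if "x \<in> carrier G" for x using \<Theta>_supp[OF that] by (simp add: W_def)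
  have u_fib: "u w \<in> fib w" if "w \<in> W" for w
    using that uG[of w] \<Theta>_u[of w] by (auto simp: fib_def W_def fun_eq_iff)
  have cosets: "rcosets\<^bsub>G\<^esub> N = fib ` W"
  proof (intro equalityI subsetI)
    fix C assume "C \<in> rcosets\<^bsub>G\<^esub> N"
    then obtain x where "x \<in> carrier G" "C = N #>\<^bsub>G\<^esub> x" by (auto simp del: G_simps simp: RCOSETS_def)
    then show "C \<in> fib ` W" using coset \<Theta>_W by blast
  next
    fix C assume "C \<in> fib ` W"
    then obtain w where w: "w \<in> W" "C = fib w" by blast
    then have "C = N #>\<^bsub>G\<^esub> u w" using u_fib[OF w(1)] coset[OF uG] by (simp add: fib_def)
    then show "C \<in> rcosets\<^bsub>G\<^esub> N" using uG by (auto simp del: G_simps simp: RCOSETS_def)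
  qed
  have fib_inj: "w = w'" if "fib w = fib w'" "w \<in> W" for w w' using u_fib[OF that(2)] that(1) by (auto simp: fib_def)
  have fib_add: "fib w <#>\<^bsub>G\<^esub> fib w' = fib (w + w')" if w: "w \<in> W" "w' \<in> W" for w w'
  proof (intro equalityI subsetI)
    fix z assume "z \<in> fib w <#>\<^bsub>G\<^esub> fib w'"
    then show "z \<in> fib (w + w')" using G_add by (auto simp del: G_simps(1) simp: set_mult_def fib_def \<Theta>_add)
  next
    fix z assume z: "z \<in> fib (w + w')"
    then have zG: "z \<in> carrier G" "\<Theta> z = w + w'" by (auto simp: fib_def)
    have "z - u w \<in> fib w'" using zG uG[of w] G_diff u_fib[OF w(1)]
      by (auto simp del: G_simps simp: fib_def \<Theta>_diff)
    moreover have "z = u w + (z - u w)" by simp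
    ultimately show "z \<in> fib w <#>\<^bsub>G\<^esub> fib w'" using u_fib[OF w(1)]
      unfolding set_mult_def G_simps by blast
  qed

  let ?E = "extension_of_scalars class_ring (class_ring :: 'k poly fract ring) to_fract M"
  have E_eq: "?E = \<lparr>carrier = carrier (G Mod N), mult = undefined, one = undefined,
         ring.zero = \<one>\<^bsub>G Mod N\<^esub>, add = monoid.mult (G Mod N),
         smult = (\<lambda>t C. \<Union>x\<in>C. N #>\<^bsub>G\<^esub> frag_extend (\<lambda>(s, m). frag_of (t * s, m)) x)\<rparr>"
    by (simp add: extension_of_scalars_def Let_def G_def N_def S_def rel_def)
  have E_carrier: "carrier ?E = fib ` W" by (simp add: E_eq FactGroup_def cosets)
  have E_add: "fib w \<oplus>\<^bsub>?E\<^esub> fib w' = fib (w + w')" if "w \<in> W" "w' \<in> W" for w w'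
    using fib_add[OF that] by (simp add: E_eq FactGroup_def)
  have E_zero: "\<zero>\<^bsub>?E\<^esub> = fib 0" using N_iff by (auto simp: E_eq FactGroup_def fib_def)
  have E_smult: "t \<odot>\<^bsub>?E\<^esub> fib w = fib (\<lambda>j. t * w j)" if "w \<in> W" for t w
  proof -
    let ?f = "frag_extend (\<lambda>(s, m). frag_of (t * s, m))"
    have ext: "?f x \<in> carrier G \<and> \<Theta> (?f x) = (\<lambda>j. t * \<Theta> x j)" if "x \<in> carrier G" for x
      using that
    proof (induction rule: G_induct)
      case (diff x y)
      then show ?case using G_diff[of "?f x" "?f y"]
        by (auto simp del: G_simps simp: frag_extend_diff \<Theta>_diff fun_eq_iff algebra_simps)
    next
      case (frag s m) then show ?case by (simp add: S_def \<Theta>_frag mult.assoc)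
    qed (simp add: \<Theta>_0 zero_fun_def)
    have "t \<odot>\<^bsub>?E\<^esub> fib w = (\<Union>x\<in>fib w. N #>\<^bsub>G\<^esub> ?f x)" by (simp add: E_eq)
    also have "\<dots> = (\<Union>x\<in>fib w. fib (\<lambda>j. t * w j))"
    proof (intro SUP_cong refl)
      fix x assume "x \<in> fib w"
      then show "N #>\<^bsub>G\<^esub> ?f x = fib (\<lambda>j. t * w j)" using ext[of x] coset[of "?f x"] by (auto simp: fib_def)
    qed
    also have "\<dots> = fib (\<lambda>j. t * w j)" using u_fib[OF that] by blast
    finally show ?thesis .
  qed
  have W_closed: "w + w' \<in> W" "(\<lambda>j. t * w j) \<in> W" "0 \<in> W" "- w \<in> W" if "w \<in> W" "w' \<in> W" for w w' t
    using that by (auto simp: W_def)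
  have W0: "0 \<in> W" by (simp add: W_def)
  have E_vs: "vectorspace (class_ring :: 'k poly fract ring) ?E"
  proof (rule vs_criteria)
    show "field (class_ring :: 'k poly fract ring)" by (rule class_field)
    show "\<forall>v\<in>carrier ?E. \<exists>neg_v\<in>carrier ?E. v \<oplus>\<^bsub>?E\<^esub> neg_v = \<zero>\<^bsub>?E\<^esub>"
    proof
      fix v assume "v \<in> carrier ?E"
      then obtain w where w: "w \<in> W" "v = fib w" unfolding E_carrier by blast
      then have "v \<oplus>\<^bsub>?E\<^esub> fib (- w) = \<zero>\<^bsub>?E\<^esub>" using E_add[of w "- w"] W_closed[OF w(1,1)] by (simp add: E_zero)
      then show "\<exists>neg_v\<in>carrier ?E. v \<oplus>\<^bsub>?E\<^esub> neg_v = \<zero>\<^bsub>?E\<^esub>"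
        unfolding E_carrier using W_closed(4)[OF w(1,1)] by blast
    qed
  qed (auto simp: E_carrier E_zero E_add E_smult W_closed W0 plus_fun_def
      W_closed(1)[unfolded plus_fun_def] algebra_simps)
  let ?V = "module_vec TYPE('k poly fract) r"
  define \<eta> where "\<eta> v = fib (\<lambda>j. if j < r then v $ j else 0)" for v :: "'k poly fract vec"
  have inW: "(\<lambda>j. if j < r then v $ j else 0) \<in> W" for v :: "'k poly fract vec" by (simp add: W_def)
  have V_vs: "vectorspace (class_ring :: 'k poly fract ring) ?V" by (rule vec_vs)
  have "\<eta> \<in> LinearCombinations.module_hom class_ring ?V ?E"
    unfolding LinearCombinations.module_hom_def
  proof (intro CollectI conjI allI impI)
    show "\<eta> \<in> carrier ?V \<rightarrow> carrier ?E" using inW by (auto simp: E_carrier \<eta>_def)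
  next
    fix v w assume "v \<in> carrier ?V \<and> w \<in> carrier ?V"
    then have "dim_vec v = r" "dim_vec w = r" by (auto simp: module_vec_def)
    then show "\<eta> (v \<oplus>\<^bsub>?V\<^esub> w) = \<eta> v \<oplus>\<^bsub>?E\<^esub> \<eta> w"
      by (auto simp: module_vec_def \<eta>_def E_add inW fun_eq_iff intro!: arg_cong[of _ _ fib])
  next
    fix t :: "'k poly fract" and v assume "t \<in> carrier class_ring \<and> v \<in> carrier ?V"
    then have "dim_vec v = r" by (auto simp: module_vec_def)
    then show "\<eta> (t \<odot>\<^bsub>?V\<^esub> v) = t \<odot>\<^bsub>?E\<^esub> \<eta> v"
      by (auto simp: module_vec_def \<eta>_def E_smult inW fun_eq_iff intro!: arg_cong[of _ _ fib])
  qed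
  then have lin: "linear_map class_ring ?V ?E \<eta>"
    using V_vs E_vs unfolding linear_map_def mod_hom_def mod_hom_axioms_def vectorspace_def by blast
  have inj: "inj_on \<eta> (carrier ?V)"
  proof (rule inj_onI)
    fix v w assume vw: "v \<in> carrier ?V" "w \<in> carrier ?V" "\<eta> v = \<eta> w"
    have "(\<lambda>j. if j < r then v $ j else 0) = (\<lambda>j. if j < r then w $ j else 0)"
      using vw(3) inW unfolding \<eta>_def by (rule fib_inj)
    then have "v $ j = w $ j" if "j < r" for j using that by (metis)
    then show "v = w" using vw(1,2) by (intro eq_vecI) (auto simp: module_vec_def)
  qed
  have surj: "\<eta> ` carrier ?V = carrier ?E"
  proof (intro equalityI subsetI)
    fix C assume "C \<in> carrier ?E"
    then obtain w where w: "w \<in> W" "C = fib w" unfolding E_carrier by blast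
    then have "(\<lambda>j. if j < r then vec r w $ j else 0) = w" by (auto simp: W_def fun_eq_iff)
    then have "C = \<eta> (vec r w)" using w by (simp add: \<eta>_def)
    then show "C \<in> \<eta> ` carrier ?V" by (auto simp: module_vec_def)
  qed (use inW in \<open>auto simp: E_carrier \<eta>_def\<close>)
  interpret V: vec_space "TYPE('k poly fract)" r .
  have "vectorspace.fin_dim (class_ring :: 'k poly fract ring) ?V" by (rule V.fin_dim)
  from linear_map.dim_eq[OF lin this inj surj] show ?thesis by (simp add: V.dim_is_n)
qed

end

section \<open>Finite torsion modules over \<open>\<F>\<^sub>q[T]\<close>\<close>

text \<open>Euclid's algorithm. The induction measure separates \<open>b = 0\<close> from nonzero
  constants, which also have degree 0.\<close>

lemma field_poly_bezout:
  fixes a b :: "'a::field poly"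
  shows "\<exists>u v. u * a + v * b dvd a \<and> u * a + v * b dvd b"
proof (induction "if b = 0 then 0 else Suc (degree b)" arbitrary: a b rule: less_induct)
  case less
  show ?case
  proof (cases "b = 0")
    case True then show ?thesis by (intro exI[of _ 1] exI[of _ 0]) simp
  next
    case False
    then have "(if a mod b = 0 then 0 else Suc (degree (a mod b))) < (if b = 0 then 0 else Suc (degree b))"
      using degree_mod_less[of b a] by auto
    from less[OF this] obtain u v where uv: "u * b + v * (a mod b) dvd b" "u * b + v * (a mod b) dvd a mod b"
      by blast
    define g where "g = u * b + v * (a mod b)"
    have g: "g = v * a + (u - v * (a div b)) * b"
      unfolding g_def by (subst minus_div_mult_eq_mod[symmetric]) (simp add: algebra_simps)
    have "g dvd a div b * b + a mod b" using uv unfolding g_def[symmetric] by (intro dvd_add dvd_mult)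
    then have "g dvd a" by simp
    then show ?thesis using uv(1)[folded g_def] g by metis
  qed
qed

lemma coprime_imp_comaximal:
  fixes a b :: "'a::field poly"
  assumes "coprime a b" shows "comaximal a b"
proof -
  obtain u v where "u * a + v * b dvd a" "u * a + v * b dvd b" using field_poly_bezout by blast
  then have "u * a + v * b dvd 1" using assms by (meson coprime_def)
  then obtain w where "1 = (u * a + v * b) * w" by (auto elim: dvdE)
  then have "(w * u) * a + (w * v) * b = 1" by (simp add: algebra_simps)
  then show ?thesis unfolding comaximal_def by blast
qed

text \<open>Take a nonconstant divisor \<pi> of least degree: its greatest common divisor with any
  \<open>b\<close> is either constant or associated to \<pi>.\<close>

lemma prime_divisor_exists:
  fixes a :: "'a::field poly"
  assumes "degree a > 0"
  shows "\<exists>\<pi>. \<pi> dvd a \<and> degree \<pi> > 0 \<and> (\<forall>b. \<pi> dvd b \<or> comaximal b \<pi>)"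
proof -
  define P where "P \<pi> \<longleftrightarrow> \<pi> dvd a \<and> degree \<pi> > 0" for \<pi>
  define \<pi> where "\<pi> = arg_min degree P"
  have "P a" using assms by (simp add: P_def)
  then have \<pi>: "P \<pi>" unfolding \<pi>_def by (rule arg_min_natI)
  have min: "degree \<pi> \<le> degree g" if "P g" for g
    unfolding \<pi>_def using that by (rule arg_min_nat_le)
  have "\<pi> dvd b \<or> comaximal b \<pi>" for b
  proof -
    obtain u v where g: "u * b + v * \<pi> dvd b" "u * b + v * \<pi> dvd \<pi>" using field_poly_bezout by blast
    define h where "h = u * b + v * \<pi>"
    obtain k where k: "\<pi> = h * k" using g h_def by (auto elim: dvdE)
    have nz: "h \<noteq> 0" "k \<noteq> 0" using k \<pi> by (auto simp: P_def)
    show ?thesis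
    proof (cases "degree h > 0")
      case True
      then have "degree \<pi> \<le> degree h" using min[of h] \<pi> k by (auto simp: P_def intro: dvd_mult_left)
      then have "degree k = 0" using nz by (simp add: k degree_mult_eq)
      then have "k dvd 1" using nz by (auto simp: is_unit_iff_degree)
      then have "\<pi> dvd h" using k by (metis dvd_refl mult_unit_dvd_iff)
      then show ?thesis using g h_def dvd_trans by blast
    next
      case False
      then have "h dvd 1" using nz by (auto simp: is_unit_iff_degree)
      then obtain w where "1 = h * w" by (auto elim: dvdE)
      then have "(w * u) * b + (w * v) * \<pi> = 1" by (simp add: h_def algebra_simps)
      then show ?thesis unfolding comaximal_def by blast
    qed
  qed
  then show ?thesis using \<pi> by (auto simp: P_def)
qed

lemma card_polys_degree_less:
  fixes d :: nat
  assumes "finite (UNIV :: 'a::field set)"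
  shows "finite {P :: 'a poly. P = 0 \<or> degree P < d} \<and>
    card {P :: 'a poly. P = 0 \<or> degree P < d} = card (UNIV :: 'a set) ^ d"
proof (induction d)
  case 0 then show ?case by simp
next
  case (Suc d)
  let ?S = "\<lambda>d. {P :: 'a poly. P = 0 \<or> degree P < d}"
  have "?S (Suc d) = (\<lambda>(a, P). pCons a P) ` (UNIV \<times> ?S d)"
  proof (intro equalityI subsetI)
    fix P assume P: "P \<in> ?S (Suc d)"
    obtain a Q where "P = pCons a Q" by (cases P)
    then show "P \<in> (\<lambda>(a, P). pCons a P) ` (UNIV \<times> ?S d)"
      using P by (auto simp: degree_pCons_eq_if split: if_splits)
  qed (auto simp: degree_pCons_eq_if split: if_splits)
  moreover have "inj_on (\<lambda>(a, P). pCons a P) (UNIV \<times> ?S d)" by (auto simp: inj_on_def)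
  ultimately show ?case using Suc assms by (simp add: card_image card_cartesian_product)
qed

lemma card_additive_image:
  fixes f :: "'a::ab_group_add \<Rightarrow> 'b::ab_group_add"
  assumes fin: "finite G" and G: "\<And>x y. x \<in> G \<Longrightarrow> y \<in> G \<Longrightarrow> x + y \<in> G" "\<And>x y. x \<in> G \<Longrightarrow> y \<in> G \<Longrightarrow> x - y \<in> G"
    and f: "\<And>x y. x \<in> G \<Longrightarrow> y \<in> G \<Longrightarrow> f (x + y) = f x + f y"
  shows "card G = card {x \<in> G. f x = 0} * card (f ` G)"
proof -
  have "card {x \<in> G. f x = y} = card {x \<in> G. f x = 0}" if y: "y \<in> f ` G" for y
  proof -
    obtain x0 where x0: "x0 \<in> G" "y = f x0" using y by blast
    have f_diff: "f (x - x0) = f x - f x0" if "x \<in> G" for x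
      using f[of "x - x0" x0] G x0 that by (simp add: eq_diff_eq)
    have "bij_betw (\<lambda>x. x + x0) {x \<in> G. f x = 0} {x \<in> G. f x = y}"
      by (rule bij_betw_byWitness[where f' = "\<lambda>x. x - x0"]) (use x0 G f f_diff in auto)
    from bij_betw_same_card[OF this] show ?thesis by simp
  qed
  moreover have "card G = (\<Sum>y\<in>f ` G. card {x \<in> G. f x = y})"
    using sum.image_gen[OF fin, of "\<lambda>_. 1::nat" f] by simp
  ultimately show ?thesis by simp
qed

section \<open>Torsion modules determined by counting\<close>

locale poly_module =
  fixes G :: "'b::ab_group_add set" and act :: "'f::field poly \<Rightarrow> 'b \<Rightarrow> 'b"
  assumes G_0: "0 \<in> G" and G_add: "x \<in> G \<Longrightarrow> y \<in> G \<Longrightarrow> x + y \<in> G"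
    and G_act: "x \<in> G \<Longrightarrow> act b x \<in> G"
    and act_add: "x \<in> G \<Longrightarrow> y \<in> G \<Longrightarrow> act b (x + y) = act b x + act b y"
    and act_add_left: "x \<in> G \<Longrightarrow> act (b + c) x = act b x + act c x"
    and act_mult: "x \<in> G \<Longrightarrow> act (b * c) x = act b (act c x)"
    and act_1: "x \<in> G \<Longrightarrow> act 1 x = x"
begin

lemma act_0: "act b 0 = 0" using act_add[of 0 0 b] G_0 by simp

lemma act_0_left: "x \<in> G \<Longrightarrow> act 0 x = 0" using act_add_left[of x 0 0] by simp

lemma act_minus_left: "x \<in> G \<Longrightarrow> act (- b) x = - act b x"
  using act_add_left[of x b "- b"] act_0_left[of x] by (simp add: eq_neg_iff_add_eq_0 add.commute)

lemma act_diff_left: "x \<in> G \<Longrightarrow> act (b - c) x = act b x - act c x"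
  using act_add_left[of x b "- c"] act_minus_left[of x c] by simp

lemma G_minus: "x \<in> G \<Longrightarrow> - x \<in> G"
  using act_minus_left[of x 1] act_1[of x] G_act[of x "-1"] by simp

lemma G_diff: "x \<in> G \<Longrightarrow> y \<in> G \<Longrightarrow> x - y \<in> G"
  using G_add[of x "- y"] G_minus by simp

lemma act_diff:
  assumes "x \<in> G" "y \<in> G" shows "act b (x - y) = act b x - act b y"
  using act_add[of "x - y" y b] assms G_diff by (simp add: eq_diff_eq)

lemma G_sum: "(\<And>i. i \<in> I \<Longrightarrow> f i \<in> G) \<Longrightarrow> sum f I \<in> G"
  by (induction I rule: infinite_finite_induct) (auto simp: G_0 G_add)

lemma act_sum: "(\<And>i. i \<in> I \<Longrightarrow> f i \<in> G) \<Longrightarrow> act b (sum f I) = (\<Sum>i\<in>I. act b (f i))"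
  by (induction I rule: infinite_finite_induct) (auto simp: act_0 act_add G_sum)

lemma act_commute: "x \<in> G \<Longrightarrow> act b (act c x) = act c (act b x)"
  by (metis act_mult mult.commute)

definition tors :: "'f poly \<Rightarrow> 'b set" where "tors b = {x \<in> G. act b x = 0}"

lemma tors_G: "x \<in> tors b \<Longrightarrow> x \<in> G" by (simp add: tors_def)

lemma tors_dvd:
  assumes "b dvd c" "x \<in> tors b" shows "x \<in> tors c"
proof -
  obtain d where "c = b * d" using assms(1) by (rule dvdE)
  then show ?thesis using assms(2) by (auto simp: tors_def mult.commute[of b] act_mult act_0)
qed

lemma act_tors: "x \<in> tors (b * c) \<Longrightarrow> act b x \<in> tors c"
  by (auto simp: tors_def G_act act_mult[symmetric] mult.commute)

lemma act_cong_tors: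
  assumes "x \<in> tors a" "a dvd b - c" shows "act b x = act c x"
proof -
  have "act (b - c) x = 0" using tors_dvd[OF assms(2,1)] by (simp add: tors_def)
  then show ?thesis using assms(1) by (simp add: act_diff_left tors_def)
qed

definition free_family :: "'f poly \<Rightarrow> (nat \<Rightarrow> 'b) \<Rightarrow> nat \<Rightarrow> bool"
  where "free_family a v r \<longleftrightarrow> (\<forall>j<r. v j \<in> tors a) \<and>
    (\<forall>b. (\<Sum>j<r. act (b j) (v j)) = 0 \<longrightarrow> (\<forall>j<r. a dvd b j))"

lemma free_familyD: "free_family a v r \<Longrightarrow> (\<Sum>j<r. act (b j) (v j)) = 0 \<Longrightarrow> j < r \<Longrightarrow> a dvd b j"
  unfolding free_family_def by blast

lemma act_act_sum:
  assumes "\<And>j. j < r \<Longrightarrow> v j \<in> G" "\<And>j. j < r \<Longrightarrow> act c (v j) = w j"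
  shows "act c (\<Sum>j<r. act (b j) (v j)) = (\<Sum>j<r. act (b j) (w j))"
proof -
  have "act c (\<Sum>j<r. act (b j) (v j)) = (\<Sum>j<r. act c (act (b j) (v j)))"
    using assms(1) by (intro act_sum G_act) auto
  also have "\<dots> = (\<Sum>j<r. act (b j) (act c (v j)))"
    using assms(1) by (intro sum.cong refl) (metis act_mult lessThan_iff mult.commute)
  finally show ?thesis using assms(2) by simp
qed

text \<open>Linear algebra over the field \<open>A/\<pi>\<close>: the combinations of
  \<open>k < r\<close> vectors number at most \<open>q^(k * degree \<pi>)\<close>, too few to fill
  the torsion. A vector \<open>x\<close> outside them can be added, since a coefficient of
  \<open>x\<close> not divisible by \<pi> would be invertible modulo \<pi> and make \<open>x\<close>
  such a combination.\<close>

lemma free_family_prime: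
  assumes fin: "finite (UNIV :: 'f set)" and \<pi>: "degree \<pi> > 0" "\<And>b. \<pi> dvd b \<or> comaximal b \<pi>"
    and card: "card (tors \<pi>) = card (UNIV :: 'f set) ^ (r * degree \<pi>)" and k: "k \<le> r"
  shows "\<exists>u. free_family \<pi> u k"
  using k
proof (induction k)
  case 0 then show ?case by (auto simp: free_family_def)
next
  case (Suc k)
  then obtain u where u: "free_family \<pi> u k" by auto
  then have ut: "u j \<in> tors \<pi>" if "j < k" for j using that by (auto simp: free_family_def)
  define D where "D = {P :: 'f poly. P = 0 \<or> degree P < degree \<pi>}"
  define s where "s b = (\<Sum>j<k. act (b j) (u j))" for b
  have D: "finite D" "card D = card (UNIV :: 'f set) ^ degree \<pi>"
    using card_polys_degree_less[OF fin] by (auto simp: D_def)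
  have rng: "s b \<in> s ` ({..<k} \<rightarrow>\<^sub>E D)" for b
  proof -
    have "s b = s (\<lambda>j\<in>{..<k}. b j mod \<pi>)"
      unfolding s_def
    proof (intro sum.cong refl)
      fix j assume "j \<in> {..<k}"
      moreover have "\<pi> dvd b j - b j mod \<pi>" by (simp add: minus_mod_eq_mult_div)
      ultimately show "act (b j) (u j) = act ((\<lambda>j\<in>{..<k}. b j mod \<pi>) j) (u j)"
        using act_cong_tors[OF ut] by simp
    qed
    moreover have "(\<lambda>j\<in>{..<k}. b j mod \<pi>) \<in> {..<k} \<rightarrow>\<^sub>E D"
    proof -
      have "\<pi> \<noteq> 0" using \<pi>(1) by auto
      then have "P mod \<pi> \<in> D" for P using degree_mod_less[of \<pi> P] unfolding D_def by blast
      then show ?thesis by auto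
    qed
    ultimately show ?thesis by (rule image_eqI)
  qed
  have "card (s ` ({..<k} \<rightarrow>\<^sub>E D)) \<le> card ({..<k} \<rightarrow>\<^sub>E D)"
    using D by (intro card_image_le finite_PiE) auto
  also have "\<dots> = card (UNIV :: 'f set) ^ (k * degree \<pi>)"
    by (simp add: card_PiE D power_mult[symmetric] mult.commute)
  also have "\<dots> < card (tors \<pi>)"
  proof -
    have "card {0, 1 :: 'f} \<le> card (UNIV :: 'f set)" using fin by (intro card_mono) auto
    then have "card (UNIV :: 'f set) > 1" by simp
    moreover have "k * degree \<pi> < r * degree \<pi>" using Suc.prems \<pi>(1) by simp
    ultimately show ?thesis unfolding card by (simp add: power_strict_increasing)
  qed
  finally have "\<not> tors \<pi> \<subseteq> s ` ({..<k} \<rightarrow>\<^sub>E D)"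
    using D card_mono[of "s ` ({..<k} \<rightarrow>\<^sub>E D)" "tors \<pi>"] finite_PiE[of "{..<k}" "\<lambda>_. D"] by fastforce
  then obtain x where x: "x \<in> tors \<pi>" "\<And>b. s b \<noteq> x" using rng by blast
  have "free_family \<pi> (u(k := x)) (Suc k)"
    unfolding free_family_def
  proof (intro conjI allI impI)
    show "(u(k := x)) j \<in> tors \<pi>" if "j < Suc k" for j using that ut x by (auto simp: less_Suc_eq)
  next
    fix b j assume b: "(\<Sum>j<Suc k. act (b j) ((u(k := x)) j)) = 0" and j: "j < Suc k"
    have "(\<Sum>j<k. act (b j) ((u(k := x)) j)) = s b" unfolding s_def by (intro sum.cong) auto
    then have sb: "s b + act (b k) x = 0" using b by simp
    have dk: "\<pi> dvd b k"
    proof (rule ccontr)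
      assume "\<not> \<pi> dvd b k"
      then obtain c d where cd: "c * b k + d * \<pi> = 1"
        using \<pi>(2)[of "b k"] unfolding comaximal_def by blast
      have "x = act (c * b k + d * \<pi>) x" using cd x by (simp add: act_1 tors_def)
      also have "\<dots> = act c (act (b k) x)" using x by (simp add: act_add_left act_mult tors_def act_0)
      also have "act (b k) x = (\<Sum>j<k. act (- b j) (u j))"
        using sb ut by (simp add: s_def act_minus_left tors_def sum_negf eq_neg_iff_add_eq_0 add.commute)
      also have "act c \<dots> = (\<Sum>j<k. act c (act (- b j) (u j)))"
        using ut by (intro act_sum G_act) (auto simp: tors_def)
      also have "\<dots> = s (\<lambda>j. c * - b j)"
        using ut unfolding s_def by (intro sum.cong refl act_mult[symmetric]) (auto simp: tors_def)
      finally show False using x(2) by metis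
    qed
    then have "act (b k) x = 0" using tors_dvd x(1) by (auto simp: tors_def)
    then have "(\<Sum>j<k. act (b j) (u j)) = 0" using sb by (simp add: s_def)
    then have "\<pi> dvd b j" if "j < k" using free_familyD[OF u _ that] by blast
    then show "\<pi> dvd b j" using j dk less_Suc_eq by blast
  qed
  then show ?case by (intro exI[of _ "u(k := x)"])
qed

text \<open>The kernel of \<open>b\<close> on the torsion of \<open>b * c\<close> is the torsion of
  \<open>b\<close>, so the image has the cardinality of its target. That \<open>card\<close> is
  nonzero also provides finiteness.\<close>

lemma act_surj_tors:
  assumes nz: "card (tors (b * c)) \<noteq> 0" and card: "card (tors (b * c)) = card (tors b) * card (tors c)"
  shows "act b ` tors (b * c) = tors c"
proof (rule card_subset_eq)
  have fin: "finite (tors (b * c))" "finite (tors c)" "card (tors b) \<noteq> 0"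
    using assms by (auto intro: card_ge_0_finite)
  show "finite (tors c)" by fact
  show "act b ` tors (b * c) \<subseteq> tors c" using act_tors by blast
  have "card (tors (b * c)) = card {x \<in> tors (b * c). act b x = 0} * card (act b ` tors (b * c))"
    using fin(1) by (intro card_additive_image) (auto simp: tors_def G_add G_diff act_add act_diff)
  also have "{x \<in> tors (b * c). act b x = 0} = tors b"
    using tors_dvd[of b "b * c"] by (auto simp: tors_def)
  finally show "card (act b ` tors (b * c)) = card (tors c)" using card fin(3) by simp
qed

text \<open>Induction along \<open>a = \<pi> * a'\<close> with \<pi> prime: a free family for
  \<open>a'\<close> is lifted through multiplication by \<pi>. If \<pi> divides \<open>a'\<close>,
  the counts make the lift possible and every lift is free; otherwise the Chinese remainder theorem
  combines it with a free family for \<pi>.\<close>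

lemma free_family_exists:
  assumes fin: "finite (UNIV :: 'f set)" and "a \<noteq> 0"
    and "\<And>b. b dvd a \<Longrightarrow> card (tors b) = card (UNIV :: 'f set) ^ (r * degree b)"
  shows "\<exists>v. free_family a v r"
  using assms(2-)
proof (induction "degree a" arbitrary: a rule: less_induct)
  case less
  show ?case
  proof (cases "degree a = 0")
    case True
    then have "a dvd 1" using less.prems(1) by (simp add: is_unit_iff_degree)
    then have "a dvd b" for b using dvd_trans by blast
    then have "free_family a (\<lambda>_. 0) r" by (auto simp: free_family_def tors_def G_0 act_0)
    then show ?thesis by blast
  next
    case False
    then obtain \<pi> where \<pi>: "\<pi> dvd a" "degree \<pi> > 0" "\<And>b. \<pi> dvd b \<or> comaximal b \<pi>"
      using prime_divisor_exists[of a] by blast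
    obtain a' where a': "a = \<pi> * a'" using \<pi>(1) by (auto elim: dvdE)
    have nz: "\<pi> \<noteq> 0" "a' \<noteq> 0" using less.prems(1) a' by auto
    have deg: "degree a = degree \<pi> + degree a'" using nz by (simp add: a' degree_mult_eq)
    then obtain v where v: "free_family a' v r"
      using less.hyps[of a'] less.prems(2) nz \<pi>(2) a' by (auto dest: dvd_mult_left)
    have vt: "v j \<in> tors a'" if "j < r" for j using v that by (auto simp: free_family_def)
    have card_\<pi>: "card (tors \<pi>) = card (UNIV :: 'f set) ^ (r * degree \<pi>)" using less.prems(2) \<pi>(1) by blast
    \<comment> \<open>Multiplying a relation among the \<open>w j\<close> by \<pi> gives one among
      the \<open>v j\<close>, so \<open>a'\<close> divides all coefficients. What remains is a
      relation among the \<open>a' w j\<close>, to which \<open>dv\<close> applies.\<close>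
    have key: "free_family a w r"
      if w: "\<And>j. j < r \<Longrightarrow> w j \<in> tors a" "\<And>j. j < r \<Longrightarrow> act \<pi> (w j) = v j"
        and dv: "\<And>c j. (\<Sum>j<r. act (c j) (act a' (w j))) = 0 \<Longrightarrow> j < r \<Longrightarrow> \<pi> dvd c j" for w
      unfolding free_family_def
    proof (intro conjI allI impI w(1))
      fix b j assume b: "(\<Sum>j<r. act (b j) (w j)) = 0" and j: "j < r"
      have "act \<pi> (\<Sum>j<r. act (b j) (w j)) = (\<Sum>j<r. act (b j) (v j))"
        using w by (intro act_act_sum) (auto simp: tors_def)
      then have "\<forall>j. \<exists>c. j < r \<longrightarrow> b j = a' * c"
        using free_familyD[OF v, of b] b by (auto simp: act_0 dvd_def)
      then obtain c where c: "\<And>j. j < r \<Longrightarrow> b j = a' * c j" by metis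
      have "(\<Sum>j<r. act (c j) (act a' (w j))) = (\<Sum>j<r. act (b j) (w j))"
        using w(1) c by (intro sum.cong refl) (simp add: act_mult[symmetric] tors_def mult.commute)
      then have "\<pi> dvd c j" using dv[of c] b j by simp
      then show "a dvd b j" using c j by (simp add: a')
    qed
    show ?thesis
    proof (cases "\<pi> dvd a'")
      case True
      then obtain a'' where a'': "a' = \<pi> * a''" by (auto elim: dvdE)
      have c1: "card (UNIV :: 'f set) \<noteq> 0" using fin by simp
      have "card (tors a) = card (tors \<pi>) * card (tors a')"
        using less.prems(2)[of a] less.prems(2)[of \<pi>] less.prems(2)[of a'] a' deg
        by (simp add: power_add[symmetric] algebra_simps)
      moreover have "card (tors a) \<noteq> 0" using less.prems(2)[of a] c1 by simp
      ultimately have surj: "act \<pi> ` tors a = tors a'"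
        using act_surj_tors[of \<pi> a', folded a'] by blast
      then have "\<forall>j. \<exists>x. j < r \<longrightarrow> x \<in> tors a \<and> act \<pi> x = v j" using vt by (metis imageE)
      then obtain w where w: "\<And>j. j < r \<Longrightarrow> w j \<in> tors a" "\<And>j. j < r \<Longrightarrow> act \<pi> (w j) = v j" by metis
      \<comment> \<open>As \<open>a' = \<pi> * a''\<close>, the vector \<open>a' w j\<close> is
        \<open>a'' v j\<close>. Freeness of \<open>v\<close> gives that \<open>\<pi> * a''\<close>
        divides \<open>c j * a''\<close>.\<close>
      have "\<pi> dvd c j" if c: "(\<Sum>j<r. act (c j) (act a' (w j))) = 0" and j: "j < r" for c j
      proof -
        have "act (c j) (act a' (w j)) = act (c j * a'') (v j)" if "j < r" for j
        proof -
          have "act a' (w j) = act a'' (v j)"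
            using w[OF that] by (simp add: a'' mult.commute[of \<pi>] act_mult tors_def)
          then show ?thesis using vt[OF that] by (simp add: act_mult tors_def)
        qed
        then have "(\<Sum>j<r. act (c j * a'') (v j)) = 0" using c by simp
        then have "a' dvd c j * a''" using free_familyD[OF v, of "\<lambda>j. c j * a''"] j by blast
        then show ?thesis using nz by (simp add: a'')
      qed
      then show ?thesis using key[OF w] by blast
    next
      case False
      then obtain s t where st: "s * a' + t * \<pi> = 1" using \<pi>(3)[of a'] by (auto simp: comaximal_def)
      obtain u where u: "free_family \<pi> u r" using free_family_prime[OF fin \<pi>(2,3) card_\<pi>] by blast
      have ut: "u j \<in> tors \<pi>" if "j < r" for j using u that by (auto simp: free_family_def)
      \<comment> \<open>From \<open>s * a' + t * \<pi> = 1\<close> this \<open>w j\<close> satisfies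
        both \<open>\<pi> w j = v j\<close> and \<open>a' w j = u j\<close>.\<close>
      define w where "w j = act s (u j) + act t (v j)" for j
      have wG: "w j \<in> G" if "j < r" for j
        using ut[OF that] vt[OF that] by (auto simp: w_def tors_def intro: G_add G_act)
      have w1: "act \<pi> (w j) = v j" if "j < r" for j
      proof -
        have "act \<pi> (w j) = act s (act \<pi> (u j)) + act t (act \<pi> (v j))"
          using ut[OF that] vt[OF that]
          by (simp add: w_def act_add G_act tors_def act_commute[of _ \<pi>])
        also have "\<dots> = act (s * a' + t * \<pi>) (v j)"
          using ut[OF that] vt[OF that] by (simp add: act_add_left tors_def act_0 act_mult)
        finally show ?thesis using st vt[OF that] by (simp add: act_1 tors_def)
      qed
      have w2: "act a' (w j) = u j" if "j < r" for j
      proof -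
        have "act a' (w j) = act s (act a' (u j)) + act t (act a' (v j))"
          using ut[OF that] vt[OF that]
          by (simp add: w_def act_add G_act tors_def act_commute[of _ a'])
        also have "\<dots> = act (s * a' + t * \<pi>) (u j)"
          using ut[OF that] vt[OF that] by (simp add: act_add_left tors_def act_0 act_mult)
        finally show ?thesis using st ut[OF that] by (simp add: act_1 tors_def)
      qed
      have w3: "w j \<in> tors a" if "j < r" for j
      proof -
        have "act a (w j) = act a' (act \<pi> (w j))"
          using wG[OF that] by (simp add: a' mult.commute[of \<pi>] act_mult)
        then show ?thesis using wG[OF that] w1[OF that] vt[OF that] by (simp add: tors_def)
      qed
      have "\<pi> dvd c j" if c: "(\<Sum>j<r. act (c j) (act a' (w j))) = 0" and j: "j < r" for c j
      proof -
        have "(\<Sum>j<r. act (c j) (u j)) = 0" using c w2 by simp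
        then show ?thesis using free_familyD[OF u] j by blast
      qed
      then show ?thesis using key[OF w3 w1] by blast
    qed
  qed
qed

text \<open>Combinations of a free family with coefficients reduced modulo \<open>a\<close> are
  distinct, and there are as many of them as torsion elements; so they exhaust the torsion.\<close>

theorem free_basis_exists:
  assumes fin: "finite (UNIV :: 'f set)" and a: "a \<noteq> 0"
    and card: "\<And>b. b dvd a \<Longrightarrow> card (tors b) = card (UNIV :: 'f set) ^ (r * degree b)"
  obtains v where "free_family a v r" "\<And>x. x \<in> tors a \<Longrightarrow> \<exists>b. x = (\<Sum>j<r. act (b j) (v j))"
proof -
  obtain v where v: "free_family a v r" using free_family_exists[OF fin a card] by blast
  have vt: "v j \<in> tors a" if "j < r" for j using v that by (auto simp: free_family_def)
  define D where "D = {P :: 'f poly. P = 0 \<or> degree P < degree a}"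
  have D: "finite D" "card D = card (UNIV :: 'f set) ^ degree a"
    using card_polys_degree_less[OF fin] by (auto simp: D_def)
  define s where "s b = (\<Sum>j<r. act (b j) (v j))" for b
  have inj: "inj_on s ({..<r} \<rightarrow>\<^sub>E D)"
  proof (rule inj_onI)
    fix b c assume b: "b \<in> {..<r} \<rightarrow>\<^sub>E D" and c: "c \<in> {..<r} \<rightarrow>\<^sub>E D" and eq: "s b = s c"
    have "(\<Sum>j<r. act (b j - c j) (v j)) = (\<Sum>j<r. act (b j) (v j) - act (c j) (v j))"
      using vt by (intro sum.cong refl act_diff_left) (auto simp: tors_def)
    then have z: "(\<Sum>j<r. act (b j - c j) (v j)) = 0" using eq by (simp add: s_def sum_subtractf)
    show "b = c"
    proof (rule PiE_ext[OF b c])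
      fix j assume j: "j \<in> {..<r}"
      then have dv: "a dvd b j - c j" using free_familyD[OF v z] by blast
      have "b j \<in> D" "c j \<in> D" using b c j by (auto simp: PiE_iff)
      then have "b j - c j = 0 \<or> degree (b j - c j) < degree a"
        unfolding D_def using degree_diff_less[of "b j" "degree a" "c j"] by auto
      then have "b j - c j = 0" using dv dvd_imp_degree_le[of a "b j - c j"] by (metis leD)
      then show "b j = c j" by simp
    qed
  qed
  have "s ` ({..<r} \<rightarrow>\<^sub>E D) = tors a"
  proof (rule card_subset_eq)
    have "card (tors a) > 0" using card[of a] fin by (simp add: card_gt_0_iff)
    then show "finite (tors a)" by (rule card_ge_0_finite)
    show "s ` ({..<r} \<rightarrow>\<^sub>E D) \<subseteq> tors a"
    proof clarify
      fix b
      have "act a (s b) = (\<Sum>j<r. act (b j) 0)"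
        unfolding s_def using vt by (intro act_act_sum) (auto simp: tors_def)
      moreover have "s b \<in> G" unfolding s_def using vt by (intro G_sum G_act) (auto simp: tors_def)
      ultimately show "s b \<in> tors a" by (simp add: tors_def act_0)
    qed
    show "card (s ` ({..<r} \<rightarrow>\<^sub>E D)) = card (tors a)"
      using card[of a] by (simp add: card_image[OF inj] card_PiE D power_mult[symmetric] mult.commute)
  qed
  then show thesis using that[OF v] unfolding s_def by blast
qed

end

section \<open>The functions on a \<open>q\<close>-variety\<close>

lemma finite_field_power_card:
  fixes x :: "'f::field"
  assumes fin: "finite (UNIV :: 'f set)"
  shows "x ^ card (UNIV :: 'f set) = x"
proof (cases "x = 0")
  case True
  then show ?thesis using fin by (simp add: power_0_left)
next
  case False
  let ?U = "UNIV - {0 :: 'f}"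
  have "prod (\<lambda>y. x * y) ?U = prod id ?U"
    by (rule prod.reindex_bij_witness[of _ "\<lambda>y. y / x" "\<lambda>y. x * y"]) (use False in auto)
  moreover have "prod id ?U \<noteq> 0" using fin by simp
  moreover have "prod (\<lambda>y. x * y) ?U = x ^ card ?U * prod id ?U"
    by (simp add: prod.distrib)
  ultimately have "x ^ card ?U = 1" by simp
  moreover have "card (UNIV :: 'f set) = Suc (card ?U)"
    using fin by (simp add: card_Suc_Diff1 del: card_Diff_insert)
  ultimately show ?thesis by (simp only: power_Suc mult_1_right)
qed

locale A_module =
  fixes p q e n :: nat
    and \<iota> :: "'f::field \<Rightarrow> 'k::alg_closed_field"
    and \<delta> :: "'f poly \<Rightarrow> 'k"
    and F :: "'k vec set"
    and \<Phi> :: "'f poly \<Rightarrow> 'k vec \<Rightarrow> 'k vec"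
  assumes prime_p: "prime p" and char_p: "CHAR('k) = p"
    and e_pos: "e \<ge> 1" and q_def: "q = p ^ e"
    and card_f: "card (UNIV :: 'f set) = q" and \<iota>_hom: "field_hom \<iota>"
    and \<delta>_hom: "A_algebra_hom_to_K \<iota> \<delta>"
    and variety: "q_variety q n F"
    and module_struct: "A_module_structure q \<iota> \<delta> n F \<Phi>"
begin

sublocale \<iota>: field_hom \<iota> by (rule \<iota>_hom)

abbreviation ofA :: "'f poly \<Rightarrow> 'k poly" where "ofA \<equiv> map_poly \<iota>"

lemma ofA_add: "ofA (a + b) = ofA a + ofA b"
  by (rule poly_eqI) (simp add: coeff_map_poly \<iota>.hom_add)

lemma ofA_mult: "ofA (a * b) = ofA a * ofA b"
  by (rule poly_eqI) (simp add: coeff_map_poly coeff_mult \<iota>.hom_sum \<iota>.hom_mult)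

lemma ofA_1 [simp]: "ofA 1 = 1"
  by (simp add: map_poly_1)

lemma ofA_pCons [simp]: "ofA (pCons c a) = pCons (\<iota> c) (ofA a)"
  by (simp add: map_poly_pCons)

lemma degree_ofA [simp]: "degree (ofA a) = degree a"
  by (simp add: degree_map_poly)

lemma ofA_eq_0_iff [simp]: "ofA a = 0 \<longleftrightarrow> a = 0"
  by (simp add: map_poly_eq_0_iff)

definition sc :: "'k \<Rightarrow> ('k vec \<Rightarrow> 'k) \<Rightarrow> 'k vec \<Rightarrow> 'k" where "sc c \<phi> = (\<lambda>x. c * \<phi> x)"
definition TT :: "('k vec \<Rightarrow> 'k) \<Rightarrow> 'k vec \<Rightarrow> 'k"
  where "TT \<phi> = (\<lambda>x. if x \<in> F then \<phi> (\<Phi> [:0, 1:] x) else 0)"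
definition fr :: "('k vec \<Rightarrow> 'k) \<Rightarrow> 'k vec \<Rightarrow> 'k" where "fr \<phi> = (\<lambda>x. \<phi> x ^ q)"
text \<open>The value 0 outside \<open>F\<close> makes equality of functions the same as congruence
  modulo \<open>M(F)\<close>; thus the image of \<open>Lam q n\<close> is a copy of
  \<open>K{F}\<close>.\<close>

definition feval :: "'k poly vec \<Rightarrow> 'k vec \<Rightarrow> 'k"
  where "feval f = (\<lambda>x. if x \<in> F then lam_eval f x else 0)"
definition XX :: "nat \<Rightarrow> 'k vec \<Rightarrow> 'k" where "XX i = (\<lambda>x. if x \<in> F then x $ i else 0)"
definition R :: "('k vec \<Rightarrow> 'k) set" where "R = feval ` Lam q n"

sublocale frobenius_space sc p e q
  by unfold_locales
    (use prime_p char_p e_pos q_def in \<open>auto simp: sc_def fun_eq_iff algebra_simps\<close>)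

lemma sc_apply [simp]: "sc c \<phi> x = c * \<phi> x" by (simp add: sc_def)

lemma finite_f: "finite (UNIV :: 'f set)"
  using card_f q_ge_2 by (intro card_ge_0_finite) simp

lemma \<iota>_power_q [simp]: "\<iota> c ^ q = \<iota> c"
  using finite_field_power_card[OF finite_f, of c] card_f by (metis \<iota>.hom_power)

lemma frob_power_add: "((x :: 'k) + y) ^ (q ^ k) = x ^ (q ^ k) + y ^ (q ^ k)"
  by (induction k) (auto simp: power_mult mult.commute[of q] frob_add)

text \<open>The range of \<open>k\<close> is generous: \<open>k < q ^ k\<close> ensures that no
  exponent is missed, and the surplus coefficients vanish.\<close>

lemma Ktau_poly:
  assumes "P \<in> Ktau q"
  shows "poly P x = (\<Sum>k\<le>degree P. coeff P (q ^ k) * x ^ (q ^ k))"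
proof -
  let ?d = "degree P"
  have inj: "inj_on (\<lambda>k. q ^ k) {..?d}" using q_ge_2 by (auto simp: inj_on_def)
  have "poly P x = (\<Sum>j\<le>?d. coeff P j * x ^ j)" by (rule poly_altdef)
  also have "\<dots> = (\<Sum>j\<in>{..?d} \<union> (\<lambda>k. q ^ k) ` {..?d}. coeff P j * x ^ j)"
    by (rule sum.mono_neutral_left) (auto simp: coeff_eq_0)
  also have "\<dots> = (\<Sum>j\<in>(\<lambda>k. q ^ k) ` {..?d}. coeff P j * x ^ j)"
  proof (rule sum.mono_neutral_right)
    show "\<forall>j\<in>{..?d} \<union> (\<lambda>k. q ^ k) ` {..?d} - (\<lambda>k. q ^ k) ` {..?d}. coeff P j * x ^ j = 0"
    proof
      fix j assume j: "j \<in> {..?d} \<union> (\<lambda>k. q ^ k) ` {..?d} - (\<lambda>k. q ^ k) ` {..?d}"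
      have "coeff P j = 0"
      proof (rule ccontr)
        assume "coeff P j \<noteq> 0"
        then obtain i where i: "j = q ^ i" using assms by (auto simp: Ktau_def)
        have "i < q ^ i" using q_ge_2 by (intro power_gt_expt) auto
        then show False using i j by auto
      qed
      then show "coeff P j * x ^ j = 0" by simp
    qed
  qed auto
  also have "\<dots> = (\<Sum>k\<le>?d. coeff P (q ^ k) * x ^ (q ^ k))" by (simp add: sum.reindex[OF inj])
  finally show ?thesis .
qed

lemma Ktau_additive:
  fixes P :: "'k poly"
  assumes "P \<in> Ktau q" shows "poly P (x + y) = poly P x + poly P y"
  by (simp add: Ktau_poly[OF assms] frob_power_add algebra_simps sum.distrib)

lemma \<iota>_power_qk: "\<iota> c ^ (q ^ k) = \<iota> c"
  by (induction k) (auto simp: power_mult)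

lemma Ktau_semilinear:
  fixes P :: "'k poly"
  assumes "P \<in> Ktau q" shows "poly P (\<iota> c * x) = \<iota> c * poly P x"
  by (simp add: Ktau_poly[OF assms] power_mult_distrib \<iota>_power_qk sum_distrib_left mult.left_commute)

lemma F_carrier: "F \<subseteq> carrier_vec n" using variety by (auto simp: q_variety_def)

lemma LamD: "f \<in> Lam q n \<Longrightarrow> dim_vec f = n" "f \<in> Lam q n \<Longrightarrow> i < n \<Longrightarrow> f $ i \<in> Ktau q"
  by (auto simp: Lam_def)

lemma Lam_add: "f \<in> Lam q n \<Longrightarrow> g \<in> Lam q n \<Longrightarrow> f + g \<in> Lam q n" for f g :: "'k poly vec"
  by (auto simp: Lam_def Ktau_def) (metis add.right_neutral)

lemma Lam_diff: "f \<in> Lam q n \<Longrightarrow> g \<in> Lam q n \<Longrightarrow> f - g \<in> Lam q n" for f g :: "'k poly vec"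
  by (auto simp: Lam_def Ktau_def) (metis diff_0_right)

lemma Lam_smult: "f \<in> Lam q n \<Longrightarrow> [:c:] \<cdot>\<^sub>v f \<in> Lam q n" for f :: "'k poly vec"
  by (auto simp: Lam_def Ktau_def)

lemma lam_eval_add:
  "(f :: 'k poly vec) \<in> Lam q n \<Longrightarrow> x \<in> carrier_vec n \<Longrightarrow> y \<in> carrier_vec n \<Longrightarrow>
    lam_eval f (x + y) = lam_eval f x + lam_eval f y"
  by (simp add: lam_eval_def LamD Ktau_additive sum.distrib)

lemma lam_eval_scale:
  "f \<in> Lam q n \<Longrightarrow> x \<in> carrier_vec n \<Longrightarrow> lam_eval f (\<iota> c \<cdot>\<^sub>v x) = \<iota> c * lam_eval f x"
  by (simp add: lam_eval_def LamD Ktau_semilinear sum_distrib_left)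

lemma lam_eval_0: "(f :: 'k poly vec) \<in> Lam q n \<Longrightarrow> lam_eval f (0\<^sub>v n) = 0"
  using q_ge_2 by (simp add: lam_eval_def LamD Ktau_poly[OF LamD(2)] power_0_left)

lemma F_0: "0\<^sub>v n \<in> F" using variety lam_eval_0 by (auto simp: q_variety_def)

lemma F_add: "x \<in> F \<Longrightarrow> y \<in> F \<Longrightarrow> x + y \<in> F"
  using variety by (auto simp: q_variety_def lam_eval_add subset_iff)

lemma F_scale: "x \<in> F \<Longrightarrow> \<iota> c \<cdot>\<^sub>v x \<in> F"
  using variety by (auto simp: q_variety_def lam_eval_scale subset_iff)

lemma \<Phi>_hom: "\<Phi> \<in> Ring.ring_hom class_ring (End_ring q n F)" "\<Phi> [:c:] = (\<lambda>x\<in>F. \<iota> c \<cdot>\<^sub>v x)"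
  using module_struct by (auto simp: A_module_structure_def A_algebra_hom_to_End_def)

lemma \<Phi>_F: "x \<in> F \<Longrightarrow> \<Phi> a x \<in> F"
  and \<Phi>_rep: "\<exists>fs. represents q n n F fs (\<Phi> a)"
  using ring_hom_closed[OF \<Phi>_hom(1), of a] by (auto simp: End_ring_def q_morphisms_def)

lemma \<Phi>_plus: "x \<in> F \<Longrightarrow> \<Phi> (a + b) x = \<Phi> a x + \<Phi> b x"
  using ring_hom_add[OF \<Phi>_hom(1), of a b] by (simp add: End_ring_def)

lemma \<Phi>_mult: "x \<in> F \<Longrightarrow> \<Phi> (a * b) x = \<Phi> a (\<Phi> b x)"
  using ring_hom_mult[OF \<Phi>_hom(1), of a b] by (simp add: End_ring_def compose_def)

lemma \<Phi>_1: "x \<in> F \<Longrightarrow> \<Phi> 1 x = x"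
  using ring_hom_one[OF \<Phi>_hom(1)] by (simp add: End_ring_def)

lemma \<Phi>_add: "x \<in> F \<Longrightarrow> y \<in> F \<Longrightarrow> \<Phi> a (x + y) = \<Phi> a x + \<Phi> a y"
proof -
  assume xy: "x \<in> F" "y \<in> F"
  obtain fs where "represents q n n F fs (\<Phi> a)" using \<Phi>_rep by blast
  then show ?thesis using xy F_add[OF xy] F_carrier
    by (auto simp: represents_def lam_eval_add subset_iff intro!: eq_vecI)
qed

lemma fr_pow: "(fr ^^ k) \<phi> x = \<phi> x ^ (q ^ k)"
  by (induction k) (auto simp: fr_def power_mult[symmetric] mult.commute)

lemma feval_expand:
  assumes "f \<in> Lam q n"
  shows "feval f = (\<Sum>i<n. \<Sum>k\<le>degree (f $ i). sc (coeff (f $ i) (q ^ k)) ((fr ^^ k) (XX i)))"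
  using q_ge_2
  by (auto simp: feval_def fun_eq_iff lam_eval_def LamD[OF assms] Ktau_poly[OF LamD(2)[OF assms]]
      sum_fun_apply fr_pow XX_def)

lemma R_eq_span: "R = span {(fr ^^ k) (XX i) | k i. i < n}"
proof
  show "R \<subseteq> span {(fr ^^ k) (XX i) | k i. i < n}"
  proof
    fix \<phi> assume "\<phi> \<in> R"
    then obtain f where f: "f \<in> Lam q n" "\<phi> = feval f" by (auto simp: R_def)
    have "\<phi> = (\<Sum>i<n. \<Sum>k\<le>degree (f $ i). sc (coeff (f $ i) (q ^ k)) ((fr ^^ k) (XX i)))"
      unfolding f(2) by (rule feval_expand[OF f(1)])
    also have "\<dots> \<in> span {(fr ^^ k) (XX i) | k i. i < n}"
      by (intro span_sum span_scale span_base) auto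
    finally show "\<phi> \<in> span {(fr ^^ k) (XX i) | k i. i < n}" .
  qed
  show "span {(fr ^^ k) (XX i) | k i. i < n} \<subseteq> R"
  proof (rule span_minimal)
    show "subspace R"
    proof (rule subspaceI)
      have "0\<^sub>v n \<in> Lam q n" by (auto simp: Lam_def Ktau_def)
      moreover have "feval (0\<^sub>v n) = 0" by (auto simp: feval_def lam_eval_def fun_eq_iff)
      ultimately show "0 \<in> R" unfolding R_def by (metis imageI)
    next
      fix x y assume "x \<in> R" "y \<in> R"
      then obtain f g where fg: "f \<in> Lam q n" "x = feval f" "g \<in> Lam q n" "y = feval g"
        by (auto simp: R_def)
      have "f + g \<in> Lam q n" using fg by (intro Lam_add)
      moreover have "feval (f + g) = x + y"
        using fg by (auto simp: feval_def lam_eval_def fun_eq_iff LamD sum.distrib)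
      ultimately show "x + y \<in> R" unfolding R_def by (metis imageI)
    next
      fix c x assume "x \<in> R"
      then obtain f where f: "f \<in> Lam q n" "x = feval f" by (auto simp: R_def)
      have "[:c:] \<cdot>\<^sub>v f \<in> Lam q n" using f by (intro Lam_smult)
      moreover have "feval ([:c:] \<cdot>\<^sub>v f) = sc c x"
        using f by (auto simp: feval_def lam_eval_def fun_eq_iff LamD sum_distrib_left)
      ultimately show "sc c x \<in> R" unfolding R_def by (metis imageI)
    qed
    show "{(fr ^^ k) (XX i) | k i. i < n} \<subseteq> R"
    proof clarify
      fix k i assume i: "i < n"
      let ?f = "vec n (\<lambda>j. if j = i then monom 1 (q ^ k) else 0)"
      have "?f \<in> Lam q n" by (auto simp: Lam_def Ktau_def)
      moreover have "feval ?f = (fr ^^ k) (XX i)"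
        using i q_ge_2 by (auto simp: feval_def lam_eval_def fun_eq_iff fr_pow XX_def poly_monom
            if_distrib[of "\<lambda>P. poly P _"] sum.delta cong: if_cong)
      ultimately show "(fr ^^ k) (XX i) \<in> R" unfolding R_def by (metis imageI)
    qed
  qed
qed

lemma fr_add: "fr (\<phi> + \<psi>) = fr \<phi> + fr \<psi>" by (auto simp: fr_def frob_add)

lemma fr_scale: "fr (sc c \<phi>) = sc (c ^ q) (fr \<phi>)" by (auto simp: fr_def power_mult_distrib)

lemma TT_fr: "TT (fr \<phi>) = fr (TT \<phi>)" using q_ge_2 by (auto simp: TT_def fr_def)

lemma compose_XX:
  assumes "represents q n n F fs (\<Phi> a)" "i < n"
  shows "(\<lambda>x. if x \<in> F then XX i (\<Phi> a x) else 0) = feval (fs i)"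
proof
  fix x
  show "(if x \<in> F then XX i (\<Phi> a x) else 0) = feval (fs i) x"
    using assms \<Phi>_F[of x a] by (simp add: feval_def XX_def represents_def)
qed

lemma fr_R:
  assumes "\<phi> \<in> R" shows "fr \<phi> \<in> R"
proof -
  let ?G = "{(fr ^^ k) (XX i) | k i. i < n}"
  have "fr \<psi> \<in> span ?G" if G: "\<psi> \<in> ?G" for \<psi>
  proof -
    obtain k i where x: "\<psi> = (fr ^^ k) (XX i)" "i < n" using G by blast
    then have "fr \<psi> = (fr ^^ Suc k) (XX i)" by simp
    then show ?thesis using x(2) by (intro span_base) blast
  qed
  then show ?thesis
    using semilinear_span[OF fr_add fr_scale] assms unfolding R_eq_span by blast
qed

lemma TT_R:
  assumes "\<phi> \<in> R" shows "TT \<phi> \<in> R"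
proof -
  let ?G = "{(fr ^^ k) (XX i) | k i. i < n}"
  have add: "TT (\<phi> + \<psi>) = TT \<phi> + TT \<psi>" and scale: "TT (sc c \<phi>) = sc c (TT \<phi>)" for c \<phi> \<psi>
    by (auto simp: TT_def)
  have "TT \<psi> \<in> span ?G" if G: "\<psi> \<in> ?G" for \<psi>
  proof -
    obtain k i where x: "\<psi> = (fr ^^ k) (XX i)" "i < n" using G by blast
    obtain fs where fs: "represents q n n F fs (\<Phi> [:0, 1:])" using \<Phi>_rep by blast
    have "TT (XX i) = feval (fs i)" using compose_XX[OF fs x(2)] by (simp add: TT_def)
    then have "TT (XX i) \<in> R" using fs x(2) by (auto simp: R_def represents_def)
    then have "TT ((fr ^^ k) (XX i)) \<in> R" by (induction k) (auto simp: TT_fr fr_R)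
    then show ?thesis using x by (simp add: R_eq_span)
  qed
  then show ?thesis
    using semilinear_span[OF add scale] assms unfolding R_eq_span by blast
qed

sublocale frobenius_module sc p e q TT fr R XX n
proof unfold_locales
  show "TT (\<phi> + \<psi>) = TT \<phi> + TT \<psi>" for \<phi> \<psi> by (auto simp: TT_def)
  show "TT (sc c \<phi>) = sc c (TT \<phi>)" for c \<phi> by (auto simp: TT_def)
  show "XX i \<in> R" if "i < n" for i
    unfolding R_eq_span using that by (intro span_base CollectI exI[of _ 0] exI[of _ i]) simp
  show "subspace R" "R \<subseteq> span {(fr ^^ k) (XX i) | k i. i < n}"
    by (simp_all add: R_eq_span)
qed (auto simp: fr_add fr_scale TT_fr fr_R TT_R)

text \<open>Inside \<open>span\<close> and \<open>act\<close> the parameter \<open>sc\<close> occurs eta-expanded, where the simplifier would unfold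
  it.\<close>

declare sc_apply [simp del]

section \<open>Torsion points\<close>

lemma F_dim: "x \<in> F \<Longrightarrow> dim_vec x = n"
  using F_carrier by auto

lemma R_additive: "\<phi> \<in> R \<Longrightarrow> x \<in> F \<Longrightarrow> y \<in> F \<Longrightarrow> \<phi> (x + y) = \<phi> x + \<phi> y"
  using F_carrier by (auto simp: R_def feval_def F_add lam_eval_add subset_iff)

lemma R_homogeneous: "\<phi> \<in> R \<Longrightarrow> x \<in> F \<Longrightarrow> \<phi> (\<iota> c \<cdot>\<^sub>v x) = \<iota> c * \<phi> x"
  using F_carrier by (auto simp: R_def feval_def F_scale lam_eval_scale subset_iff)

lemma R_zero: "\<phi> \<in> R \<Longrightarrow> \<phi> (0\<^sub>v n) = 0"
  by (auto simp: R_def feval_def lam_eval_0)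

lemma R_outside: "\<phi> \<in> R \<Longrightarrow> x \<notin> F \<Longrightarrow> \<phi> x = 0"
  by (auto simp: R_def feval_def)

lemma \<Phi>_0: "x \<in> F \<Longrightarrow> \<Phi> 0 x = 0\<^sub>v n"
  using \<Phi>_hom(2)[of 0] F_carrier by (auto simp: subset_iff intro!: eq_vecI)

text \<open>Polynomials over \<open>\<F>\<^sub>q\<close> act by composition with the corresponding
  endomorphism, since functions in \<open>R\<close> are additive and
  \<open>\<F>\<^sub>q\<close>-homogeneous on \<open>F\<close>. A general element of
  \<open>K[T]\<close> acts only through a \<open>K\<close>-linear combination of such
  compositions.\<close>

lemma act_ofA:
  assumes "\<phi> \<in> R"
  shows "act (ofA a) \<phi> = (\<lambda>x. if x \<in> F then \<phi> (\<Phi> a x) else 0)"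
proof (induction a)
  case 0
  then show ?case using R_zero[OF assms] by (auto simp: \<Phi>_0 fun_eq_iff)
next
  case (pCons c a)
  show ?case
  proof
    fix x
    have "\<Phi> (pCons c a) x = \<iota> c \<cdot>\<^sub>v x + \<Phi> a (\<Phi> [:0, 1:] x)" if x: "x \<in> F"
    proof -
      have "pCons c a = [:c:] + a * [:0, 1:]" by simp
      then have "\<Phi> (pCons c a) x = \<Phi> [:c:] x + \<Phi> (a * [:0, 1:]) x" using \<Phi>_plus[OF x] by metis
      moreover have "\<Phi> [:c:] x = \<iota> c \<cdot>\<^sub>v x" using \<Phi>_hom(2) x by simp
      ultimately show ?thesis by (simp only: \<Phi>_mult[OF x])
    qed
    then show "act (ofA (pCons c a)) \<phi> x = (if x \<in> F then \<phi> (\<Phi> (pCons c a) x) else 0)"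
      using R_outside[OF assms] assms
      unfolding ofA_pCons act_pCons pCons.IH
      by (simp add: sc_apply TT_def \<Phi>_F F_scale R_additive R_homogeneous)
  qed
qed

lemma twist_ofA: "twist (ofA a) = ofA a"
  using q_ge_2 by (intro poly_eqI) (simp add: coeff_map_poly)

text \<open>All terms with exponent \<open>q ^ k\<close>, \<open>k > 0\<close>, are multiples of
  \<open>q\<close>-th powers of elements of \<open>R\<close>. So modulo the span of the image of
  \<open>fr\<close> only the differential is left.\<close>

lemma linear_part:
  assumes f: "f \<in> Lam q n"
  shows "feval f - (\<Sum>i<n. sc (coeff (f $ i) 1) (XX i)) \<in> span (fr ` R)"
proof -
  have "feval f - (\<Sum>i<n. sc (coeff (f $ i) 1) (XX i)) =
      (\<Sum>i<n. \<Sum>k<degree (f $ i). sc (coeff (f $ i) (q ^ Suc k)) ((fr ^^ Suc k) (XX i)))"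
  proof
    fix x
    have "poly (f $ i) (x $ i) = coeff (f $ i) 1 * x $ i +
        (\<Sum>k<degree (f $ i). coeff (f $ i) (q ^ Suc k) * (x $ i) ^ (q ^ Suc k))" if "i < n" for i
      unfolding Ktau_poly[OF LamD(2)[OF f that]] lessThan_Suc_atMost[symmetric]
      by (subst sum.lessThan_Suc_shift) simp
    then show "(feval f - (\<Sum>i<n. sc (coeff (f $ i) 1) (XX i))) x =
      (\<Sum>i<n. \<Sum>k<degree (f $ i). sc (coeff (f $ i) (q ^ Suc k)) ((fr ^^ Suc k) (XX i))) x"
      using q_ge_2 unfolding fr_pow
      by (simp add: sc_apply sum_fun_apply fr_pow feval_def lam_eval_def LamD(1)[OF f] XX_def sum.distrib
          del: funpow.simps power_Suc)
  qed
  also have "\<dots> \<in> span (fr ` R)"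
  proof (intro span_sum span_scale span_base)
    fix i k assume "i \<in> {..<n}"
    then have "(fr ^^ k) (XX i) \<in> R" using X_R fr_R by (induction k) auto
    then show "(fr ^^ Suc k) (XX i) \<in> fr ` R" by simp
  qed
  finally show ?thesis .
qed

text \<open>A linear form that vanishes on the tangent space is the differential of an element of
  \<open>M(F)\<close>, since a subspace of \<open>K\<^sup>n\<close> is the annihilator of its annihilator.\<close>

lemma tangent_annihilator:
  assumes l: "\<And>x. x \<in> tangent_space q n F \<Longrightarrow> (\<Sum>i<n. l i * x $ i) = 0"
  obtains f where "f \<in> vanishing q n F" "\<And>i. i < n \<Longrightarrow> coeff (f $ i) 1 = l i"
proof -
  define s :: "'k \<Rightarrow> (nat \<Rightarrow> 'k) \<Rightarrow> nat \<Rightarrow> 'k" where "s c v = (\<lambda>i. c * v i)" for c v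
  interpret V: vector_space s by unfold_locales (auto simp: s_def fun_eq_iff algebra_simps)
  interpret K: vector_space "(*) :: 'k \<Rightarrow> 'k \<Rightarrow> 'k" by unfold_locales (auto simp: algebra_simps)
  interpret P: vector_space_pair s "(*) :: 'k \<Rightarrow> 'k \<Rightarrow> 'k" ..
  define d where "d f = (\<lambda>i. if i < n then coeff (f $ i) 1 else 0)" for f :: "'k poly vec"
  define D where "D = d ` vanishing q n F"
  \<comment> \<open>Linear forms are encoded as functions on all naturals; cutting off at
    \<open>n\<close> makes them comparable with the elements of \<open>D\<close>.\<close>
  define l' where "l' = (\<lambda>i. if i < n then l i else 0)"
  have vD: "f \<in> Lam q n \<and> (\<forall>x\<in>F. lam_eval f x = 0)" if "f \<in> vanishing q n F" for f
    using that by (simp add: vanishing_def)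
  have vI: "f \<in> vanishing q n F" if "f \<in> Lam q n" "\<forall>x\<in>F. lam_eval f x = 0" for f
    using that by (simp add: vanishing_def)
  have "V.subspace D"
  proof (rule V.subspaceI)
    have "0\<^sub>v n \<in> vanishing q n F" by (auto simp: vanishing_def Lam_def Ktau_def lam_eval_def)
    moreover have "d (0\<^sub>v n) = 0" by (auto simp: d_def fun_eq_iff)
    ultimately show "0 \<in> D" unfolding D_def by (metis imageI)
  next
    fix x y assume "x \<in> D" "y \<in> D"
    then obtain f g where fg: "f \<in> vanishing q n F" "x = d f" "g \<in> vanishing q n F" "y = d g"
      by (auto simp: D_def)
    have dims: "dim_vec f = n" "dim_vec g = n" using fg vD LamD by blast+
    have "f + g \<in> Lam q n" using vD[OF fg(1)] vD[OF fg(3)] by (blast intro: Lam_add)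
    moreover have "lam_eval (f + g) z = lam_eval f z + lam_eval g z" for z
      using dims by (simp add: lam_eval_def sum.distrib)
    ultimately have "f + g \<in> vanishing q n F" using vD[OF fg(1)] vD[OF fg(3)] by (intro vI) auto
    moreover have "d (f + g) = x + y" using fg dims by (auto simp: d_def fun_eq_iff)
    ultimately show "x + y \<in> D" unfolding D_def by (metis imageI)
  next
    fix c x assume "x \<in> D"
    then obtain f where f: "f \<in> vanishing q n F" "x = d f" by (auto simp: D_def)
    have dims: "dim_vec f = n" using f vD LamD by blast
    have "[:c:] \<cdot>\<^sub>v f \<in> Lam q n" using vD[OF f(1)] by (blast intro: Lam_smult)
    moreover have "lam_eval ([:c:] \<cdot>\<^sub>v f) z = c * lam_eval f z" for z
      using dims by (simp add: lam_eval_def sum_distrib_left)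
    ultimately have "[:c:] \<cdot>\<^sub>v f \<in> vanishing q n F" using vD[OF f(1)] by (intro vI) auto
    moreover have "d ([:c:] \<cdot>\<^sub>v f) = s c x" using f dims by (auto simp: d_def s_def fun_eq_iff)
    ultimately show "s c x \<in> D" unfolding D_def by (metis imageI)
  qed
  have "l' \<in> D"
  proof (rule ccontr)
    assume n: "l' \<notin> D"
    obtain B where B: "B \<subseteq> D" "V.independent B" "D \<subseteq> V.span B"
      using V.maximal_independent_subset[of D] by blast
    have "V.span B \<subseteq> D" using B(1) \<open>V.subspace D\<close> by (rule V.span_minimal)
    then have lB: "l' \<notin> V.span B" using n by blast
    have "V.independent (insert l' B)" using B(2) lB by (intro V.independent_insertI)
    \<comment> \<open>If \<open>l'\<close> were not in \<open>D\<close>, a functional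
      \<open>g\<close> would vanish on \<open>D\<close> and take the value 1 at \<open>l'\<close>.
      Its values on the unit vectors form a tangent vector at which \<open>l\<close> is not
      0.\<close>
    then obtain g where g: "Vector_Spaces.linear s (*) g"
      and gB: "\<forall>x\<in>insert l' B. g x = (if x = l' then 1 else 0)"
      using P.linear_independent_extend[of "insert l' B" "\<lambda>x. if x = l' then 1 else 0"] by blast
    interpret g: Vector_Spaces.linear s "(*)" g by (rule g)
    have gD: "g v = 0" if "v \<in> D" for v
    proof (rule g.eq_0_on_span[of B])
      show "g b = 0" if "b \<in> B" for b
        using gB that lB V.span_base[of b B] by (metis insertCI)
      show "v \<in> V.span B" using B(3) \<open>v \<in> D\<close> by blast
    qed
    define u where "u i = (\<lambda>j::nat. if j = i then 1 else 0 :: 'k)" for i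
    define x where "x = vec n (\<lambda>i. g (u i))"
    have gsum: "g v = (\<Sum>i<n. v i * x $ i)" if "\<And>i. i \<ge> n \<Longrightarrow> v i = 0" for v
    proof -
      have "v = (\<Sum>i<n. s (v i) (u i))"
      proof
        fix j
        show "v j = (\<Sum>i<n. s (v i) (u i)) j"
          using that[of j] by (cases "j < n") (auto simp: sum_fun_apply s_def u_def if_distrib cong: if_cong)
      qed
      then have "g v = g (\<Sum>i<n. s (v i) (u i))" by simp
      also have "\<dots> = (\<Sum>i<n. v i * g (u i))" by (simp add: g.sum g.scale)
      finally show ?thesis by (simp add: x_def)
    qed
    have "x \<in> tangent_space q n F"
      unfolding tangent_space_def
    proof (intro CollectI conjI ballI)
      show "x \<in> carrier_vec n" by (simp add: x_def)
      fix f assume f: "f \<in> vanishing q n F"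
      then have "dim_vec f = n" using vD LamD by blast
      then have "lam_linear f x = (\<Sum>i<n. d f i * x $ i)" by (simp add: lam_linear_def d_def)
      also have "\<dots> = g (d f)" by (rule gsum[symmetric]) (simp add: d_def)
      also have "\<dots> = 0" using f by (intro gD) (simp add: D_def)
      finally show "lam_linear f x = 0" .
    qed
    then have "(\<Sum>i<n. l' i * x $ i) = 0" using l[of x] by (simp add: l'_def)
    moreover have "g l' = (\<Sum>i<n. l' i * x $ i)" by (rule gsum) (simp add: l'_def)
    ultimately show False using gB by simp
  qed
  then obtain f where f: "f \<in> vanishing q n F" "l' = d f" by (auto simp: D_def)
  have "coeff (f $ i) 1 = l i" if "i < n" for i
    using fun_cong[OF f(2), of i] that by (simp add: d_def l'_def)
  then show thesis using that f(1) by blast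
qed

text \<open>Composition with \<open>\<Phi> a\<close> turns \<open>X i\<close> into
  \<open>fs i\<close>, whose differential agrees with \<open>\<delta> a\<close> times the
  \<open>i\<close>-th coordinate on the tangent space. Subtracting an element of \<open>M(F)\<close>
  makes the linear parts agree on all of \<open>K^n\<close>; hence \<open>\<delta> a\<close> times
  \<open>X i\<close> is congruent to \<open>a X i\<close> modulo the span of \<open>q\<close>-th
  powers.\<close>

lemma etale:
  assumes a: "\<delta> a \<noteq> 0"
  shows "R \<subseteq> span (fr ` R \<union> act (ofA a) ` R)"
proof -
  let ?S = "span (fr ` R \<union> act (ofA a) ` R)"
  have frS: "\<phi> \<in> ?S" if "\<phi> \<in> span (fr ` R)" for \<phi> using that span_mono[of "fr ` R" "fr ` R \<union> act (ofA a) ` R"] by blast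
  obtain fs where fs: "represents q n n F fs (\<Phi> a)" using \<Phi>_rep by blast
  have L: "fs i \<in> Lam q n" if "i < n" for i using fs that by (simp add: represents_def)
  have X_S: "XX i \<in> ?S" if i: "i < n" for i
  proof -
    \<comment> \<open>The discrepancy of the linear parts: zero on the tangent space, and therefore
      the differential of some \<open>f\<close> that vanishes on \<open>F\<close>.\<close>
    define l where "l j = coeff (fs i $ j) 1 - (if j = i then \<delta> a else 0)" for j
    have "(\<Sum>j<n. l j * x $ j) = 0" if x: "x \<in> tangent_space q n F" for x
    proof -
      have xn: "dim_vec x = n" using x by (auto simp: tangent_space_def)
      have "morphism_differential n fs x = \<delta> a \<cdot>\<^sub>v x"
        using module_struct fs x by (auto simp: A_module_structure_def)
      then have "morphism_differential n fs x $ i = (\<delta> a \<cdot>\<^sub>v x) $ i" by simp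
      then have "lam_linear (fs i) x = \<delta> a * x $ i" using i xn by (simp add: morphism_differential_def)
      moreover have "(\<Sum>j<n. (if j = i then \<delta> a else 0) * x $ j) = \<delta> a * x $ i"
        using i by (simp add: if_distrib[of "\<lambda>c. c * _"] cong: if_cong)
      ultimately show ?thesis
        using LamD(1)[OF L[OF i]] by (simp add: l_def lam_linear_def left_diff_distrib sum_subtractf)
    qed
    then obtain f where f: "f \<in> vanishing q n F" "\<And>j. j < n \<Longrightarrow> coeff (f $ j) 1 = l j"
      using tangent_annihilator[of l] by blast
    have fL: "f \<in> Lam q n" and f0: "feval f = 0"
      using f(1) by (auto simp: vanishing_def feval_def fun_eq_iff)
    have "feval (fs i) - (\<Sum>j<n. sc (coeff (fs i $ j) 1) (XX j))
        - (feval f - (\<Sum>j<n. sc (coeff (f $ j) 1) (XX j))) \<in> ?S"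
      using linear_part[OF L[OF i]] linear_part[OF fL] frS span_diff by blast
    moreover have "(\<Sum>j<n. sc (coeff (fs i $ j) 1) (XX j)) - (\<Sum>j<n. sc (coeff (f $ j) 1) (XX j)) = sc (\<delta> a) (XX i)"
    proof -
      have "(\<Sum>j<n. sc (coeff (fs i $ j) 1) (XX j)) - (\<Sum>j<n. sc (coeff (f $ j) 1) (XX j))
          = (\<Sum>j<n. if j = i then sc (\<delta> a) (XX i) else 0)"
        unfolding sum_subtractf[symmetric]
        by (intro sum.cong refl)
            (auto simp: f(2)[unfolded One_nat_def] l_def[unfolded One_nat_def] scale_left_diff_distrib)
      then show ?thesis using i by simp
    qed
    ultimately have 1: "feval (fs i) - sc (\<delta> a) (XX i) \<in> ?S" using f0 by (simp add: algebra_simps)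
    have "feval (fs i) = act (ofA a) (XX i)"
      using compose_XX[OF fs i] act_ofA[OF X_R[OF i]] by simp
    then have "feval (fs i) \<in> ?S" using X_R[OF i] by (auto intro: span_base)
    then have "feval (fs i) - (feval (fs i) - sc (\<delta> a) (XX i)) \<in> ?S" using 1 by (rule span_diff)
    then have "sc (\<delta> a) (XX i) \<in> ?S" by simp
    then have "sc (inverse (\<delta> a)) (sc (\<delta> a) (XX i)) \<in> ?S" by (rule span_scale)
    then show ?thesis using a by simp
  qed
  have "(fr ^^ k) (XX i) \<in> ?S" if i: "i < n" for k i
  proof (cases k)
    case 0 then show ?thesis using X_S[OF i] by simp
  next
    case (Suc k')
    have "(fr ^^ k') (XX i) \<in> R" by (induction k') (use X_R[OF i] fr_R in auto)
    then show ?thesis unfolding Suc by (intro span_base) simp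
  qed
  then have "span {(fr ^^ k) (XX i) | k i. i < n} \<subseteq> ?S" by (intro span_minimal) auto
  then show ?thesis by (simp add: R_eq_span)
qed

section \<open>Counting torsion points\<close>

lemma card_frobenius_fixed: "finite {y :: 'k. y ^ q = y}" "card {y :: 'k. y ^ q = y} = q"
proof -
  let ?P = "monom 1 q - [:0, 1:] :: 'k poly"
  have deg: "degree ?P = q"
    using q_ge_2 by (subst degree_diff_eq_left) (auto simp: degree_monom_eq)
  then have P0: "?P \<noteq> 0" using q_ge_2 by auto
  have eq: "{y :: 'k. y ^ q = y} = {y. poly ?P y = 0}" by (auto simp: poly_monom)
  show fin: "finite {y :: 'k. y ^ q = y}" unfolding eq by (rule poly_roots_finite[OF P0])
  have "card {y :: 'k. y ^ q = y} \<le> q"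
    using card_poly_roots_bound[OF P0] deg eq by simp
  moreover have "q \<le> card {y :: 'k. y ^ q = y}"
  proof -
    have "card (range \<iota>) = q" using card_f by (simp add: card_image \<iota>.inj_f)
    moreover have "range \<iota> \<subseteq> {y. y ^ q = y}" by auto
    ultimately show ?thesis using card_mono[OF fin] by metis
  qed
  ultimately show "card {y :: 'k. y ^ q = y} = q" by simp
qed

text \<open>With a basis \<open>B\<close> of \<open>K{F}/aK{F}\<close> consisting of \<open>\<tau>\<close>-fixed vectors, a point \<open>x\<close> of the torsion
  is the same as a \<open>K{\<tau>}\<close>-linear map \<open>K{F}/aK{F} \<rightarrow> K\<close> (evaluation at \<open>x\<close>), and such a map is given
  by its values on \<open>B\<close>, which are arbitrary solutions of \<open>y ^ q = y\<close>.\<close>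

lemma card_torsion:
  assumes basis: "poly_basis b r" and a: "a \<noteq> 0" "\<delta> a \<noteq> 0"
    and den: "\<And>x. x \<in> R \<Longrightarrow> \<exists>P Q. comaximal P (ofA a) \<and> act P x = (\<Sum>j<r. act (Q j) (b j))"
  shows "card {x \<in> F. \<Phi> a x = 0\<^sub>v n} = q ^ (r * degree a)"
proof -
  let ?J = "act (ofA a) ` R"
  have a0: "ofA a \<noteq> 0" using a(1) by simp
  obtain B where B: "finite B" "card B = r * degree (ofA a)" "B \<subseteq> R" "independent B"
    and Bfix: "\<And>b. b \<in> B \<Longrightarrow> fr b - b \<in> ?J"
    and decomp: "\<And>x. x \<in> R \<Longrightarrow> \<exists>w\<in>span B. x - w \<in> ?J"
    and inter: "\<And>w. w \<in> span B \<Longrightarrow> w \<in> ?J \<Longrightarrow> w = 0"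
    using fixed_basis_mod[OF basis twist_ofA a0 den etale[OF a(2)]] by blast
  define V where "V = {x \<in> F. \<Phi> a x = 0\<^sub>v n}"
  have J_V: "\<phi> x = 0" if J: "\<phi> \<in> ?J" and x: "x \<in> V" for \<phi> x
  proof -
    obtain \<psi> where "\<psi> \<in> R" "\<phi> = act (ofA a) \<psi>" using J by blast
    then show ?thesis using x act_ofA[of \<psi> a] R_zero[of \<psi>] by (simp add: V_def)
  qed
  have J_diff: "\<phi> - \<psi> \<in> ?J" "\<phi> + \<psi> \<in> ?J" if J: "\<phi> \<in> ?J" "\<psi> \<in> ?J" for \<phi> \<psi>
  proof -
    obtain \<phi>' \<psi>' where J': "\<phi>' \<in> R" "\<phi> = act (ofA a) \<phi>'" "\<psi>' \<in> R" "\<psi> = act (ofA a) \<psi>'" using J by blast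
    then have "\<phi> - \<psi> = act (ofA a) (\<phi>' - \<psi>')" "\<phi> + \<psi> = act (ofA a) (\<phi>' + \<psi>')"
      by (auto simp: act_diff act_add)
    then show "\<phi> - \<psi> \<in> ?J" "\<phi> + \<psi> \<in> ?J"
      using J' subspace_diff[OF R_subspace] subspace_add[OF R_subspace] by auto
  qed
  have J_scale: "sc c \<phi> \<in> ?J" if J: "\<phi> \<in> ?J" for c \<phi>
  proof -
    obtain \<phi>' where J': "\<phi>' \<in> R" "\<phi> = act (ofA a) \<phi>'" using J by blast
    then have "sc c \<phi> = act (ofA a) (sc c \<phi>')" by (simp add: act_scale)
    then show ?thesis using J' subspace_scale[OF R_subspace] by auto
  qed
  have J_0: "0 \<in> ?J" using subspace_0[OF R_subspace] act_zero[of "ofA a"] by (metis imageI)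
  have J_subspace: "subspace ?J" using J_0 J_diff(2) J_scale by (rule subspaceI)
  have J_fr: "fr \<phi> \<in> ?J" if J: "\<phi> \<in> ?J" for \<phi>
  proof -
    obtain \<phi>' where J': "\<phi>' \<in> R" "\<phi> = act (ofA a) \<phi>'" using J by blast
    then have "fr \<phi> = act (ofA a) (fr \<phi>')" by (simp add: \<tau>_act twist_ofA)
    then show ?thesis using J' fr_R by auto
  qed
  define coord where "coord \<phi> c \<longleftrightarrow> \<phi> - (\<Sum>b\<in>B. sc (c b) b) \<in> ?J" for \<phi> c
  have coord_exists: "\<exists>c. coord \<phi> c" if "\<phi> \<in> R" for \<phi>
  proof -
    obtain w where w: "w \<in> span B" "\<phi> - w \<in> ?J" using decomp \<open>\<phi> \<in> R\<close> by blast
    obtain c where "w = (\<Sum>b\<in>B. sc (c b) (id b))" using in_span_family[of B w id] w B(1) by auto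
    then show ?thesis using w unfolding coord_def by (intro exI[of _ c]) simp
  qed
  have coord_unique: "c b = c' b" if c: "coord \<phi> c" "coord \<phi> c'" and b: "b \<in> B" for \<phi> c c' b
  proof -
    have "(\<Sum>b\<in>B. sc (c' b - c b) b) = \<phi> - (\<Sum>b\<in>B. sc (c b) b) - (\<phi> - (\<Sum>b\<in>B. sc (c' b) b))"
      by (simp add: scale_left_diff_distrib sum_subtractf)
    also have "\<dots> \<in> ?J" using c unfolding coord_def by (rule J_diff)
    finally have "(\<Sum>b\<in>B. sc (c' b - c b) b) = 0"
      by (intro inter span_sum span_scale span_base)
    then have "c' b - c b = 0" 
      using independentD[OF B(4,1) order_refl _ b, of "\<lambda>b. c' b - c b"] by blast
    then show ?thesis by simp
  qed
  define ev where "ev x = (\<lambda>b\<in>B. b x)" for x :: "'k vec"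
  let ?Y = "B \<rightarrow>\<^sub>E {y :: 'k. y ^ q = y}"
  have "bij_betw ev V ?Y"
    unfolding bij_betw_def
  proof (intro conjI equalityI subsetI)
    show "inj_on ev V"
    proof (rule inj_onI)
      fix x y assume xy: "x \<in> V" "y \<in> V" "ev x = ev y"
      have eqB: "b x = b y" if "b \<in> B" for b using fun_cong[OF xy(3), of b] that by (simp add: ev_def)
      have eqR: "\<phi> x = \<phi> y" if R: "\<phi> \<in> R" for \<phi>
      proof -
        obtain c where c: "coord \<phi> c" using coord_exists[OF R] by blast
        have "\<phi> z = (\<Sum>b\<in>B. c b * b z)" if "z \<in> V" for z
          using J_V[OF c[unfolded coord_def] that] by (simp add: sum_fun_apply sc_apply)
        then have "\<phi> x = (\<Sum>b\<in>B. c b * b x)" "\<phi> y = (\<Sum>b\<in>B. c b * b y)" using xy by auto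
        moreover have "(\<Sum>b\<in>B. c b * b x) = (\<Sum>b\<in>B. c b * b y)"
          using eqB by (intro sum.cong) auto
        ultimately show ?thesis by simp
      qed
      show "x = y"
      proof (rule eq_vecI)
        show "dim_vec x = dim_vec y" using xy by (simp add: V_def F_dim)
        show "x $ i = y $ i" if "i < dim_vec y" for i
        proof -
          have "i < n" using that xy by (simp add: V_def F_dim)
          then show ?thesis using eqR[OF X_R] xy by (simp add: XX_def V_def)
        qed
      qed
    qed
  next
    fix y assume "y \<in> ev ` V"
    then obtain x where x: "x \<in> V" "y = ev x" by blast
    have "b x ^ q = b x" if "b \<in> B" for b
      using J_V[OF Bfix[OF that] x(1)] by (simp add: fr_def)
    then show "y \<in> ?Y" by (auto simp: x(2) ev_def)
  next
    fix y assume y: "y \<in> ?Y"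
    then have yq: "y b ^ q = y b" if "b \<in> B" for b using that by auto
    \<comment> \<open>The \<open>K\<close>-linear form on \<open>R\<close> that kills
      \<open>aR\<close> and takes the value \<open>y b\<close> at \<open>b\<close>. Coordinates with
      respect to \<open>B\<close> are unique only modulo \<open>aR\<close>, so the choice made here
      does not affect the value.\<close>
    define \<theta> where "\<theta> \<phi> = (\<Sum>b\<in>B. (SOME c. coord \<phi> c) b * y b)" for \<phi>
    have \<theta>_eq: "\<theta> \<phi> = (\<Sum>b\<in>B. c b * y b)" if c: "coord \<phi> c" for \<phi> c
      unfolding \<theta>_def using coord_unique[OF someI[of "coord \<phi>", OF c] c] by (intro sum.cong) auto
    have \<theta>_J: "\<theta> \<phi> = 0" if "\<phi> \<in> ?J" for \<phi>
    proof -
      have "coord \<phi> (\<lambda>_. 0)" using that by (simp add: coord_def)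
      from \<theta>_eq[OF this] show ?thesis by simp
    qed
    have \<theta>_add: "\<theta> (\<phi> + \<psi>) = \<theta> \<phi> + \<theta> \<psi>" if R: "\<phi> \<in> R" "\<psi> \<in> R" for \<phi> \<psi>
    proof -
      obtain c c' where c: "coord \<phi> c" "coord \<psi> c'" using coord_exists R by blast
      have "\<phi> + \<psi> - (\<Sum>b\<in>B. sc (c b + c' b) b)
          = (\<phi> - (\<Sum>b\<in>B. sc (c b) b)) + (\<psi> - (\<Sum>b\<in>B. sc (c' b) b))"
        by (simp add: scale_left_distrib sum.distrib)
      also have "\<dots> \<in> ?J" using c unfolding coord_def by (rule J_diff)
      finally have "coord (\<phi> + \<psi>) (\<lambda>b. c b + c' b)" by (simp only: coord_def)
      from \<theta>_eq[OF this] show ?thesis using \<theta>_eq[OF c(1)] \<theta>_eq[OF c(2)]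
        by (simp add: distrib_right sum.distrib)
    qed
    have \<theta>_scale: "\<theta> (sc k \<phi>) = k * \<theta> \<phi>" if R: "\<phi> \<in> R" for k \<phi>
    proof -
      obtain c where c: "coord \<phi> c" using coord_exists R by blast
      have "sc k \<phi> - (\<Sum>b\<in>B. sc (k * c b) b) = sc k (\<phi> - (\<Sum>b\<in>B. sc (c b) b))"
        by (simp add: scale_right_diff_distrib scale_sum_right)
      also have "\<dots> \<in> ?J" using c unfolding coord_def by (rule J_scale)
      finally have "coord (sc k \<phi>) (\<lambda>b. k * c b)" by (simp only: coord_def)
      from \<theta>_eq[OF this] show ?thesis using \<theta>_eq[OF c] by (simp add: sum_distrib_left mult.assoc)
    qed
    \<comment> \<open>As each \<open>b\<close> is fixed modulo \<open>aR\<close>, passing to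
      \<open>fr \<phi>\<close> raises the coordinates to the \<open>q\<close>-th power; together
      with \<open>y b ^ q = y b\<close> this makes \<theta> commute with the Frobenius.\<close>
    have \<theta>_fr: "\<theta> (fr \<phi>) = \<theta> \<phi> ^ q" if R: "\<phi> \<in> R" for \<phi>
    proof -
      obtain c where c: "coord \<phi> c" using coord_exists R by blast
      have "fr (\<phi> - (\<Sum>b\<in>B. sc (c b) b)) \<in> ?J" using c J_fr unfolding coord_def by blast
      moreover have "(\<Sum>b\<in>B. sc (c b ^ q) (fr b - b)) \<in> ?J" 
        by (rule subspace_sum[OF J_subspace], rule J_scale, rule Bfix)
      ultimately have "fr (\<phi> - (\<Sum>b\<in>B. sc (c b) b)) + (\<Sum>b\<in>B. sc (c b ^ q) (fr b - b)) \<in> ?J"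
        by (rule J_diff)
      also have "fr (\<phi> - (\<Sum>b\<in>B. sc (c b) b)) + (\<Sum>b\<in>B. sc (c b ^ q) (fr b - b))
          = fr \<phi> - (\<Sum>b\<in>B. sc (c b ^ q) b)"
        by (simp add: \<tau>_diff \<tau>_sum \<tau>_scale scale_right_diff_distrib sum_subtractf)
      finally have "coord (fr \<phi>) (\<lambda>b. c b ^ q)" by (simp only: coord_def)
      from \<theta>_eq[OF this] show ?thesis using \<theta>_eq[OF c] yq
        by (simp add: frob_sum power_mult_distrib)
    qed
    have frR: "(fr ^^ k) \<phi> \<in> R" if R: "\<phi> \<in> R" for k \<phi>
      by (induction k) (use R fr_R in auto)
    have \<theta>_frk: "\<theta> ((fr ^^ k) \<phi>) = \<theta> \<phi> ^ (q ^ k)" if R: "\<phi> \<in> R" for k \<phi>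
      by (induction k) (use R frR \<theta>_fr in \<open>auto simp: power_mult[symmetric] mult.commute\<close>)
    have \<theta>_sum: "\<theta> (sum f A) = (\<Sum>i\<in>A. \<theta> (f i))" if "\<And>i. i \<in> A \<Longrightarrow> f i \<in> R" for f and A :: "nat set"
      using that by (induction A rule: infinite_finite_induct)
        (auto simp: \<theta>_J[OF J_0] \<theta>_add subspace_sum[OF R_subspace])
    \<comment> \<open>The point at which \<theta> is evaluation. It satisfies the equations of
      \<open>F\<close> because they give the zero function in \<open>R\<close>, and it is a torsion
      point because \<theta> kills each \<open>a X i\<close>.\<close>
    define x where "x = vec n (\<lambda>i. \<theta> (XX i))"
    have xi: "x $ i = \<theta> (XX i)" if "i < n" for i using that by (simp add: x_def)
    have term_R: "sc c ((fr ^^ k) (XX i)) \<in> R" if "i < n" for c k i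
      using subspace_scale[OF R_subspace frR[OF X_R[OF that]]] .
    have \<theta>_feval: "\<theta> (feval f) = lam_eval f x" if f: "f \<in> Lam q n" for f
    proof -
      have "\<theta> (feval f) = \<theta> (\<Sum>i<n. \<Sum>k\<le>degree (f $ i). sc (coeff (f $ i) (q ^ k)) ((fr ^^ k) (XX i)))"
        by (simp only: feval_expand[OF f])
      also have "\<dots> = (\<Sum>i<n. \<theta> (\<Sum>k\<le>degree (f $ i). sc (coeff (f $ i) (q ^ k)) ((fr ^^ k) (XX i))))"
        using term_R by (intro \<theta>_sum subspace_sum[OF R_subspace]) simp
      also have "\<dots> = (\<Sum>i<n. \<Sum>k\<le>degree (f $ i). \<theta> (sc (coeff (f $ i) (q ^ k)) ((fr ^^ k) (XX i))))"
        using term_R by (intro sum.cong refl \<theta>_sum) simp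
      also have "\<dots> = (\<Sum>i<n. poly (f $ i) (x $ i))"
        using frR X_R by (intro sum.cong refl) (auto simp: Ktau_poly[OF LamD(2)[OF f]] \<theta>_scale \<theta>_frk xi intro!: sum.cong)
      finally show ?thesis using LamD(1)[OF f] by (simp add: lam_eval_def)
    qed
    obtain S where S: "S \<subseteq> Lam q n" "F = {x \<in> carrier_vec n. \<forall>f\<in>S. lam_eval f x = 0}"
      using variety by (auto simp: q_variety_def)
    have "lam_eval f x = 0" if f: "f \<in> S" for f
    proof -
      have "lam_eval f z = 0" if "z \<in> F" for z using S(2) f that by blast
      then have "feval f = 0" by (auto simp: feval_def fun_eq_iff)
      then have "\<theta> (feval f) = 0" using \<theta>_J[OF J_0] by simp
      then show ?thesis using \<theta>_feval f S(1) by auto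
    qed
    moreover have "x \<in> carrier_vec n" by (simp add: x_def)
    ultimately have xF: "x \<in> F" using S(2) by blast
    obtain fs where fs: "represents q n n F fs (\<Phi> a)" using \<Phi>_rep by blast
    have "\<Phi> a x = 0\<^sub>v n"
    proof (rule eq_vecI)
      show "dim_vec (\<Phi> a x) = dim_vec (0\<^sub>v n)" using F_dim[OF \<Phi>_F[OF xF]] by simp
      fix i assume "i < dim_vec (0\<^sub>v n :: 'k vec)"
      then have i: "i < n" by simp
      then have "fs i \<in> Lam q n" using fs by (auto simp: represents_def)
      moreover have "feval (fs i) = act (ofA a) (XX i)"
        using compose_XX[OF fs i] act_ofA[OF X_R[OF i]] by simp
      ultimately have "lam_eval (fs i) x = 0" using \<theta>_feval \<theta>_J X_R[OF i] by (metis imageI)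
      then show "\<Phi> a x $ i = 0\<^sub>v n $ i" using fs xF i by (simp add: represents_def)
    qed
    then have xV: "x \<in> V" using xF by (simp add: V_def)
    have "ev x = y"
    proof
      fix b
      show "ev x b = y b"
      proof (cases "b \<in> B")
        case True
        then obtain f where f: "f \<in> Lam q n" "b = feval f" using B(3) by (auto simp: R_def)
        have "(\<Sum>b'\<in>B. sc (if b' = b then 1 else 0) b') = (\<Sum>b'\<in>B. if b' = b then b else 0)"
          by (intro sum.cong) auto
        then have "coord b (\<lambda>b'. if b' = b then 1 else 0)"
          using True B(1) J_0 by (simp add: coord_def)
        from \<theta>_eq[OF this] have "\<theta> b = y b"
          using True B(1) by (simp add: if_distrib[of "\<lambda>c. c * _"] cong: if_cong)
        moreover have "b x = lam_eval f x" unfolding f(2) using xF by (simp add: feval_def)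
        ultimately show ?thesis using \<theta>_feval[OF f(1)] f(2) True by (simp add: ev_def)
      qed (use y in \<open>auto simp: ev_def PiE_def extensional_def\<close>)
    qed
    then show "y \<in> ev ` V" using xV by blast
  qed
  then have "card V = card ?Y" by (rule bij_betw_same_card)
  also have "\<dots> = q ^ (r * degree a)" by (simp add: card_PiE B(1,2) card_frobenius_fixed)
  finally show ?thesis by (simp add: V_def)
qed

text \<open>Comaximality with \<open>P\<close> is a condition at the roots of \<open>P\<close> in
  \<open>K\<close>, which are split off one by one. The constant depends on \<open>P\<close> alone,
  so that it can be chosen before \<open>a\<close>.\<close>

lemma comaximal_denominator:
  fixes P :: "'k poly"
  assumes "P \<noteq> 0"
  shows "\<exists>c. c \<noteq> 0 \<and> (\<forall>a. a \<noteq> 0 \<longrightarrow> comaximal a c \<longrightarrow> comaximal P (ofA a))"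
  using assms
proof (induction "degree P" arbitrary: P)
  case 0
  then obtain k where k: "P = [:k:]" "k \<noteq> 0" by (metis degree_eq_zeroE pCons_0_0)
  have "comaximal P b" for b
    unfolding comaximal_def using k by (intro exI[of _ "[:inverse k:]"] exI[of _ 0]) (simp add: one_pCons)
  then show ?case by (intro exI[of _ 1]) simp
next
  case (Suc d)
  obtain \<alpha> where \<alpha>: "poly P \<alpha> = 0" using alg_closed_imp_poly_has_root[of P] Suc.hyps(2) by auto
  then obtain P' where P': "P = [:- \<alpha>, 1:] * P'" unfolding poly_eq_0_iff_dvd by (rule dvdE)
  then have "P' \<noteq> 0" using Suc.prems by auto
  moreover have "degree P = Suc (degree P')"
    unfolding P' using \<open>P' \<noteq> 0\<close> by (subst degree_mult_eq) auto
  ultimately obtain c where c: "c \<noteq> 0" "\<And>a. a \<noteq> 0 \<Longrightarrow> comaximal a c \<Longrightarrow> comaximal P' (ofA a)"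
    using Suc.hyps(1)[of P'] Suc.hyps(2) by auto
  have lin: "comaximal [:- \<alpha>, 1:] Q" if Q: "poly Q \<alpha> \<noteq> 0" for Q
  proof -
    define k where "k = [:inverse (poly Q \<alpha>):]"
    have "poly (Q - [:poly Q \<alpha>:]) \<alpha> = 0" by simp
    then obtain g where g: "Q - [:poly Q \<alpha>:] = [:- \<alpha>, 1:] * g" unfolding poly_eq_0_iff_dvd by (rule dvdE)
    have "k * Q - k * (Q - [:poly Q \<alpha>:]) = k * [:poly Q \<alpha>:]"
      unfolding right_diff_distrib by simp
    also have "\<dots> = 1" using Q by (simp add: k_def one_pCons)
    finally have "(- k * g) * [:- \<alpha>, 1:] + k * Q = 1"
      unfolding g by (simp only: mult_minus_left mult.assoc mult.commute[of g] uminus_add_conv_diff)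
    then show ?thesis unfolding comaximal_def by blast
  qed
  \<comment> \<open>For a root algebraic over \<open>\<F>\<^sub>q\<close> any nonzero annihilating
    polynomial serves, minimal or not. For a transcendental root the default 1 is enough, because
    only \<open>a = 0\<close> vanishes there; this is why \<open>a \<noteq> 0\<close> is required
    separately.\<close>
  define c' where "c' = (if \<exists>b. b \<noteq> 0 \<and> poly (ofA b) \<alpha> = 0 then SOME b. b \<noteq> 0 \<and> poly (ofA b) \<alpha> = 0 else 1)"
  have c': "c' \<noteq> 0" "(\<exists>b. b \<noteq> 0 \<and> poly (ofA b) \<alpha> = 0) \<Longrightarrow> poly (ofA c') \<alpha> = 0"
    unfolding c'_def using someI_ex[of "\<lambda>b. b \<noteq> 0 \<and> poly (ofA b) \<alpha> = 0"] by auto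
  have "comaximal P (ofA a)" if a: "a \<noteq> 0" "comaximal a (c' * c)" for a
  proof -
    obtain u v where uv: "u * a + v * (c' * c) = 1" using a(2) by (auto simp: comaximal_def)
    then have "u * a + (v * c) * c' = 1" "u * a + (v * c') * c = 1" by (simp_all add: ac_simps)
    then have "comaximal a c" "ofA u * ofA a + ofA (v * c) * ofA c' = 1"
      unfolding comaximal_def by (blast, metis ofA_1 ofA_add ofA_mult)
    then have "poly (ofA u * ofA a + ofA (v * c) * ofA c') \<alpha> = 1" by simp
    moreover have "poly (ofA c') \<alpha> = 0" if "poly (ofA a) \<alpha> = 0" using c'(2) a(1) that by blast
    ultimately have "poly (ofA a) \<alpha> \<noteq> 0" by auto
    then have "comaximal [:- \<alpha>, 1:] (ofA a)" by (rule lin)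
    then show ?thesis unfolding P' using c(2)[OF a(1) \<open>comaximal a c\<close>] by (rule comaximal_mult_left)
  qed
  then show ?case using c(1) c'(1) by (intro exI[of _ "c' * c"]) simp
qed

text \<open>The factor \<open>[:0, 1:]\<close> of \<open>c\<close> makes \<open>c\<close> a non-unit, so that \<open>0\<close> is not coprime to \<open>c\<close>.\<close>

theorem card_torsion_coprime:
  assumes basis: "poly_basis b r"
  obtains c where "c \<noteq> 0"
    "\<And>a. coprime a c \<Longrightarrow> a \<noteq> 0 \<and>
      (\<forall>d. d dvd a \<longrightarrow> card {x \<in> F. \<Phi> d x = 0\<^sub>v n} = q ^ (r * degree d))"
proof -
  interpret \<delta>: comm_ring_hom \<delta> using \<delta>_hom by (simp add: A_algebra_hom_to_K_def)
  obtain \<P> where P: "finite \<P>" "0 \<notin> \<P>"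
    and den: "\<And>a x. twist a = a \<Longrightarrow> \<forall>P\<in>\<P>. comaximal P a \<Longrightarrow> x \<in> R \<Longrightarrow>
      \<exists>P Q. comaximal P a \<and> act P x = (\<Sum>j<r. act (Q j) (b j))"
    by (rule denominators[OF basis], rule that)
  define k where "k P = (SOME c. c \<noteq> 0 \<and> (\<forall>a. a \<noteq> 0 \<longrightarrow> comaximal a c \<longrightarrow> comaximal P (ofA a)))" for P
  have k: "k P \<noteq> 0 \<and> (\<forall>a. a \<noteq> 0 \<longrightarrow> comaximal a (k P) \<longrightarrow> comaximal P (ofA a))" if "P \<in> \<P>" for P
  proof -
    have "P \<noteq> 0" using that P(2) by auto
    then show ?thesis unfolding k_def by (rule someI_ex[OF comaximal_denominator])
  qed
  \<comment> \<open>If \<delta> has a nonzero kernel, any nonzero element of it can be taken: what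
    is comaximal with such an element has nonzero image. If \<delta> is injective, 1 will
    do.\<close>
  have "\<exists>c. c \<noteq> 0 \<and> ((\<exists>a. a \<noteq> 0 \<and> \<delta> a = 0) \<longrightarrow> \<delta> c = 0)"
  proof (cases "\<exists>a. a \<noteq> 0 \<and> \<delta> a = 0")
    case False then show ?thesis by (intro exI[of _ 1]) simp
  qed blast
  then obtain c\<^sub>0 where c0: "c\<^sub>0 \<noteq> 0" "(\<exists>a. a \<noteq> 0 \<and> \<delta> a = 0) \<Longrightarrow> \<delta> c\<^sub>0 = 0" by blast
  define c where "c = [:0, 1:] * (c\<^sub>0 * (\<Prod>P\<in>\<P>. k P))"
  have "c \<noteq> 0" using c0 k P(1) by (auto simp: c_def)
  moreover have "a \<noteq> 0 \<and> (\<forall>d. d dvd a \<longrightarrow> card {x \<in> F. \<Phi> d x = 0\<^sub>v n} = q ^ (r * degree d))"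
    if a: "coprime a c" for a
  proof -
    have nz: "d \<noteq> 0" if "coprime d c" for d
    proof
      assume "d = 0"
      then have "c dvd 1" using that by simp
      then have "[:0, 1:] dvd (1 :: 'f poly)" unfolding c_def by (rule dvd_mult_left)
      then show False by (auto simp: is_unit_iff_degree)
    qed
    have "card {x \<in> F. \<Phi> d x = 0\<^sub>v n} = q ^ (r * degree d)" if "d dvd a" for d
    proof -
      \<comment> \<open>Coprimality to \<open>c\<close> is inherited by divisors, which is how the
        count for one \<open>a\<close> extends to all divisors.\<close>
      have cop: "coprime d c" using a \<open>d dvd a\<close> by (meson coprime_def dvd_trans)
      then have max: "comaximal d c" by (rule coprime_imp_comaximal)
      have d: "d \<noteq> 0" using nz cop by blast
      have "\<delta> d \<noteq> 0"
      proof
        assume \<delta>d: "\<delta> d = 0"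
        have "comaximal d c\<^sub>0" 
          using max by (rule comaximal_dvd_right) (unfold c_def, intro dvd_mult dvd_triv_left)
        then obtain u v where "u * d + v * c\<^sub>0 = 1" by (auto simp: comaximal_def)
        then have "\<delta> u * \<delta> d + \<delta> v * \<delta> c\<^sub>0 = 1" by (metis \<delta>.hom_add \<delta>.hom_mult \<delta>.hom_one)
        moreover have "\<delta> c\<^sub>0 = 0" using \<delta>d d by (intro c0(2) exI[of _ d]) simp
        ultimately show False using \<delta>d by simp
      qed
      moreover have "\<forall>P\<in>\<P>. comaximal P (ofA d)"
      proof
        fix P assume "P \<in> \<P>"
        then have "k P dvd c" unfolding c_def using P(1) by (intro dvd_mult dvd_prodI)
        then have "comaximal d (k P)" using max comaximal_dvd_right by blast
        then show "comaximal P (ofA d)" using k \<open>P \<in> \<P>\<close> d by blast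
      qed
      ultimately show ?thesis using card_torsion[OF basis d _ den[OF twist_ofA]] by blast
    qed
    then show ?thesis using nz[OF a] by blast
  qed
  ultimately show thesis using that by blast
qed

text \<open>The counts for all divisors provide a basis of the torsion over \<open>A/aA\<close>; the
  isomorphism is the inverse of forming linear combinations of this basis.\<close>

theorem torsion_isomorphic:
  assumes a: "a \<noteq> 0"
    and card: "\<And>d. d dvd a \<Longrightarrow> card {x \<in> F. \<Phi> d x = 0\<^sub>v n} = q ^ (r * degree d)"
  shows "module_isomorphic class_ring (Tor n F \<Phi> a)
      (module_power (quotient_module class_ring (genideal class_ring {a})) r)"
proof -
  define I where "I = genideal class_ring {a}"
  have I: "ideal I class_ring" unfolding I_def by (rule ring.genideal_ideal[OF class_ring.ring_axioms]) simp
  have I_iff: "x \<in> I \<longleftrightarrow> a dvd x" for x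
  proof -
    have "I = PIdl\<^bsub>class_ring\<^esub> a" unfolding I_def 
      using cring.cgenideal_eq_genideal[OF class_cring.cring_axioms, of a] by simp
    then show ?thesis by (auto simp: cgenideal_def dvd_def mult.commute)
  qed
  define cos where "cos x = I +>\<^bsub>class_ring\<^esub> x" for x
  have cos_eq: "cos x = cos y \<longleftrightarrow> a dvd x - y" for x y
    using ring.quotient_eq_iff_same_a_r_cos[OF class_ring.ring_axioms I, of x y]
    by (simp add: cos_def I_iff class_ring_simps)
  have cos_add: "set_add class_ring (cos x) (cos y) = cos (x + y)" for x y
    using ideal.a_rcos_sum[OF I, of x y] by (simp add: cos_def)
  have cos_mult: "rcoset_mult class_ring I (cos x) (cos y) = cos (x * y)" for x y
    using ideal.rcoset_mult_add[OF I, of x y] by (simp add: cos_def)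
  have cos_range: "a_rcosets\<^bsub>class_ring\<^esub> I = range cos"
    by (auto simp: A_RCOSETS_def' cos_def)
  let ?N = "module_power (quotient_module class_ring I) r"
  have N_carrier: "carrier ?N = {..<r} \<rightarrow>\<^sub>E range cos"
    by (simp add: module_power_def quotient_module_def FactRing_def cos_range)
  have N_add: "u \<oplus>\<^bsub>?N\<^esub> v = (\<lambda>i\<in>{..<r}. set_add class_ring (u i) (v i))" for u v
    by (simp add: module_power_def quotient_module_def FactRing_def)
  have N_smult: "c \<odot>\<^bsub>?N\<^esub> v = (\<lambda>i\<in>{..<r}. rcoset_mult class_ring I (cos c) (v i))" for c v
    by (simp add: module_power_def quotient_module_def FactRing_def cos_def)
  \<comment> \<open>Vectors of varying dimension do not form a group under addition, so
    \<open>F\<close> is transported into functions on the naturals before the results on torsion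
    modules are applied.\<close>
  define toF :: "'k vec \<Rightarrow> nat \<Rightarrow> 'k" where "toF x = (\<lambda>i. if i < n then x $ i else 0)" for x
  define fact where "fact c y = toF (\<Phi> c (vec n y))" for c y
  have of_to: "vec n (toF x) = x" if "x \<in> F" for x
    using F_dim[OF that] by (intro eq_vecI) (auto simp: toF_def)
  have toF_inj: "x = y" if "toF x = toF y" "x \<in> F" "y \<in> F" for x y
    using of_to that by metis
  have toF_add: "toF (x + y) = toF x + toF y" if "x \<in> F" "y \<in> F" for x y
    using F_dim that by (auto simp: toF_def fun_eq_iff)
  have toF_0: "toF (0\<^sub>v n) = 0" by (auto simp: toF_def fun_eq_iff)
  have fact_toF: "fact c (toF x) = toF (\<Phi> c x)" if "x \<in> F" for c x
    using of_to[OF that] by (simp add: fact_def)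
  interpret M: poly_module "toF ` F" fact
  proof unfold_locales
    show "0 \<in> toF ` F" using F_0 toF_0 by (metis imageI)
    show "x + y \<in> toF ` F" if "x \<in> toF ` F" "y \<in> toF ` F" for x y
      using that toF_add F_add by (metis (no_types, lifting) imageE imageI)
  qed (auto simp: fact_toF \<Phi>_F \<Phi>_plus \<Phi>_mult \<Phi>_1 \<Phi>_add F_add toF_add[symmetric])
  have tors: "M.tors d = toF ` {x \<in> F. \<Phi> d x = 0\<^sub>v n}" for d
  proof -
    have "toF x = 0 \<longleftrightarrow> x = 0\<^sub>v n" if "x \<in> F" for x
      using toF_inj[OF _ that F_0] toF_0 by auto
    then show ?thesis using \<Phi>_F by (auto simp: M.tors_def fact_toF toF_0)
  qed
  have card_tors: "card (M.tors d) = card (UNIV :: 'f set) ^ (r * degree d)" if "d dvd a" for d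
  proof -
    have "inj_on toF {x \<in> F. \<Phi> d x = 0\<^sub>v n}" using toF_inj by (auto intro: inj_onI)
    then show ?thesis using card[OF that] by (simp add: tors card_image card_f)
  qed
  obtain v where v: "M.free_family a v r"
    and gen: "\<And>x. x \<in> M.tors a \<Longrightarrow> \<exists>b. x = (\<Sum>j<r. fact (b j) (v j))"
    by (rule M.free_basis_exists[OF finite_f a card_tors], assumption, rule that)
  have vt: "v j \<in> M.tors a" if "j < r" for j using v that by (auto simp: M.free_family_def)
  have vG: "v j \<in> toF ` F" if "j < r" for j using vt[OF that] by (rule M.tors_G)
  define S where "S b = (\<Sum>j<r. fact (b j) (v j))" for b
  have S_add: "S (\<lambda>j. b j + c j) = S b + S c" for b c
    unfolding S_def sum.distrib[symmetric] by (intro sum.cong refl M.act_add_left vG) auto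
  have S_mult: "fact c (S b) = S (\<lambda>j. c * b j)" for b c
  proof -
    have "fact c (S b) = (\<Sum>j<r. fact c (fact (b j) (v j)))"
      unfolding S_def by (intro M.act_sum M.G_act vG) auto
    also have "\<dots> = S (\<lambda>j. c * b j)"
      unfolding S_def by (intro sum.cong refl M.act_mult[symmetric] vG) auto
    finally show ?thesis .
  qed
  have S_eq: "S b = S c \<longleftrightarrow> (\<forall>j<r. cos (b j) = cos (c j))" for b c
  proof
    assume eq: "S b = S c"
    have "(\<Sum>j<r. fact (b j - c j) (v j)) = S b - S c"
      unfolding S_def sum_subtractf[symmetric] by (intro sum.cong refl M.act_diff_left vG) auto
    then have z: "(\<Sum>j<r. fact (b j - c j) (v j)) = 0" using eq by simp
    show "\<forall>j<r. cos (b j) = cos (c j)" using M.free_familyD[OF v z] by (simp add: cos_eq)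
  next
    assume "\<forall>j<r. cos (b j) = cos (c j)"
    then show "S b = S c" unfolding S_def
      by (intro sum.cong refl M.act_cong_tors[OF vt]) (auto simp: cos_eq)
  qed
  have S_tors: "S b \<in> M.tors a" for b
  proof -
    have G: "S b \<in> toF ` F" unfolding S_def by (intro M.G_sum M.G_act vG) auto
    have "fact a (S b) = S (\<lambda>_. 0)" unfolding S_mult S_eq by (simp add: cos_eq)
    also have "\<dots> = 0" unfolding S_def by (intro sum.neutral ballI M.act_0_left vG) auto
    finally show ?thesis using G by (simp add: M.tors_def)
  qed
  \<comment> \<open>A choice of coefficients; by \<open>S_eq\<close> it is determined modulo
    \<open>a\<close>, which is all that \<open>h\<close> records.\<close>
  define \<beta> where "\<beta> x = (SOME b. toF x = S b)" for x
  have T: "carrier (Tor n F \<Phi> a) = {x \<in> F. \<Phi> a x = 0\<^sub>v n}" by (simp add: Tor_def)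
  have \<beta>: "toF x = S (\<beta> x)" if "x \<in> carrier (Tor n F \<Phi> a)" for x
  proof -
    have "toF x \<in> M.tors a" using that by (auto simp: T tors)
    then have "\<exists>b. toF x = S b" using gen unfolding S_def by blast
    then show ?thesis unfolding \<beta>_def by (rule someI_ex)
  qed
  define h where "h x = (\<lambda>j\<in>{..<r}. cos (\<beta> x j))" for x
  have h_eq: "h x = (\<lambda>j\<in>{..<r}. cos (b j))" if "x \<in> carrier (Tor n F \<Phi> a)" "toF x = S b" for x b
    using S_eq[of "\<beta> x" b] \<beta>[OF that(1)] that(2) by (auto simp: h_def fun_eq_iff restrict_def)
  have "h \<in> LinearCombinations.module_hom class_ring (Tor n F \<Phi> a) ?N"
    unfolding LinearCombinations.module_hom_def
  proof (intro CollectI conjI allI impI)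
    show "h \<in> carrier (Tor n F \<Phi> a) \<rightarrow> carrier ?N" unfolding N_carrier by (auto simp: h_def)
  next
    fix x y assume "x \<in> carrier (Tor n F \<Phi> a) \<and> y \<in> carrier (Tor n F \<Phi> a)"
    then have xy: "x \<in> carrier (Tor n F \<Phi> a)" "y \<in> carrier (Tor n F \<Phi> a)" by auto
    then have F: "x \<in> F" "y \<in> F" by (auto simp: T)
    have "x + y \<in> carrier (Tor n F \<Phi> a)" using xy by (auto simp: T F_add \<Phi>_add)
    moreover have "toF (x + y) = S (\<lambda>j. \<beta> x j + \<beta> y j)"
      using toF_add[OF F] \<beta>[OF xy(1)] \<beta>[OF xy(2)] by (simp add: S_add)
    ultimately have "h (x + y) = (\<lambda>j\<in>{..<r}. cos (\<beta> x j + \<beta> y j))" by (rule h_eq)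
    moreover have "h x \<oplus>\<^bsub>?N\<^esub> h y = (\<lambda>j\<in>{..<r}. cos (\<beta> x j + \<beta> y j))"
      by (simp add: N_add h_def fun_eq_iff restrict_def cos_add)
    ultimately have "h (x + y) = h x \<oplus>\<^bsub>?N\<^esub> h y" by simp
    then show "h (x \<oplus>\<^bsub>Tor n F \<Phi> a\<^esub> y) = h x \<oplus>\<^bsub>?N\<^esub> h y" by (simp add: Tor_def)
  next
    fix c :: "'f poly" and x assume "c \<in> carrier class_ring \<and> x \<in> carrier (Tor n F \<Phi> a)"
    then have x: "x \<in> carrier (Tor n F \<Phi> a)" by auto
    then have F: "x \<in> F" by (auto simp: T)
    have "\<Phi> a (\<Phi> c x) = \<Phi> c (\<Phi> a x)" using \<Phi>_mult[OF F] by (metis mult.commute)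
    moreover have "\<Phi> c (0\<^sub>v n) = 0\<^sub>v n"
      using M.act_0[of c] fact_toF[OF F_0] toF_0 toF_inj[OF _ \<Phi>_F[OF F_0] F_0] by simp
    ultimately have "\<Phi> c x \<in> carrier (Tor n F \<Phi> a)" using x by (auto simp: T \<Phi>_F)
    moreover have "toF (\<Phi> c x) = S (\<lambda>j. c * \<beta> x j)"
      using fact_toF[OF F, of c] \<beta>[OF x] by (simp add: S_mult)
    ultimately have "h (\<Phi> c x) = (\<lambda>j\<in>{..<r}. cos (c * \<beta> x j))" by (rule h_eq)
    moreover have "c \<odot>\<^bsub>?N\<^esub> h x = (\<lambda>j\<in>{..<r}. cos (c * \<beta> x j))"
      by (simp add: N_smult h_def fun_eq_iff restrict_def cos_mult)
    ultimately have "h (\<Phi> c x) = c \<odot>\<^bsub>?N\<^esub> h x" by simp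
    then show "h (c \<odot>\<^bsub>Tor n F \<Phi> a\<^esub> x) = c \<odot>\<^bsub>?N\<^esub> h x" by (simp add: Tor_def)
  qed
  moreover have "bij_betw h (carrier (Tor n F \<Phi> a)) (carrier ?N)"
    unfolding bij_betw_def
  proof (intro conjI equalityI subsetI)
    show "inj_on h (carrier (Tor n F \<Phi> a))"
    proof (rule inj_onI)
      fix x y assume xy: "x \<in> carrier (Tor n F \<Phi> a)" "y \<in> carrier (Tor n F \<Phi> a)" "h x = h y"
      have "cos (\<beta> x j) = cos (\<beta> y j)" if "j < r" for j
        using fun_cong[OF xy(3), of j] that by (simp add: h_def)
      then have "toF x = toF y" using \<beta> xy(1,2) S_eq by metis
      then show "x = y" using xy toF_inj by (auto simp: T)
    qed
    show "y \<in> carrier ?N" if "y \<in> h ` carrier (Tor n F \<Phi> a)" for y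
      using that unfolding N_carrier by (auto simp: h_def)
  next
    fix y assume y: "y \<in> carrier ?N"
    then have "\<forall>j. \<exists>b. j < r \<longrightarrow> y j = cos b" unfolding N_carrier by blast
    then obtain b where b: "\<And>j. j < r \<Longrightarrow> y j = cos (b j)" by metis
    obtain x where x: "x \<in> carrier (Tor n F \<Phi> a)" "S b = toF x"
      using S_tors[of b] unfolding tors T by blast
    have "h x = (\<lambda>j\<in>{..<r}. cos (b j))" using h_eq[OF x(1)] x(2) by simp
    also have "\<dots> = y"
    proof
      fix j
      show "(\<lambda>j\<in>{..<r}. cos (b j)) j = y j"
        using b y unfolding N_carrier by (cases "j < r") (auto simp: PiE_def extensional_def)
    qed
    finally show "y \<in> h ` carrier (Tor n F \<Phi> a)" using x(1) by blast
  qed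
  ultimately show ?thesis unfolding module_isomorphic_def I_def by blast
qed

section \<open>The rank\<close>

text \<open>A coset of \<open>M(F)\<close> consists of all polynomials with one and the same
  function on \<open>F\<close>. Passing to that function carries \<open>K{F}\<close> to
  \<open>R\<close> and its scalar multiplication to \<open>act\<close>, so the dimension count for
  \<open>R\<close> applies.\<close>

lemma A_rank_eq:
  assumes basis: "poly_basis b r"
  shows "A_rank q n F \<Phi> = r"
proof -
  have L_carrier: "f \<in> carrier_vec n" if "f \<in> Lam q n" for f :: "'k poly vec" using that by (simp add: Lam_def)
  have ev_add: "feval (f + g) = feval f + feval g" if "f \<in> Lam q n" "g \<in> Lam q n" for f g
    using LamD(1)[OF that(1)] LamD(1)[OF that(2)] by (auto simp: feval_def lam_eval_def fun_eq_iff sum.distrib)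
  have ev_diff: "feval (f - g) = feval f - feval g" if "f \<in> Lam q n" "g \<in> Lam q n" for f g
    using LamD(1)[OF that(1)] LamD(1)[OF that(2)] by (auto simp: feval_def lam_eval_def fun_eq_iff sum_subtractf)
  have van: "v \<in> vanishing q n F \<longleftrightarrow> v \<in> Lam q n \<and> feval v = 0" for v :: "'k poly vec"
    by (auto simp: vanishing_def feval_def fun_eq_iff)
  \<comment> \<open>The coset belonging to a function, as a fibre of \<open>feval\<close>; it
    inverts the passage from cosets to functions.\<close>
  define cls where "cls \<phi> = {f \<in> Lam q n. feval f = \<phi>}" for \<phi>
  have coset: "vanishing q n F +>\<^bsub>Lam_group q n\<^esub> f = cls (feval f)" if f: "f \<in> Lam q n" for f
  proof (intro equalityI subsetI)
    fix g assume "g \<in> vanishing q n F +>\<^bsub>Lam_group q n\<^esub> f"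
    then obtain v where "v \<in> vanishing q n F" "g = v + f" by (auto simp: a_r_coset_def' Lam_group_def)
    then show "g \<in> cls (feval f)" using f by (simp add: van cls_def Lam_add ev_add)
  next
    fix g assume "g \<in> cls (feval f)"
    then have g: "g \<in> Lam q n" "feval g = feval f" by (auto simp: cls_def)
    then have "g - f \<in> vanishing q n F" using f by (simp add: van Lam_diff ev_diff)
    moreover have "g = (g - f) + f" using L_carrier[OF g(1)] L_carrier[OF f] by auto
    ultimately show "g \<in> vanishing q n F +>\<^bsub>Lam_group q n\<^esub> f"
      unfolding a_r_coset_def' by (auto simp: Lam_group_def)
  qed
  let ?M = "K_of q n F \<Phi>"
  have M_carrier: "carrier ?M = cls ` R"
    using coset by (auto simp: K_of_def A_RCOSETS_def' Lam_group_def R_def)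
  have cls_ex: "\<exists>f. f \<in> Lam q n \<and> feval f = \<phi>" if "\<phi> \<in> R" for \<phi> using that by (auto simp: R_def)
  have M_add: "cls \<phi> \<oplus>\<^bsub>?M\<^esub> cls \<psi> = cls (\<phi> + \<psi>)" if R: "\<phi> \<in> R" "\<psi> \<in> R" for \<phi> \<psi>
  proof -
    obtain f where f: "f \<in> Lam q n" "feval f = \<phi>" using cls_ex[OF R(1)] by blast
    have "cls \<phi> <+>\<^bsub>Lam_group q n\<^esub> cls \<psi> = cls (\<phi> + \<psi>)"
    proof (intro equalityI subsetI)
      fix z assume "z \<in> cls \<phi> <+>\<^bsub>Lam_group q n\<^esub> cls \<psi>"
      then show "z \<in> cls (\<phi> + \<psi>)" by (auto simp: set_add_def' Lam_group_def cls_def Lam_add ev_add)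
    next
      fix z assume z: "z \<in> cls (\<phi> + \<psi>)"
      then have "z - f \<in> cls \<psi>" using f by (simp add: cls_def Lam_diff ev_diff)
      moreover have "z = f + (z - f)" using L_carrier[OF f(1)] L_carrier[of z] z by (auto simp: cls_def)
      moreover have "f \<in> cls \<phi>" using f by (simp add: cls_def)
      ultimately show "z \<in> cls \<phi> <+>\<^bsub>Lam_group q n\<^esub> cls \<psi>" unfolding set_add_def' by (auto simp: Lam_group_def)
    qed
    then show ?thesis by (simp add: K_of_def)
  qed
  have TT_pow: "(TT ^^ i) \<phi> x = \<phi> ((\<Phi> [:0, 1:] ^^ i) x)" if "x \<in> F" for i \<phi> x
    using that
  proof (induction i arbitrary: x)
    case (Suc i)
    have "(TT ^^ Suc i) \<phi> x = (TT ^^ i) \<phi> (\<Phi> [:0, 1:] x)"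
      using Suc.prems by (simp only: funpow.simps comp_apply TT_def[of "(TT ^^ i) \<phi>"] if_True)
    also have "\<dots> = \<phi> ((\<Phi> [:0, 1:] ^^ i) (\<Phi> [:0, 1:] x))" using Suc \<Phi>_F by blast
    finally show ?case by (simp add: funpow_swap1)
  qed simp
  have M_smult: "P \<odot>\<^bsub>?M\<^esub> cls \<phi> = cls (act P \<phi>)" if \<phi>: "\<phi> \<in> R" for P \<phi>
  proof -
    have pow_F: "(\<Phi> [:0, 1:] ^^ i) x \<in> F" if "x \<in> F" for i x
      by (induction i) (use that \<Phi>_F in auto)
    have act_eq: "act P \<phi> x = (\<Sum>i\<le>degree P. coeff P i * lam_eval f ((\<Phi> [:0, 1:] ^^ i) x))"
      if "x \<in> F" "feval f = \<phi>" for x f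
      using that pow_F unfolding act_def sum_fun_apply
      by (intro sum.cong refl) (auto simp: sc_apply TT_pow feval_def)
    have out: "act P \<phi> x = 0" if "x \<notin> F" for x using R_outside[OF R_act[OF \<phi>] that] .
    have "P \<odot>\<^bsub>?M\<^esub> cls \<phi> = {g \<in> Lam q n. \<exists>f\<in>cls \<phi>. \<forall>x\<in>F. lam_eval g x = act P \<phi> x}"
      using act_eq by (auto simp: K_of_def cls_def)
    also have "\<dots> = cls (act P \<phi>)"
      using cls_ex[OF \<phi>] out by (auto simp: cls_def feval_def fun_eq_iff)
    finally show ?thesis .
  qed
  define h where "h C = feval (SOME f. f \<in> C)" for C
  have h: "h (cls \<phi>) = \<phi>" if "\<phi> \<in> R" for \<phi>
  proof -
    have "\<exists>f. f \<in> cls \<phi>" using cls_ex[OF that] by (auto simp: cls_def)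
    then have "(SOME f. f \<in> cls \<phi>) \<in> cls \<phi>" by (rule someI_ex)
    then show ?thesis by (simp add: h_def cls_def)
  qed
  have "vectorspace.dim (class_ring :: 'k poly fract ring)
      (extension_of_scalars class_ring class_ring to_fract ?M) = r"
  proof (rule extension_of_scalars_dim[OF _ _ _ basis])
    show "bij_betw h (carrier ?M) R"
      by (rule bij_betw_byWitness[of _ cls]) (auto simp: M_carrier h)
    show "x \<oplus>\<^bsub>?M\<^esub> y \<in> carrier ?M \<and> h (x \<oplus>\<^bsub>?M\<^esub> y) = h x + h y"
      if "x \<in> carrier ?M" "y \<in> carrier ?M" for x y
      using that by (auto simp: M_carrier M_add h subspace_add[OF R_subspace])
    show "P \<odot>\<^bsub>?M\<^esub> x \<in> carrier ?M \<and> h (P \<odot>\<^bsub>?M\<^esub> x) = act P (h x)" if "x \<in> carrier ?M" for P x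
      using that by (auto simp: M_carrier M_smult h R_act)
  qed
  then show ?thesis by (simp add: A_rank_def)
qed

end

theorem theorem7p7:
  fixes p q e n :: nat
    and \<iota> :: "'f::field \<Rightarrow> 'k::alg_closed_field"
    and \<delta> :: "'f poly \<Rightarrow> 'k"
    and F :: "'k vec set"
    and \<Phi> :: "'f poly \<Rightarrow> 'k vec \<Rightarrow> 'k vec"
  assumes "prime p" and "CHAR('k) = p"
    and "e \<ge> 1" and "q = p ^ e"
    and "card (UNIV :: 'f set) = q" and "field_hom \<iota>"
    and "A_algebra_hom_to_K \<iota> \<delta>"
    and "q_variety q n F"
    and "A_module_structure q \<iota> \<delta> n F \<Phi>"
  shows "\<exists>c :: 'f poly. c \<noteq> 0 \<and> (\<forall>a. coprime a c \<longrightarrow>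
    module_isomorphic class_ring (Tor n F \<Phi> a)
      (module_power (quotient_module class_ring (genideal class_ring {a})) (A_rank q n F \<Phi>)))"
proof -
  interpret A_module p q e n \<iota> \<delta> F \<Phi> by (rule A_module.intro) (use assms in auto)
  obtain b r where basis: "poly_basis b r" using poly_basis_exists by blast
  obtain c where c: "c \<noteq> 0" "\<And>a. coprime a c \<Longrightarrow> a \<noteq> 0 \<and>
      (\<forall>d. d dvd a \<longrightarrow> card {x \<in> F. \<Phi> d x = 0\<^sub>v n} = q ^ (r * degree d))"
    using card_torsion_coprime[OF basis] by blast
  have "module_isomorphic class_ring (Tor n F \<Phi> a)
      (module_power (quotient_module class_ring (genideal class_ring {a})) (A_rank q n F \<Phi>))"
    if "coprime a c" for a
    unfolding A_rank_eq[OF basis] using c(2)[OF that] by (intro torsion_isomorphic) auto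
  then show ?thesis using c(1) by blast
qed

end
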